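(* Suppose $K$ satisfies (K1), (K2) and (K3). Then there exists a constant $M_0>0$, depending only on $d$, $s$, $\lambda$ and $\Lambda$, such that for every direction $\omega\in\mathbb R^d\setminus\{0\}$ there is a class A minimal surface $E_\omega$ for $\mathrm{Per}_K$ with $$\Big\{x\in\mathbb R^d:\tfrac{\omega}{|\omega|}\cdot x<-M_0\Big\}\subset E_\omega\subset\Big\{x\in\mathbb R^d:\tfrac{\omega}{|\omega|}\cdot x\le M_0\Big\}.$$
   Context: $d\ge2$; $|\cdot|$ denotes the $\ell^1$ norm on $\mathbb R^d$ (also in $\omega/|\omega|$). $K:\mathbb R^d\times\mathbb R^d\to[0,+\infty]$ is measurable and satisfies (K1) $K(x,y)=K(y,x)$ for a.e. $x,y$; (K2) $\lambda|x-y|^{-d-s}\le K(x,y)\le\Lambda|x-y|^{-d-s}$ for a.e. $x,y$, for some $s\in(0,1)$, $\Lambda\ge\lambda>0$; (K3) $K(x+z,y+z)=K(x,y)$ for all $z\in\mathbb Z^d$ and a.e. $x,y$. For measurable $A,B$, $L_K(A,B):=\int_A\int_BK(x,y)\,dx\,dy$. For open $\Omega$ and measurable $E$, $\mathrm{Per}_K(E;\Omega):=L_K(E\cap\Omega,\Omega\setminus E)+L_K(E\cap\Omega,\mathbb R^d\setminus(E\cup\Omega))+L_K(E\setminus\Omega,\Omega\setminus E)$. $E$ is a minimizer for $\mathrm{Per}_K$ in $\Omega$ if $\mathrm{Per}_K(E;\Omega)<\infty$ and $\mathrm{Per}_K(E;\Omega)\le\mathrm{Per}_K(F;\Omega)$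 for every measurable $F$ with $F\setminus\Omega=E\setminus\Omega$; a class A minimal surface if it is a minimizer in every bounded open $\Omega\subset\mathbb R^d$. *)

theory Defs
  imports "HOL-Analysis.Analysis"
begin

text \<open>The l1 norm on R^d (as in the paper, |.| denotes the l1 norm).\<close>
definition l1norm :: "real ^ 'n \<Rightarrow> real" where
  "l1norm x = (\<Sum>i\<in>UNIV. \<bar>x $ i\<bar>)"

definition lebesgue2 :: "((real ^ 'n) \<times> (real ^ 'n)) measure" where
  "lebesgue2 = completion (lborel \<Otimes>\<^sub>M lborel)"

definition kernel_ok ::
  "real \<Rightarrow> real \<Rightarrow> real \<Rightarrow> (real ^ 'n \<Rightarrow> real ^ 'n \<Rightarrow> ennreal) \<Rightarrow> bool" where
  "kernel_ok s lam Lam K \<longleftrightarrow>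
     (\<lambda>p. K (fst p) (snd p)) \<in> borel_measurable lebesgue2 \<and>
     (AE p in lebesgue2. K (fst p) (snd p) = K (snd p) (fst p)) \<and>
     (AE p in lebesgue2.
        ennreal (lam * l1norm (fst p - snd p) powr (- (real CARD('n) + s))) \<le> K (fst p) (snd p) \<and>
        K (fst p) (snd p) \<le> ennreal (Lam * l1norm (fst p - snd p) powr (- (real CARD('n) + s)))) \<and>
     (\<forall>z::real^'n. (\<forall>i. z $ i \<in> \<int>) \<longrightarrow>
        (AE p in lebesgue2. K (fst p + z) (snd p + z) = K (fst p) (snd p)))"

definition LK :: "(real ^ 'n \<Rightarrow> real ^ 'n \<Rightarrow> ennreal) \<Rightarrow> (real ^ 'n) set \<Rightarrow> (real ^ 'n) set \<Rightarrow> ennreal" where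
  "LK K A B = (\<integral>\<^sup>+ p. indicator (A \<times> B) p * K (fst p) (snd p) \<partial>lebesgue2)"

definition PerK :: "(real ^ 'n \<Rightarrow> real ^ 'n \<Rightarrow> ennreal) \<Rightarrow> (real ^ 'n) set \<Rightarrow> (real ^ 'n) set \<Rightarrow> ennreal" where
  "PerK K E \<Omega> = LK K (E \<inter> \<Omega>) (\<Omega> - E) + LK K (E \<inter> \<Omega>) (UNIV - (E \<union> \<Omega>)) + LK K (E - \<Omega>) (\<Omega> - E)"

definition minimizer_in :: "(real ^ 'n \<Rightarrow> real ^ 'n \<Rightarrow> ennreal) \<Rightarrow> (real ^ 'n) set \<Rightarrow> (real ^ 'n) set \<Rightarrow> bool" where
  "minimizer_in K \<Omega> E \<longleftrightarrow> E \<in> sets lebesgue \<and> PerK K E \<Omega> < \<infinity> \<and>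
     (\<forall>F \<in> sets lebesgue. F - \<Omega> = E - \<Omega> \<longrightarrow> PerK K E \<Omega> \<le> PerK K F \<Omega>)"

definition classA_minimal :: "(real ^ 'n \<Rightarrow> real ^ 'n \<Rightarrow> ennreal) \<Rightarrow> (real ^ 'n) set \<Rightarrow> bool" where
  "classA_minimal K E \<longleftrightarrow> (\<forall>\<Omega>. open \<Omega> \<and> bounded \<Omega> \<longrightarrow> minimizer_in K \<Omega> E)"

end

theory Submission
  imports Defs
begin

text \<open>
  The cut energy of a set is submodular, so minimizers between two obstacles exist, and there is a
  least one, without any compactness. With obstacles \<open>{\<omega> \<bullet> x < a}\<close> and \<open>{\<omega> \<bullet> x < b}\<close> (replaced by
  unions of integer cubes), the least minimizers on growing domains increase to a set \<open>E\<close>, and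
  comparison with its integer translates gives the Birkhoff property: \<open>E + k \<subseteq> E\<close> whenever
  \<open>\<omega> \<bullet> k \<le> 0\<close>. No periodicity and hence no rationality of \<open>\<omega>\<close> is needed.

  Removing a cube of side \<open>R\<close> bounds the energy of \<open>E\<close> in it by \<open>R^(d-s)\<close>, while \<open>R^d\<close> disjoint
  subcubes in which both \<open>E\<close> and its complement have positive density would cost \<open>R^d\<close>. So a wide
  strip contains a cube almost inside or almost outside \<open>E\<close>; a De Giorgi iteration makes it clean, and
  by the Birkhoff property \<open>E\<close> stays at a universal distance from one of the obstacles. That obstacle
  can be moved to infinity. The other one is inactive as well, because an energetically favourable
  push across it could be repeated at \<open>N^(d-1)\<close> almost-periods in a cube of side \<open>N\<close>, whereas
  translating \<open>E\<close> inside this cube costs only \<open>N^(d-1-s)\<close>.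
\<close>

text \<open>The width of the strip is fixed by one numerical inequality between powers of the scale
  \<open>m\<close>, before the kernel and \<omega> are given; this makes the bound uniform. Later
  constants may depend on the minimizer, because they serve only a proof by contradiction that an
  obstacle is inactive.

  A perimeter is the measure, with density \<open>K\<close>, of a set of pairs. Submodularity and
  semicontinuity are then pointwise facts about indicators, and the singularity of \<open>K\<close>
  is met by averaging over the radii of concentric cubes: two points are separated only by radii in
  an interval no longer than their distance, which gains one power and is integrable for
  \<open>s < 1\<close>. The sup norm replaces the given norm because its balls are cubes.

  An almost-period \<open>k\<close> with \<omega> \<bullet> k close to 0 need not move
  \<open>E\<close> by little, since the ordered family of integer translates may jump. Before the
  last obstacle is removed, \<open>E\<close> is therefore replaced by a union of translates
  approaching it from below; this version is continuous from the side that is needed.\<close>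

lemma suminf_geometric_ennreal:
  fixes a r :: real
  assumes "0 \<le> a" "0 \<le> r" "r < 1"
  shows "(\<Sum>j. ennreal (a * r ^ j)) = ennreal (a / (1 - r))"
proof -
  have "(\<lambda>j. a * r ^ j) sums (a * (1 / (1 - r)))"
    using assms by (intro sums_mult geometric_sums) auto
  then show ?thesis
    using assms by (subst suminf_ennreal_eq[where x = "a * (1 / (1 - r))"]) auto
qed

subsection \<open>Power weights and cubes\<close>

lemma ennreal_le_suminf: "f j \<le> (\<Sum>j. f j)" for f :: "nat \<Rightarrow> ennreal"
  using sum_le_suminf[of f "{j}"] by simp

lemma two_powr_less_one: "a < 0 \<Longrightarrow> 2 powr a < (1::real)"
  using powr_less_mono[of a 0 2] by simp

text \<open>Dyadic layers: where \<open>u\<close> is comparable to \<open>t j\<close> the weight is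
  at most \<open>t (Suc j) powr - q\<close> and the volume at most \<open>C * t j powr m\<close>, so
  the layers form a geometric series of ratio \<open>2 powr (q - m)\<close>.\<close>

lemma nn_integral_powr_near:
  fixes u :: "'a \<Rightarrow> real"
  assumes u[measurable]: "u \<in> borel_measurable M" and qm: "0 \<le> q" "q < m" and T: "0 < T" and C: "0 \<le> C"
    and vol: "\<And>t. 0 < t \<Longrightarrow> t \<le> T \<Longrightarrow> emeasure M {x \<in> space M. u x \<le> t} \<le> ennreal (C * t powr m)"
  shows "(\<integral>\<^sup>+x. ennreal (u x powr - q) * indicator {x. 0 < u x \<and> u x \<le> T} x \<partial>M)
      \<le> ennreal (C * 2 powr q / (1 - 2 powr (q - m)) * T powr (m - q))"
proof -
  define t where "t j = T * 2 powr - real j" for j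
  have t_pos: "0 < t j" "t j \<le> T" for j
    using T by (auto simp: t_def powr_minus_divide divide_simps ge_one_powr_ge_zero)
  have "(\<integral>\<^sup>+x. ennreal (u x powr - q) * indicator {x. 0 < u x \<and> u x \<le> T} x \<partial>M)
      \<le> (\<integral>\<^sup>+x. (\<Sum>j. ennreal (t (Suc j) powr - q) * indicator {x\<in>space M. u x \<le> t j} x) \<partial>M)"
  proof (intro nn_integral_mono)
    fix x assume x: "x \<in> space M"
    show "ennreal (u x powr - q) * indicator {x. 0 < u x \<and> u x \<le> T} x
       \<le> (\<Sum>j. ennreal (t (Suc j) powr - q) * indicator {x\<in>space M. u x \<le> t j} x)"
    proof (cases "0 < u x \<and> u x \<le> T")
      case True
      \<comment> \<open>The index is chosen with
        \<open>t (Suc j) \<le> u x \<le> t j\<close>.\<close>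
      define j where "j = nat \<lfloor>log 2 (T / u x)\<rfloor>"
      have ge: "0 \<le> log 2 (T / u x)" using True T by (simp add: zero_le_log_cancel_iff)
      have j: "real j \<le> log 2 (T / u x)" "log 2 (T / u x) < real j + 1"
        using ge unfolding j_def by linarith+
      have "2 powr real j \<le> T / u x"
        using j(1) True T by (subst (asm) le_log_iff) auto
      then have 1: "u x \<le> t j" using True by (simp add: t_def powr_minus field_simps)
      have "T / u x < 2 powr (real j + 1)"
        using j(2) True T by (subst (asm) log_less_iff) auto
      then have 2: "t (Suc j) \<le> u x"
        using True by (simp add: t_def powr_minus field_simps powr_diff powr_add)
      have "u x powr - q \<le> t (Suc j) powr - q"
        using 2 t_pos(1)[of "Suc j"] qm by (intro powr_mono2') auto
      then have "ennreal (u x powr - q) * indicator {x. 0 < u x \<and> u x \<le> T} x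
         \<le> ennreal (t (Suc j) powr - q) * indicator {x\<in>space M. u x \<le> t j} x"
        using 1 True x by (auto intro!: ennreal_leI)
      also have "\<dots> \<le> (\<Sum>j. ennreal (t (Suc j) powr - q) * indicator {x\<in>space M. u x \<le> t j} x)"
        by (rule ennreal_le_suminf)
      finally show ?thesis .
    qed auto
  qed
  also have "\<dots> = (\<Sum>j. ennreal (t (Suc j) powr - q) * emeasure M {x\<in>space M. u x \<le> t j})"
    by (subst nn_integral_suminf) (auto simp: nn_integral_cmult)
  also have "\<dots> \<le> (\<Sum>j. ennreal ((C * 2 powr q * T powr (m - q)) * (2 powr (q - m)) ^ j))"
  proof (intro suminf_le)
    fix j
    have "ennreal (t (Suc j) powr - q) * emeasure M {x\<in>space M. u x \<le> t j}
       \<le> ennreal (t (Suc j) powr - q) * ennreal (C * t j powr m)"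
      using t_pos by (intro mult_left_mono vol) auto
    also have "\<dots> = ennreal (t (Suc j) powr - q * (C * t j powr m))"
      using C by (simp add: ennreal_mult')
    also have "t (Suc j) powr - q * (C * t j powr m)
        = C * (T powr - q * T powr m) * (2 powr (q * real (Suc j)) * 2 powr (- real j * m))"
      using T by (simp add: t_def powr_mult powr_powr algebra_simps del: of_nat_Suc)
    also have "\<dots> = C * T powr (m - q) * (2 powr q * 2 powr ((q - m) * real j))"
      by (simp add: powr_add[symmetric] algebra_simps)
    also have "\<dots> = (C * 2 powr q * T powr (m - q)) * (2 powr (q - m)) ^ j"
      by (simp add: powr_realpow[symmetric] powr_powr)
    finally show "ennreal (t (Suc j) powr - q) * emeasure M {x\<in>space M. u x \<le> t j} \<le> \<dots>" .
  qed auto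
  also have "\<dots> = ennreal ((C * 2 powr q * T powr (m - q)) / (1 - 2 powr (q - m)))"
    using C qm by (intro suminf_geometric_ennreal) (auto simp: two_powr_less_one)
  finally show ?thesis by simp
qed

text \<open>The same dyadic sum outwards. The measure is arbitrary because the lemma is applied both
  to Lebesgue measure, of growth exponent \<open>d\<close>, and to its restriction to a thin layer,
  of growth exponent \<open>d - 1\<close>.\<close>

lemma nn_integral_powr_tail:
  fixes u :: "'a \<Rightarrow> real"
  assumes u[measurable]: "u \<in> borel_measurable M" and qm: "0 \<le> m" "m < q" and T: "0 < T" and C: "0 \<le> C"
    and vol: "\<And>t. T \<le> t \<Longrightarrow> emeasure M {x \<in> space M. u x \<le> t} \<le> ennreal (C * t powr m)"
  shows "(\<integral>\<^sup>+x. ennreal (u x powr - q) * indicator {x. T \<le> u x} x \<partial>M)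
      \<le> ennreal (C * 2 powr m / (1 - 2 powr (m - q)) * T powr (m - q))"
proof -
  define t where "t j = T * 2 powr real j" for j
  have t_pos: "0 < t j" "T \<le> t j" for j
    using T by (auto simp: t_def ge_one_powr_ge_zero)
  have "(\<integral>\<^sup>+x. ennreal (u x powr - q) * indicator {x. T \<le> u x} x \<partial>M)
      \<le> (\<integral>\<^sup>+x. (\<Sum>j. ennreal (t j powr - q) * indicator {x\<in>space M. u x \<le> t (Suc j)} x) \<partial>M)"
  proof (intro nn_integral_mono)
    fix x assume x: "x \<in> space M"
    show "ennreal (u x powr - q) * indicator {x. T \<le> u x} x
       \<le> (\<Sum>j. ennreal (t j powr - q) * indicator {x\<in>space M. u x \<le> t (Suc j)} x)"
    proof (cases "T \<le> u x")
      case True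
      define j where "j = nat \<lfloor>log 2 (u x / T)\<rfloor>"
      have ge: "0 \<le> log 2 (u x / T)" using True T by (simp add: zero_le_log_cancel_iff)
      have j: "real j \<le> log 2 (u x / T)" "log 2 (u x / T) < real j + 1"
        using ge unfolding j_def by linarith+
      have "2 powr real j \<le> u x / T"
        using j(1) True T by (subst (asm) le_log_iff) auto
      then have 1: "t j \<le> u x" using T by (simp add: t_def field_simps)
      have "u x / T < 2 powr (real j + 1)"
        using j(2) True T by (subst (asm) log_less_iff) auto
      then have 2: "u x \<le> t (Suc j)"
        using T by (simp add: t_def field_simps powr_add)
      have "u x powr - q \<le> t j powr - q"
        using 1 t_pos(1)[of "j"] qm by (intro powr_mono2') auto
      then have "ennreal (u x powr - q) * indicator {x. T \<le> u x} x
         \<le> ennreal (t j powr - q) * indicator {x\<in>space M. u x \<le> t (Suc j)} x"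
        using 2 True x by (auto intro!: ennreal_leI)
      also have "\<dots> \<le> (\<Sum>j. ennreal (t j powr - q) * indicator {x\<in>space M. u x \<le> t (Suc j)} x)"
        by (rule ennreal_le_suminf)
      finally show ?thesis .
    qed auto
  qed
  also have "\<dots> = (\<Sum>j. ennreal (t j powr - q) * emeasure M {x\<in>space M. u x \<le> t (Suc j)})"
    by (subst nn_integral_suminf) (auto simp: nn_integral_cmult)
  also have "\<dots> \<le> (\<Sum>j. ennreal ((C * 2 powr m * T powr (m - q)) * (2 powr (m - q)) ^ j))"
  proof (intro suminf_le)
    fix j
    have "ennreal (t j powr - q) * emeasure M {x\<in>space M. u x \<le> t (Suc j)}
       \<le> ennreal (t j powr - q) * ennreal (C * t (Suc j) powr m)"
      using t_pos by (intro mult_left_mono vol) auto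
    also have "\<dots> = ennreal (t j powr - q * (C * t (Suc j) powr m))"
      using C by (simp add: ennreal_mult')
    also have "t j powr - q * (C * t (Suc j) powr m)
        = C * (T powr - q * T powr m) * (2 powr (- q * real j) * 2 powr (real (Suc j) * m))"
      using T by (simp add: t_def powr_mult powr_powr algebra_simps del: of_nat_Suc)
    also have "\<dots> = C * T powr (m - q) * (2 powr m * 2 powr ((m - q) * real j))"
      by (simp add: powr_add[symmetric] algebra_simps)
    also have "\<dots> = (C * 2 powr m * T powr (m - q)) * (2 powr (m - q)) ^ j"
      by (simp add: powr_realpow[symmetric] powr_powr)
    finally show "ennreal (t j powr - q) * emeasure M {x\<in>space M. u x \<le> t (Suc j)} \<le> \<dots>" .
  qed auto
  also have "\<dots> = ennreal ((C * 2 powr m * T powr (m - q)) / (1 - 2 powr (m - q)))"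
    using C qm by (intro suminf_geometric_ennreal) (auto simp: two_powr_less_one)
  finally show ?thesis by simp
qed

text \<open>An open ball of the sup norm, so \<open>r\<close> is half the side. Such balls have
  exact volumes and tile space up to null sets.\<close>

definition cube :: "real^'n \<Rightarrow> real \<Rightarrow> (real^'n) set" where
  "cube z r = {x. infnorm (x - z) < r}"

lemma infnorm_borel [measurable]: "(infnorm :: real^'n \<Rightarrow> real) \<in> borel_measurable borel"
  by (intro borel_measurable_continuous_onI continuous_intros)

lemma infnorm_less_iff_cart: "infnorm (x :: real^'n) < r \<longleftrightarrow> (\<forall>i. \<bar>x $ i\<bar> < r)"
proof -
  have "infnorm x = Max (range (\<lambda>i. \<bar>x $ i\<bar>))"
    unfolding infnorm_cart by (subst cSup_eq_Max) (auto simp: full_SetCompr_eq)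
  then show ?thesis by auto
qed

lemma infnorm_le_iff_cart: "infnorm (x :: real^'n) \<le> r \<longleftrightarrow> (\<forall>i. \<bar>x $ i\<bar> \<le> r)"
proof -
  have "infnorm x = Max (range (\<lambda>i. \<bar>x $ i\<bar>))"
    unfolding infnorm_cart by (subst cSup_eq_Max) (auto simp: full_SetCompr_eq)
  then show ?thesis by auto
qed

lemma cube_borel [measurable, simp]: "cube z r \<in> sets borel"
  unfolding cube_def by measurable

lemma cube_eq_box: "cube z r = box (z - (\<chi> i. r)) (z + (\<chi> i. r))"
  by (auto simp: cube_def infnorm_less_iff_cart mem_box_cart abs_less_iff algebra_simps)

lemma closed_cube_eq_cbox: "{x. infnorm (x - z) \<le> r} = cbox (z - (\<chi> i. r)) (z + (\<chi> i. r))"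
  by (auto simp: infnorm_le_iff_cart mem_box_cart abs_le_iff algebra_simps)

lemma prod_Basis_cart: "(\<Prod>b\<in>Basis. (\<chi> i::'n::finite. c) \<bullet> b) = (c::real) ^ CARD('n)"
proof -
  have "(\<Prod>b\<in>Basis. (\<chi> i::'n. c) \<bullet> b) = (\<Prod>b\<in>(Basis :: (real^'n) set). c)"
    by (intro prod.cong) (auto simp: Basis_vec_def inner_axis)
  then show ?thesis by simp
qed

lemma emeasure_cube:
  assumes "0 \<le> r"
  shows "emeasure lborel (cube (z::real^'n) r) = ennreal ((2 * r) ^ CARD('n))"
proof -
  have "emeasure lborel (cube z r) = (\<Prod>b\<in>Basis. ((\<chi> i. 2 * r) :: real^'n) \<bullet> b)"
    unfolding cube_eq_box using assms
    by (subst emeasure_lborel_box)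
       (auto simp: Basis_vec_def inner_axis intro!: arg_cong[where f = ennreal] prod.cong)
  then show ?thesis by (simp add: prod_Basis_cart)
qed

lemma emeasure_closed_cube:
  assumes "0 \<le> r"
  shows "emeasure lborel {x::real^'n. infnorm (x - z) \<le> r} = ennreal ((2 * r) ^ CARD('n))"
proof -
  have "emeasure lborel {x::real^'n. infnorm (x - z) \<le> r} = (\<Prod>b\<in>Basis. ((\<chi> i. 2 * r) :: real^'n) \<bullet> b)"
    unfolding closed_cube_eq_cbox using assms
    by (subst emeasure_lborel_cbox)
       (auto simp: Basis_vec_def inner_axis intro!: arg_cong[where f = ennreal] prod.cong)
  then show ?thesis by (simp add: prod_Basis_cart)
qed

lemma cube_mono: "r \<le> r' \<Longrightarrow> cube z r \<subseteq> cube z r'"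
  by (auto simp: cube_def)

lemma cube_subset_cube: "infnorm (z - z') + r \<le> r' \<Longrightarrow> cube z r \<subseteq> cube z' r'"
proof
  fix x assume a: "infnorm (z - z') + r \<le> r'" "x \<in> cube z r"
  have "infnorm (x - z') \<le> infnorm (x - z) + infnorm (z - z')"
    using infnorm_triangle[of "x - z" "z - z'"] by simp
  with a show "x \<in> cube z' r'" by (auto simp: cube_def)
qed

lemma bounded_cube: "bounded (cube z r)"
  unfolding cube_eq_box by simp

lemma bounded_subset_cube:
  assumes "bounded (A :: (real^'n) set)"
  obtains R where "0 < R" "A \<subseteq> cube 0 R"
proof -
  obtain B where B: "\<And>x. x \<in> A \<Longrightarrow> norm x \<le> B" using assms by (auto simp: bounded_iff)
  have "A \<subseteq> cube 0 (\<bar>B\<bar> + 1)"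
    using B infnorm_le_norm by (fastforce simp: cube_def intro: le_less_trans)
  then show thesis using that[of "\<bar>B\<bar> + 1"] by auto
qed

lemma emeasure_cube_finite: "emeasure lborel (cube z r) < \<infinity>"
  using bounded_cube emeasure_bounded_finite by blast

text \<open>The summands come from \<open>nn_integral_powr_near\<close> with
  \<open>q = D + s - 1\<close> and from \<open>nn_integral_powr_tail\<close> with
  \<open>q = D + s\<close>, both for the volume growth \<open>2 powr D * t powr D\<close> of sup
  norm balls.\<close>

definition near_const :: "real \<Rightarrow> real \<Rightarrow> real" where
  "near_const D s = 2 powr D * 2 powr (D + s - 1) / (1 - 2 powr (s - 1)) + 2 powr D * 2 powr D / (1 - 2 powr (- s))"

lemma near_const_pos:
  assumes "0 < s" "s < 1" shows "0 < near_const D s"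
proof -
  have "2 powr (s - 1) < 1" "2 powr (- s) < 1" using assms by (auto simp: two_powr_less_one)
  then show ?thesis unfolding near_const_def by (intro add_pos_pos divide_pos_pos mult_pos_pos) auto
qed

text \<open>The factor \<open>min (infnorm h) T\<close> will be the length of a set of radii. Below
  \<open>T\<close> it lowers the singularity to the exponent \<open>D + s - 1 < D\<close>; above
  \<open>T\<close> it is constant and the exponent \<open>D + s > D\<close> gives decay. Both parts
  scale like \<open>T powr (1 - s)\<close>.\<close>

lemma nn_integral_powr_min:
  fixes s T :: real
  assumes s: "0 < s" "s < 1" and T: "0 < T"
  defines "D \<equiv> real CARD('n::finite)"
  shows "(\<integral>\<^sup>+h. ennreal (infnorm (h::real^'n) powr - (D + s) * min (infnorm h) T) \<partial>lborel)
       \<le> ennreal (near_const D s * T powr (1 - s))"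
proof -
  have D: "1 \<le> D" unfolding D_def by (simp add: Suc_leI)
  have vol: "emeasure lborel {x\<in>space lborel. infnorm (x::real^'n) \<le> t} \<le> ennreal (2 powr D * t powr D)" if "0 < t" for t
    using emeasure_closed_cube[of t "0::real^'n"] that
    by (simp add: D_def powr_realpow power_mult_distrib)
  have "(\<integral>\<^sup>+h. ennreal (infnorm (h::real^'n) powr - (D + s) * min (infnorm h) T) \<partial>lborel)
     \<le> (\<integral>\<^sup>+h. ennreal (infnorm (h::real^'n) powr - (D + s - 1)) * indicator {h. 0 < infnorm h \<and> infnorm h \<le> T} h
             + ennreal T * (ennreal (infnorm h powr - (D + s)) * indicator {h. T \<le> infnorm h} h) \<partial>lborel)"
  proof (intro nn_integral_mono)
    fix h :: "real^'n"
    show "ennreal (infnorm (h::real^'n) powr - (D + s) * min (infnorm h) T)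
      \<le> ennreal (infnorm h powr - (D + s - 1)) * indicator {h. 0 < infnorm h \<and> infnorm h \<le> T} h
             + ennreal T * (ennreal (infnorm h powr - (D + s)) * indicator {h. T \<le> infnorm h} h)"
    proof (cases "infnorm h \<le> T")
      case True
      show ?thesis
      proof (cases "infnorm h = 0")
        case False
        then have p: "0 < infnorm h" using infnorm_pos_le[of h] by linarith
        have "infnorm h powr - (D + s) * infnorm h = infnorm h powr - (D + s - 1)"
          using p by (simp add: powr_diff powr_minus powr_add field_simps)
        then show ?thesis using True p by (simp add: min_absorb1)
      qed auto
    next
      case False
      then show ?thesis by (simp add: min_absorb2 mult.commute ennreal_mult' T[THEN less_imp_le])
    qed
  qed
  also have "\<dots> = (\<integral>\<^sup>+h. ennreal (infnorm (h::real^'n) powr - (D + s - 1)) * indicator {h. 0 < infnorm h \<and> infnorm h \<le> T} h \<partial>lborel)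
      + ennreal T * (\<integral>\<^sup>+h. (ennreal (infnorm (h::real^'n) powr - (D + s)) * indicator {h. T \<le> infnorm h} h) \<partial>lborel)"
    by (subst nn_integral_add) (auto simp: nn_integral_cmult)
  also have "\<dots> \<le> ennreal (2 powr D * 2 powr (D + s - 1) / (1 - 2 powr (D + s - 1 - D)) * T powr (D - (D + s - 1)))
      + ennreal T * ennreal (2 powr D * 2 powr D / (1 - 2 powr (D - (D + s))) * T powr (D - (D + s)))"
    using s D T vol by (intro add_mono mult_left_mono nn_integral_powr_near nn_integral_powr_tail) auto
  also have "\<dots> = ennreal (near_const D s * T powr (1 - s))"
  proof -
    have "2 powr (s - 1) < 1" "2 powr (- s) < 1" using s by (auto simp: two_powr_less_one)
    moreover have "T * T powr (- s) = T powr (1 - s)" using T by (simp add: powr_diff powr_minus field_simps)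
    ultimately show ?thesis using T
      by (simp add: near_const_def ennreal_mult''[symmetric] ennreal_plus[symmetric] algebra_simps
            del: ennreal_plus)
  qed
  finally show ?thesis .
qed

subsection \<open>Translations and inclusion almost everywhere\<close>

lemma nn_integral_lborel_translate:
  fixes f :: "'a::euclidean_space \<Rightarrow> ennreal"
  assumes [measurable]: "f \<in> borel_measurable borel"
  shows "(\<integral>\<^sup>+x. f (c + x) \<partial>lborel) = (\<integral>\<^sup>+x. f x \<partial>lborel)"
proof -
  have "(\<integral>\<^sup>+x. f x \<partial>lborel) = (\<integral>\<^sup>+x. f x \<partial>distr lborel borel ((+) c))"
    by (simp add: lborel_distr_plus)
  also have "\<dots> = (\<integral>\<^sup>+x. f (c + x) \<partial>lborel)"
    by (subst nn_integral_distr) auto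
  finally show ?thesis ..
qed

lemma nn_integral_lborel_reflect:
  fixes f :: "'a::euclidean_space \<Rightarrow> ennreal"
  assumes [measurable]: "f \<in> borel_measurable borel"
  shows "(\<integral>\<^sup>+x. f (c - x) \<partial>lborel) = (\<integral>\<^sup>+x. f x \<partial>lborel)"
proof -
  have "(\<integral>\<^sup>+x. f x \<partial>lborel) = (\<integral>\<^sup>+x. f x \<partial>distr lborel borel (\<lambda>x. c + (- 1) *\<^sub>R x))"
    by (subst lborel_affine[of "-1" c]) (auto simp: density_1)
  also have "\<dots> = (\<integral>\<^sup>+x. f (c - x) \<partial>lborel)"
    by (subst nn_integral_distr) auto
  finally show ?thesis ..
qed

lemma nn_integral_lborel_swap:
  fixes f :: "'a::euclidean_space \<times> 'b::euclidean_space \<Rightarrow> ennreal"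
  assumes [measurable]: "f \<in> borel_measurable borel"
  shows "(\<integral>\<^sup>+p. f (snd p, fst p) \<partial>lborel) = (\<integral>\<^sup>+p. f p \<partial>lborel)"
proof -
  have [measurable]: "f \<in> borel_measurable (lborel \<Otimes>\<^sub>M lborel)" by (simp add: lborel_prod)
  have "(\<integral>\<^sup>+p. f p \<partial>lborel) = (\<integral>\<^sup>+p. f p \<partial>(lborel \<Otimes>\<^sub>M lborel))" by (simp add: lborel_prod)
  also have "\<dots> = (\<integral>\<^sup>+p. f p \<partial>distr (lborel \<Otimes>\<^sub>M lborel) (lborel \<Otimes>\<^sub>M lborel) (\<lambda>(x, y). (y, x)))"
    using lborel_pair.distr_pair_swap by metis
  also have "\<dots> = (\<integral>\<^sup>+p. f (snd p, fst p) \<partial>(lborel \<Otimes>\<^sub>M lborel))"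
    by (subst nn_integral_distr) (auto intro!: nn_integral_cong)
  finally show ?thesis by (simp add: lborel_prod)
qed

lemma nn_integral_lborel_pair:
  fixes f :: "'a::euclidean_space \<times> 'b::euclidean_space \<Rightarrow> ennreal"
  assumes [measurable]: "f \<in> borel_measurable borel"
  shows "(\<integral>\<^sup>+p. f p \<partial>lborel) = (\<integral>\<^sup>+x. \<integral>\<^sup>+y. f (x, y) \<partial>lborel \<partial>lborel)"
  by (subst lborel_prod[symmetric], subst lborel.nn_integral_fst) (auto simp: lborel_prod)

lemma AE_lborel_pair:
  fixes P :: "'a::euclidean_space \<Rightarrow> bool" and Q :: "'b::euclidean_space \<Rightarrow> bool"
  assumes "AE x in lborel. P x" "AE x in lborel. Q x"
  shows "AE p in lborel. P (fst p) \<and> Q (snd p)"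
proof -
  obtain N where N: "{x. \<not> P x} \<subseteq> N" "N \<in> null_sets lborel"
    using assms(1) by (auto simp: eventually_ae_filter)
  obtain N' where N': "{x. \<not> Q x} \<subseteq> N'" "N' \<in> null_sets lborel"
    using assms(2) by (auto simp: eventually_ae_filter)
  have "N \<times> UNIV \<in> null_sets (lborel \<Otimes>\<^sub>M lborel)" "UNIV \<times> N' \<in> null_sets (lborel \<Otimes>\<^sub>M lborel)"
    using N N' by (auto simp: null_sets_def lborel.emeasure_pair_measure_Times)
  then have "N \<times> UNIV \<union> UNIV \<times> N' \<in> null_sets lborel"
    by (intro null_sets.Un) (simp_all only: lborel_prod)
  moreover have "{p \<in> space lborel. \<not> (P (fst p) \<and> Q (snd p))} \<subseteq> N \<times> UNIV \<union> UNIV \<times> N'"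
    using N N' by auto
  ultimately show ?thesis by (rule AE_I')
qed

lemma power_diff_le:
  fixes x y :: real
  assumes "0 \<le> y" "y \<le> x"
  shows "x ^ n - y ^ n \<le> real n * x ^ (n - 1) * (x - y)"
proof -
  have "(\<Sum>i<n. y ^ (n - Suc i) * x ^ i) \<le> (\<Sum>i<n. x ^ (n - 1))"
  proof (intro sum_mono)
    fix i assume "i \<in> {..<n}"
    then have "n - 1 = (n - Suc i) + i" by auto
    moreover have "y ^ (n - Suc i) * x ^ i \<le> x ^ (n - Suc i) * x ^ i"
      using assms by (intro mult_right_mono power_mono) auto
    ultimately show "y ^ (n - Suc i) * x ^ i \<le> x ^ (n - 1)" by (metis power_add)
  qed
  then have "(x - y) * (\<Sum>i<n. y ^ (n - Suc i) * x ^ i) \<le> (x - y) * (\<Sum>i<n. x ^ (n - 1))"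
    using assms by (intro mult_left_mono) auto
  then show ?thesis by (simp add: power_diff_sumr2 algebra_simps)
qed

definition Zd :: "(real^'n) set" where "Zd = {k. \<forall>i. k $ i \<in> \<int>}"

lemma Zd_zero[simp]: "0 \<in> Zd" by (auto simp: Zd_def)
lemma Zd_add: "k \<in> Zd \<Longrightarrow> l \<in> Zd \<Longrightarrow> k + l \<in> Zd" by (auto simp: Zd_def)
lemma Zd_diff: "k \<in> Zd \<Longrightarrow> l \<in> Zd \<Longrightarrow> k - l \<in> Zd" by (auto simp: Zd_def)
lemma Zd_uminus: "k \<in> Zd \<Longrightarrow> - k \<in> Zd" by (auto simp: Zd_def)

definition translate :: "real^'n \<Rightarrow> (real^'n) set \<Rightarrow> (real^'n) set" where "translate k A = {x. x - k \<in> A}"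

lemma mem_translate [simp]: "x \<in> translate k A \<longleftrightarrow> x - k \<in> A" by (simp add: translate_def)
lemma translate_translate: "translate k (translate l A) = translate (k + l) A" by (auto simp: translate_def algebra_simps)
lemma translate_0[simp]: "translate 0 A = A" by (auto simp: translate_def)
lemma translate_Int: "translate k (A \<inter> B) = translate k A \<inter> translate k B" by (auto simp: translate_def)
lemma translate_Diff: "translate k (A - B) = translate k A - translate k B" by (auto simp: translate_def)
lemma translate_Compl: "translate k (- A) = - translate k A" by (auto simp: translate_def)
lemma translate_UNIV[simp]: "translate k UNIV = UNIV" by (auto simp: translate_def)
lemma translate_UN: "translate k (\<Union>i\<in>I. A i) = (\<Union>i\<in>I. translate k (A i))" by (auto simp: translate_def)
lemma translate_mono: "A \<subseteq> B \<Longrightarrow> translate k A \<subseteq> translate k B" by (auto simp: translate_def)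
lemma translate_borel [measurable, simp]: "A \<in> sets borel \<Longrightarrow> translate k A \<in> sets borel"
  using measurable_sets[of "\<lambda>x. x - k" borel borel A] by (simp add: translate_def vimage_def)
lemma translate_cube: "translate k (cube z r) = cube (z + k) r" by (auto simp: translate_def cube_def algebra_simps)

lemma AE_translate_iff:
  fixes P :: "'a::euclidean_space \<Rightarrow> bool"
  shows "(AE x in lborel. P (x - k)) \<longleftrightarrow> (AE x in lborel. P x)"
proof -
  have *: "AE x in lborel. P (x - k)" if a: "AE x in lborel. P x" for P :: "'a \<Rightarrow> bool" and k
  proof -
    have "AE x in distr lborel borel ((+) (- k)). P x" using a by (simp only: lborel_distr_plus)
    then have "AE x in lborel. P (- k + x)" by (rule AE_distrD[rotated]) auto
    then show ?thesis by simp
  qed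
  show ?thesis using *[of P k] *[of "\<lambda>x. P (x - k)" "- k"] by (intro iffI) simp_all
qed

lemma emeasure_translate: "A \<in> sets borel \<Longrightarrow> emeasure lborel (translate k A) = emeasure lborel A"
proof -
  assume [measurable]: "A \<in> sets borel"
  have "emeasure lborel A = emeasure (distr lborel borel ((+) (- k))) A" by (simp add: lborel_distr_plus)
  also have "\<dots> = emeasure lborel (translate k A)"
    by (subst emeasure_distr) (auto simp: translate_def vimage_def)
  finally show ?thesis ..
qed

text \<open>Minimality determines a set only up to null sets, so order relations between minimizers
  are taken in this preorder.\<close>

definition ae_subset :: "'a::euclidean_space set \<Rightarrow> 'a set \<Rightarrow> bool" (infix "\<sqsubseteq>" 50) where
  "A \<sqsubseteq> B \<longleftrightarrow> (AE x in lborel. x \<in> A \<longrightarrow> x \<in> B)"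

lemma ae_subset_subset: "A \<subseteq> B \<Longrightarrow> A \<sqsubseteq> B" by (auto simp: ae_subset_def)
lemma ae_subset_refl[simp]: "A \<sqsubseteq> A" by (simp add: ae_subset_def)
lemma ae_subset_trans[trans]: "A \<sqsubseteq> B \<Longrightarrow> B \<sqsubseteq> C \<Longrightarrow> A \<sqsubseteq> C"
  unfolding ae_subset_def by (auto elim: eventually_elim2)
lemma ae_subset_UNIV[simp]: "A \<sqsubseteq> UNIV" by (simp add: ae_subset_def)
lemma ae_subset_empty[simp]: "{} \<sqsubseteq> A" by (simp add: ae_subset_def)
lemma ae_subset_translate_iff: "translate k A \<sqsubseteq> translate k B \<longleftrightarrow> A \<sqsubseteq> B"
  unfolding ae_subset_def by (simp add: AE_translate_iff[of "\<lambda>x. x \<in> A \<longrightarrow> x \<in> B"])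
lemma ae_subset_Compl_iff: "- A \<sqsubseteq> - B \<longleftrightarrow> B \<sqsubseteq> A"
  unfolding ae_subset_def by (auto elim: eventually_mono)
lemma ae_subset_UN: "(\<And>i::nat. A i \<sqsubseteq> B) \<Longrightarrow> (\<Union>i. A i) \<sqsubseteq> B"
proof -
  assume "\<And>i. A i \<sqsubseteq> B"
  then have "AE x in lborel. \<forall>i. x \<in> A i \<longrightarrow> x \<in> B"
    unfolding ae_subset_def by (intro AE_all_countable[THEN iffD2] allI)
  then show ?thesis by (auto simp: ae_subset_def elim: eventually_mono)
qed
lemma ae_subset_Int: "A \<sqsubseteq> B \<Longrightarrow> A \<sqsubseteq> C \<Longrightarrow> A \<sqsubseteq> B \<inter> C"
  unfolding ae_subset_def by (auto elim: eventually_elim2)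
lemma ae_subset_Un: "A \<sqsubseteq> C \<Longrightarrow> B \<sqsubseteq> C \<Longrightarrow> A \<union> B \<sqsubseteq> C"
  unfolding ae_subset_def by (auto elim: eventually_elim2)

lemma ae_subset_emeasure_mono:
  "A \<sqsubseteq> B \<Longrightarrow> A \<in> sets borel \<Longrightarrow> B \<in> sets borel \<Longrightarrow> emeasure lborel A \<le> emeasure lborel B"
  unfolding ae_subset_def by (intro emeasure_mono_AE) auto

lemma ae_subsetI_null:
  assumes "A \<in> sets borel" "B \<in> sets borel" "emeasure lborel (A - B) = 0" shows "A \<sqsubseteq> B"
proof -
  have "A - B \<in> null_sets lborel" using assms by auto
  then have "AE x in lborel. x \<notin> A - B" by (rule AE_not_in)
  then show ?thesis by (auto simp: ae_subset_def)
qed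

lemma ae_subset_null:
  assumes "A \<in> sets borel" "B \<in> sets borel" "A \<sqsubseteq> B" shows "emeasure lborel (A - B) = 0"
proof -
  have "(AE x in lborel. x \<in> A \<longrightarrow> x \<in> B) \<longleftrightarrow> emeasure lborel (A - B) = 0"
    using assms(1,2) by (intro AE_iff_measurable) auto
  then show ?thesis using assms(3) by (simp add: ae_subset_def)
qed

text \<open>Ordered pairs that leave \<open>E\<close>, with at least one end in \<Omega>. According
  to which end lies in \<Omega>, the set splits into the three products whose interactions make up
  \<open>PerK\<close>.\<close>

definition cut :: "'a set \<Rightarrow> 'a set \<Rightarrow> ('a \<times> 'a) set" where
  "cut \<Omega> E = {p. fst p \<in> E \<and> snd p \<notin> E \<and> (fst p \<in> \<Omega> \<or> snd p \<in> \<Omega>)}"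

subsection \<open>Interactions\<close>

text \<open>A Borel version of the kernel as one function on pairs, with bounds in the sup norm.
  \<open>kernel_ok_kernel\<close> produces it at the price of a dimensional factor in
  \<open>lam\<close>.\<close>

locale kernel =
  fixes K :: "(real^'n) \<times> (real^'n) \<Rightarrow> ennreal" and s lam Lam :: real
  assumes K_meas[measurable]: "K \<in> borel_measurable borel"
    and s: "0 < s" "s < 1" and lam: "0 < lam" and Lam: "0 < Lam"
    and K_sym: "AE p in lborel. K (snd p, fst p) = K p"
    and K_low: "AE p in lborel. ennreal (lam * infnorm (fst p - snd p) powr - (real CARD('n) + s)) \<le> K p"
    and K_up: "AE p in lborel. K p \<le> ennreal (Lam * infnorm (fst p - snd p) powr - (real CARD('n) + s))"
    and K_per: "\<And>k. k \<in> Zd \<Longrightarrow> AE p in lborel. K (fst p + k, snd p + k) = K p"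
begin

definition mu :: "((real^'n) \<times> (real^'n)) measure" where "mu = density lborel K"

lemma sets_mu[simp, measurable_cong]: "sets mu = sets borel" by (simp add: mu_def)
lemma space_mu[simp]: "space mu = UNIV" by (simp add: mu_def)

lemma emeasure_mu: "X \<in> sets borel \<Longrightarrow> emeasure mu X = (\<integral>\<^sup>+p. K p * indicator X p \<partial>lborel)"
  unfolding mu_def by (subst emeasure_density) auto

lemma AE_mu: "(AE p in lborel. P p) \<Longrightarrow> AE p in mu. P p"
  unfolding mu_def by (subst AE_density) auto

lemma AE_mu_pair: "(AE x in lborel. P x) \<Longrightarrow> AE p in mu. P (fst p) \<and> P (snd p)"
  by (intro AE_mu AE_lborel_pair)

lemma emeasure_mu_swap:
  assumes [measurable]: "X \<in> sets borel"
  shows "emeasure mu {p. (snd p, fst p) \<in> X} = emeasure mu X"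
proof -
  have m[measurable]: "{p. (snd p, fst p) \<in> X} \<in> sets borel"
  proof -
    have "(\<lambda>p::(real^'n)\<times>(real^'n). (snd p, fst p)) \<in> measurable borel borel"
      by (intro borel_measurable_continuous_onI continuous_intros)
    from measurable_sets[OF this assms] show ?thesis by (simp add: vimage_def)
  qed
  have "emeasure mu {p. (snd p, fst p) \<in> X} = (\<integral>\<^sup>+p. K p * indicator X (snd p, fst p) \<partial>lborel)"
    by (subst emeasure_mu) (auto simp: indicator_def intro!: nn_integral_cong)
  also have "\<dots> = (\<integral>\<^sup>+p. (\<lambda>p. K p * indicator X p) (snd p, fst p) \<partial>lborel)"
    using K_sym by (intro nn_integral_cong_AE) auto
  also have "\<dots> = emeasure mu X"
    by (subst nn_integral_lborel_swap) (auto simp: emeasure_mu)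
  finally show ?thesis .
qed

lemma emeasure_mu_translate:
  assumes [measurable]: "X \<in> sets borel" and k: "k \<in> Zd"
  shows "emeasure mu {p. (fst p - k, snd p - k) \<in> X} = emeasure mu X"
proof -
  have m[measurable]: "{p. (fst p - k, snd p - k) \<in> X} \<in> sets borel"
  proof -
    have "(\<lambda>p::(real^'n)\<times>(real^'n). (fst p - k, snd p - k)) \<in> measurable borel borel"
      by (intro borel_measurable_continuous_onI continuous_intros)
    from measurable_sets[OF this assms(1)] show ?thesis by (simp add: vimage_def)
  qed
  have "emeasure mu {p. (fst p - k, snd p - k) \<in> X} = (\<integral>\<^sup>+p. K p * indicator X (fst p - k, snd p - k) \<partial>lborel)"
    by (subst emeasure_mu) (auto simp: indicator_def intro!: nn_integral_cong)
  also have "\<dots> = (\<integral>\<^sup>+p. (\<lambda>p. K p * indicator X p) ((- k, - k) + p) \<partial>lborel)"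
    using K_per[OF Zd_uminus[OF k]] by (intro nn_integral_cong_AE) (auto simp: plus_prod_def)
  also have "\<dots> = emeasure mu X"
    by (subst nn_integral_lborel_translate) (auto simp: emeasure_mu)
  finally show ?thesis .
qed

definition interaction :: "(real^'n) set \<Rightarrow> (real^'n) set \<Rightarrow> ennreal" where "interaction A B = emeasure mu (A \<times> B)"

lemma interaction_sym: "A \<in> sets borel \<Longrightarrow> B \<in> sets borel \<Longrightarrow> interaction A B = interaction B A"
proof -
  assume "A \<in> sets borel" "B \<in> sets borel"
  moreover have "{p. (snd p, fst p) \<in> A \<times> B} = B \<times> A" by auto
  ultimately show ?thesis using emeasure_mu_swap[of "A \<times> B"] by (simp add: interaction_def borel_Times)
qed

lemma interaction_mono: "A \<subseteq> A' \<Longrightarrow> B \<subseteq> B' \<Longrightarrow> A' \<in> sets borel \<Longrightarrow> B' \<in> sets borel \<Longrightarrow> interaction A B \<le> interaction A' B'"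
  unfolding interaction_def by (intro emeasure_mono) (auto simp: borel_Times)

text \<open>Tonelli: for a pair \<open>p\<close> only the length of the set of radii admitting it
  matters. When this length is bounded by the distance of the two points, it weakens the singularity
  of \<open>K\<close> by one power.\<close>

lemma nn_integral_average:
  fixes X :: "real \<Rightarrow> ((real^'n) \<times> (real^'n)) set"
  assumes S[measurable]: "{q. fst q \<in> I \<and> snd q \<in> X (fst q)} \<in> sets (borel \<Otimes>\<^sub>M borel)"
    and X: "\<And>r. r \<in> I \<Longrightarrow> X r \<in> sets borel"
  shows "(\<integral>\<^sup>+r. indicator I r * emeasure mu (X r) \<partial>lborel) = (\<integral>\<^sup>+p. K p * emeasure lborel {r\<in>I. p \<in> X r} \<partial>lborel)"
proof -
  let ?S = "{q. fst q \<in> I \<and> snd q \<in> X (fst q)}"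
  have m[measurable]: "(\<lambda>(r, p). K p * indicator ?S (r, p)) \<in> borel_measurable (lborel \<Otimes>\<^sub>M lborel)"
    by measurable
  have "(\<integral>\<^sup>+r. indicator I r * emeasure mu (X r) \<partial>lborel) = (\<integral>\<^sup>+r. \<integral>\<^sup>+p. K p * indicator ?S (r, p) \<partial>lborel \<partial>lborel)"
  proof (intro nn_integral_cong)
    fix r
    show "indicator I r * emeasure mu (X r) = (\<integral>\<^sup>+p. K p * indicator ?S (r, p) \<partial>lborel)"
      using X[of r] by (cases "r \<in> I") (auto simp: emeasure_mu indicator_def intro!: nn_integral_cong)
  qed
  also have "\<dots> = (\<integral>\<^sup>+p. \<integral>\<^sup>+r. K p * indicator ?S (r, p) \<partial>lborel \<partial>lborel)"
    using lborel_pair.Fubini'[OF m] by simp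
  also have "\<dots> = (\<integral>\<^sup>+p. K p * emeasure lborel {r\<in>I. p \<in> X r} \<partial>lborel)"
  proof (intro nn_integral_cong)
    fix p
    have [measurable]: "{r\<in>I. p \<in> X r} \<in> sets borel"
    proof -
      have "(\<lambda>r. (r, p)) \<in> measurable borel (borel \<Otimes>\<^sub>M borel)" by measurable
      from measurable_sets[OF this S] show ?thesis by (simp add: vimage_def)
    qed
    have "(\<integral>\<^sup>+r. K p * indicator ?S (r, p) \<partial>lborel) = (\<integral>\<^sup>+r. K p * indicator {r\<in>I. p \<in> X r} r \<partial>lborel)"
      by (intro nn_integral_cong) (auto simp: indicator_def)
    also have "\<dots> = K p * emeasure lborel {r\<in>I. p \<in> X r}"
      by (subst nn_integral_cmult) auto
    finally show "(\<integral>\<^sup>+r. K p * indicator ?S (r, p) \<partial>lborel) = K p * emeasure lborel {r\<in>I. p \<in> X r}" .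
  qed
  finally show ?thesis .
qed

section \<open>Interactions across the boundary of a cube, averaged over its radius\<close>

abbreviation kernel_min :: "real \<Rightarrow> real^'n \<Rightarrow> real" where
  "kernel_min T h \<equiv> Lam * (infnorm h powr - (real CARD('n) + s) * min (infnorm h) T)"

lemma nn_integral_kernel_min:
  assumes T: "0 < T"
  shows "(\<integral>\<^sup>+h. ennreal (kernel_min T h) \<partial>lborel) \<le> ennreal (Lam * near_const (real CARD('n)) s * T powr (1 - s))"
proof -
  have "(\<integral>\<^sup>+h. ennreal (kernel_min T h) \<partial>lborel) = ennreal Lam * (\<integral>\<^sup>+h. ennreal (infnorm (h::real^'n) powr - (real CARD('n) + s) * min (infnorm h) T) \<partial>lborel)"
    using Lam T infnorm_pos_le by (subst nn_integral_cmult[symmetric]) (auto simp: ennreal_mult'[symmetric] intro!: nn_integral_cong)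
  also have "\<dots> \<le> ennreal Lam * ennreal (near_const (real CARD('n)) s * T powr (1 - s))"
    using nn_integral_powr_min[OF s T] by (intro mult_left_mono) auto
  finally show ?thesis using Lam by (simp add: ennreal_mult'[symmetric] mult.assoc)
qed

lemma nn_integral_kernel_min_fst:
  assumes T: "0 < T" and [measurable]: "A \<in> sets borel"
  shows "(\<integral>\<^sup>+p. ennreal (kernel_min T (fst p - snd p)) * indicator (A \<times> UNIV) p \<partial>lborel)
     \<le> ennreal (Lam * near_const (real CARD('n)) s * T powr (1 - s)) * emeasure lborel A"
proof -
  have "(\<integral>\<^sup>+p. ennreal (kernel_min T (fst p - snd p)) * indicator (A \<times> UNIV) p \<partial>lborel)
    = (\<integral>\<^sup>+x. \<integral>\<^sup>+y. ennreal (kernel_min T (x - y)) * indicator A x \<partial>lborel \<partial>lborel)"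
  proof (subst nn_integral_lborel_pair)
    have "A \<times> UNIV \<in> sets borel" by (simp add: borel_Times)
    then show "(\<lambda>p. ennreal (kernel_min T (fst p - snd p)) * indicator (A \<times> UNIV) p) \<in> borel_measurable borel"
      unfolding borel_prod[symmetric] by measurable
  qed (auto simp: indicator_def intro!: nn_integral_cong)
  also have "\<dots> = (\<integral>\<^sup>+x. (\<integral>\<^sup>+h. ennreal (kernel_min T h) \<partial>lborel) * indicator A x \<partial>lborel)"
  proof (intro nn_integral_cong)
    fix x :: "real^'n"
    have "(\<integral>\<^sup>+y. ennreal (kernel_min T (x - y)) * indicator A x \<partial>lborel) = (\<integral>\<^sup>+y. ennreal (kernel_min T (x - y)) \<partial>lborel) * indicator A x"
      by (subst nn_integral_multc) auto
    also have "(\<integral>\<^sup>+y. ennreal (kernel_min T (x - y)) \<partial>lborel) = (\<integral>\<^sup>+h. ennreal (kernel_min T h) \<partial>lborel)"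
      by (rule nn_integral_lborel_reflect[of "\<lambda>h. ennreal (kernel_min T h)"]) simp
    finally show "(\<integral>\<^sup>+y. ennreal (kernel_min T (x - y)) * indicator A x \<partial>lborel) = (\<integral>\<^sup>+h. ennreal (kernel_min T h) \<partial>lborel) * indicator A x" .
  qed
  also have "\<dots> = (\<integral>\<^sup>+h. ennreal (kernel_min T h) \<partial>lborel) * emeasure lborel A"
    by (subst nn_integral_cmult) auto
  also have "\<dots> \<le> ennreal (Lam * near_const (real CARD('n)) s * T powr (1 - s)) * emeasure lborel A"
    by (intro mult_right_mono nn_integral_kernel_min T) auto
  finally show ?thesis .
qed

lemma kernel_const_pos: "0 < Lam * near_const (real CARD('n)) s"
  using Lam near_const_pos[OF s] by simp

lemma cube_pairs_measurable:
  assumes [measurable]: "A \<in> sets borel" "B \<in> sets borel"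
  shows "{q. fst q \<in> {r1..r2} \<and> snd q \<in> (A \<inter> cube z (fst q)) \<times> (B - cube z (fst q))} \<in> sets (borel \<Otimes>\<^sub>M borel)"
proof -
  have "{q. fst q \<in> {r1..r2} \<and> snd q \<in> (A \<inter> cube z (fst q)) \<times> (B - cube z (fst q))} = {q \<in> space (borel \<Otimes>\<^sub>M (borel \<Otimes>\<^sub>M borel)).
      fst q \<in> {r1..r2} \<and> fst (snd q) \<in> A \<and> infnorm (fst (snd q) - z) < fst q
      \<and> snd (snd q) \<in> B \<and> \<not> infnorm (snd (snd q) - z) < fst q}"
    by (auto simp: cube_def space_pair_measure mem_Times_iff)
  also have "\<dots> \<in> sets (borel \<Otimes>\<^sub>M (borel \<Otimes>\<^sub>M borel))" by measurable
  finally show ?thesis by (simp only: borel_prod)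
qed

text \<open>A radius separates \<open>x\<close> inside from \<open>y\<close> outside only between
  \<open>infnorm (x - z)\<close> and \<open>infnorm (y - z)\<close>, so the separating radii have
  length at most \<open>infnorm (x - y)\<close>, and at most \<open>r2 - r1\<close>.\<close>

lemma nn_integral_interaction_cube:
  assumes [measurable]: "A \<in> sets borel" "B \<in> sets borel" and r: "r1 < r2"
  shows "(\<integral>\<^sup>+r. indicator {r1..r2} r * interaction (A \<inter> cube z r) (B - cube z r) \<partial>lborel)
    \<le> (\<integral>\<^sup>+p. ennreal (kernel_min (r2 - r1) (fst p - snd p)) * indicator (A \<times> B) p \<partial>lborel)"
proof -
  let ?X = "\<lambda>r. (A \<inter> cube z r) \<times> (B - cube z r)"
  have "(\<integral>\<^sup>+r. indicator {r1..r2} r * interaction (A \<inter> cube z r) (B - cube z r) \<partial>lborel)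
      = (\<integral>\<^sup>+p. K p * emeasure lborel {r\<in>{r1..r2}. p \<in> ?X r} \<partial>lborel)"
    unfolding interaction_def by (rule nn_integral_average[OF cube_pairs_measurable[OF assms(1,2)]]) (auto simp: borel_Times)
  also have "\<dots> \<le> (\<integral>\<^sup>+p. ennreal (kernel_min (r2 - r1) (fst p - snd p)) * indicator (A \<times> B) p \<partial>lborel)"
  proof (rule nn_integral_mono_AE)
    show "AE p in lborel. K p * emeasure lborel {r\<in>{r1..r2}. p \<in> ?X r}
        \<le> ennreal (kernel_min (r2 - r1) (fst p - snd p)) * indicator (A \<times> B) p"
      using K_up
    proof eventually_elim
      case (elim p)
      obtain x y where p: "p = (x, y)" by (cases p)
      have 1: "emeasure lborel {r\<in>{r1..r2}. p \<in> ?X r} \<le> ennreal (r2 - r1)"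
      proof -
        have "emeasure lborel {r\<in>{r1..r2}. p \<in> ?X r} \<le> emeasure lborel {r1..r2}"
          by (intro emeasure_mono) auto
        then show ?thesis using r by simp
      qed
      have 2: "emeasure lborel {r\<in>{r1..r2}. p \<in> ?X r} \<le> ennreal (infnorm (x - y))"
      proof (cases "infnorm (x - z) \<le> infnorm (y - z)")
        case True
        have "emeasure lborel {r\<in>{r1..r2}. p \<in> ?X r} \<le> emeasure lborel {infnorm (x - z)..infnorm (y - z)}"
          by (intro emeasure_mono) (auto simp: cube_def p)
        also have "\<dots> = ennreal (infnorm (y - z) - infnorm (x - z))" using True by simp
        also have "\<dots> \<le> ennreal (infnorm (x - y))"
          using absdiff_infnorm[of "y - z" "x - z"] by (intro ennreal_leI) (simp add: infnorm_sub)
        finally show ?thesis .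
      next
        case False
        then have e: "{r\<in>{r1..r2}. p \<in> ?X r} = {}" by (auto simp: cube_def p)
        show ?thesis unfolding e by simp
      qed
      show ?case
      proof (cases "p \<in> A \<times> B")
        case True
        have "K p * emeasure lborel {r\<in>{r1..r2}. p \<in> ?X r}
          \<le> ennreal (Lam * infnorm (fst p - snd p) powr - (real CARD('n) + s)) * ennreal (min (infnorm (x - y)) (r2 - r1))"
          using elim 1 2 by (intro mult_mono) (auto simp: min_def)
        also have "\<dots> = ennreal (kernel_min (r2 - r1) (fst p - snd p))"
          using Lam r infnorm_pos_le[of "x - y"] by (subst ennreal_mult'[symmetric]) (auto simp: p mult.assoc)
        finally show ?thesis using True by simp
      next
        case False
        then have e: "{r\<in>{r1..r2}. p \<in> ?X r} = {}" by auto
        show ?thesis unfolding e by simp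
      qed
    qed
  qed
  finally show ?thesis .
qed

text \<open>For radii up to \<open>r2\<close> only \<open>A \<inter> cube z r2\<close> takes part,
  and the remaining integral over the second point does not depend on the first. The bound by a
  volume is what closes the recursion in the density estimate.\<close>

lemma nn_integral_interaction_cube_fst:
  assumes [measurable]: "A \<in> sets borel" "B \<in> sets borel" and r: "r1 < r2"
  shows "(\<integral>\<^sup>+r. indicator {r1..r2} r * interaction (A \<inter> cube z r) (B - cube z r) \<partial>lborel)
    \<le> ennreal (Lam * near_const (real CARD('n)) s * (r2 - r1) powr (1 - s)) * emeasure lborel (A \<inter> cube z r2)"
proof -
  let ?A = "A \<inter> cube z r2"
  have "(\<integral>\<^sup>+r. indicator {r1..r2} r * interaction (A \<inter> cube z r) (B - cube z r) \<partial>lborel)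
     = (\<integral>\<^sup>+r. indicator {r1..r2} r * interaction (?A \<inter> cube z r) (B - cube z r) \<partial>lborel)"
  proof (intro nn_integral_cong)
    fix r
    show "indicator {r1..r2} r * interaction (A \<inter> cube z r) (B - cube z r) = indicator {r1..r2} r * interaction (?A \<inter> cube z r) (B - cube z r)"
    proof (cases "r \<in> {r1..r2}")
      case True
      then have "A \<inter> cube z r = ?A \<inter> cube z r" using cube_mono[of r r2 z] by auto
      then show ?thesis by simp
    qed auto
  qed
  also have "\<dots> \<le> (\<integral>\<^sup>+p. ennreal (kernel_min (r2 - r1) (fst p - snd p)) * indicator (?A \<times> B) p \<partial>lborel)"
    using r by (intro nn_integral_interaction_cube) auto
  also have "\<dots> \<le> (\<integral>\<^sup>+p. ennreal (kernel_min (r2 - r1) (fst p - snd p)) * indicator (?A \<times> UNIV) p \<partial>lborel)"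
    by (intro nn_integral_mono) (auto simp: indicator_def)
  also have "\<dots> \<le> ennreal (Lam * near_const (real CARD('n)) s * (r2 - r1) powr (1 - s)) * emeasure lborel ?A"
    using r by (intro nn_integral_kernel_min_fst) auto
  finally show ?thesis .
qed

text \<open>The weight depends only on the distance, so the roles of the two points can be
  exchanged; this version serves for a thin outer set \<open>B\<close>.\<close>

lemma nn_integral_interaction_cube_snd:
  assumes [measurable]: "A \<in> sets borel" "B \<in> sets borel" and r: "r1 < r2"
  shows "(\<integral>\<^sup>+r. indicator {r1..r2} r * interaction (A \<inter> cube z r) (B - cube z r) \<partial>lborel)
    \<le> ennreal (Lam * near_const (real CARD('n)) s * (r2 - r1) powr (1 - s)) * emeasure lborel B"
proof -
  have "(\<integral>\<^sup>+r. indicator {r1..r2} r * interaction (A \<inter> cube z r) (B - cube z r) \<partial>lborel)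
     \<le> (\<integral>\<^sup>+p. ennreal (kernel_min (r2 - r1) (fst p - snd p)) * indicator (A \<times> B) p \<partial>lborel)"
    using r by (intro nn_integral_interaction_cube) auto
  also have "\<dots> \<le> (\<integral>\<^sup>+p. (\<lambda>p. ennreal (kernel_min (r2 - r1) (fst p - snd p)) * indicator (B \<times> UNIV) p) (snd p, fst p) \<partial>lborel)"
    by (intro nn_integral_mono) (auto simp: indicator_def infnorm_sub)
  also have "\<dots> = (\<integral>\<^sup>+p. ennreal (kernel_min (r2 - r1) (fst p - snd p)) * indicator (B \<times> UNIV) p \<partial>lborel)"
  proof (rule nn_integral_lborel_swap)
    have "B \<times> UNIV \<in> sets borel" by (simp add: borel_Times)
    then show "(\<lambda>p. ennreal (kernel_min (r2 - r1) (fst p - snd p)) * indicator (B \<times> UNIV) p) \<in> borel_measurable borel"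
      unfolding borel_prod[symmetric] by measurable
  qed
  also have "\<dots> \<le> ennreal (Lam * near_const (real CARD('n)) s * (r2 - r1) powr (1 - s)) * emeasure lborel B"
    using r by (intro nn_integral_kernel_min_fst) auto
  finally show ?thesis .
qed

lemma interaction_nn_integral:
  assumes [measurable]: "A \<in> sets borel" "B \<in> sets borel"
  shows "interaction A B = (\<integral>\<^sup>+p. K p * indicator (A \<times> B) p \<partial>lborel)"
  unfolding interaction_def by (simp add: emeasure_mu borel_Times)

text \<open>A point that leaves the cube under a shift by \<open>h\<close> lies in a boundary shell
  of thickness \<open>min (infnorm h) r\<close>.\<close>

lemma emeasure_cube_diff_shift:
  fixes z h :: "real^'n"
  assumes r: "0 < r"
  shows "emeasure lborel {x \<in> cube z r. x - h \<notin> cube z r}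
      \<le> ennreal (2 * real CARD('n) * (2 * r) ^ (CARD('n) - 1) * min (infnorm h) r)"
proof -
  define t where "t = min (infnorm h) r"
  have t: "0 \<le> t" "t \<le> r" "t \<le> infnorm h" using r infnorm_pos_le[of h] by (auto simp: t_def)
  have "{x \<in> cube z r. x - h \<notin> cube z r} \<subseteq> cube z r - cube z (r - t)"
  proof safe
    fix x assume x: "x \<in> cube z r" "x - h \<notin> cube z r" "x \<in> cube z (r - t)"
    have "infnorm (x - h - z) \<le> infnorm (x - z) + infnorm h"
      using infnorm_triangle[of "x - z" "- h"] by (simp add: infnorm_neg algebra_simps)
    \<comment> \<open>If the minimum were \<open>r\<close> instead, the inner cube would have radius
      0 and be empty.\<close>
    moreover have "t = infnorm h"
    proof (rule ccontr)
      assume "t \<noteq> infnorm h"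
      then have "r - t = 0" by (auto simp: t_def min_def split: if_splits)
      then show False using x(3) infnorm_pos_le[of "x - z"] by (simp add: cube_def)
    qed
    ultimately show False using x by (auto simp: cube_def)
  qed
  then have "emeasure lborel {x \<in> cube z r. x - h \<notin> cube z r} \<le> emeasure lborel (cube z r - cube z (r - t))"
    by (intro emeasure_mono) auto
  also have "\<dots> = emeasure lborel (cube z r) - emeasure lborel (cube z (r - t))"
    using t cube_mono[of "r - t" r z] emeasure_cube_finite[of z "r - t"] by (intro emeasure_Diff) auto
  also have "\<dots> = ennreal ((2 * r) ^ CARD('n) - (2 * (r - t)) ^ CARD('n))"
    using t r by (simp add: emeasure_cube ennreal_minus)
  also have "\<dots> \<le> ennreal (2 * real CARD('n) * (2 * r) ^ (CARD('n) - 1) * t)"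
    using power_diff_le[of "2 * (r - t)" "2 * r" "CARD('n)"] t r
    by (intro ennreal_leI) (simp add: algebra_simps)
  finally show ?thesis by (simp add: t_def)
qed

text \<open>The integral is reordered by the displacement \<open>h\<close>: the volume of points
  moved out of the cube is of order \<open>infnorm h\<close> for small \<open>h\<close>, which makes
  the kernel integrable. Finiteness of this interaction allows sets to be patched along the boundary
  of a cube.\<close>

lemma interaction_cube_finite: "interaction (cube z r) (- cube z r) < \<infinity>"
proof (cases "0 < r")
  case r: False
  have "cube z r = {}"
    using r by (auto simp: cube_def not_less intro: order_trans[OF _ infnorm_pos_le])
  then show ?thesis by (simp add: interaction_def)
next
  case r: True
  let ?Q = "cube z r"
  let ?c = "2 * real CARD('n) * (2 * r) ^ (CARD('n) - 1)"
  define g where "g h = ennreal (Lam * infnorm h powr - (real CARD('n) + s))" for h :: "real^'n"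
  have g[measurable]: "g \<in> borel_measurable borel" unfolding g_def by measurable
  have mQ: "?Q \<times> - ?Q \<in> sets borel" by (simp add: borel_Times)
  have "interaction ?Q (- ?Q) \<le> (\<integral>\<^sup>+p. g (fst p - snd p) * indicator (?Q \<times> - ?Q) p \<partial>lborel)"
    unfolding interaction_nn_integral[OF cube_borel borel_comp[OF cube_borel]]
    using K_up by (intro nn_integral_mono_AE) (auto simp: g_def indicator_def elim!: eventually_mono)
  also have "\<dots> = (\<integral>\<^sup>+x. \<integral>\<^sup>+y. g (x - y) * (indicator ?Q x * indicator (- ?Q) y) \<partial>lborel \<partial>lborel)"
  proof (subst nn_integral_lborel_pair)
    show "(\<lambda>p. g (fst p - snd p) * indicator (?Q \<times> - ?Q) p) \<in> borel_measurable borel"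
      using mQ unfolding borel_prod[symmetric] by measurable
  qed (auto simp: indicator_def intro!: nn_integral_cong)
  also have "\<dots> = (\<integral>\<^sup>+x. \<integral>\<^sup>+h. g h * (indicator ?Q x * indicator (- ?Q) (x - h)) \<partial>lborel \<partial>lborel)"
  proof (rule nn_integral_cong)
    fix x :: "real^'n"
    have "(\<integral>\<^sup>+h. g h * (indicator ?Q x * indicator (- ?Q) (x - h)) \<partial>lborel)
       = (\<integral>\<^sup>+y. (\<lambda>h. g h * (indicator ?Q x * indicator (- ?Q) (x - h))) (x - y) \<partial>lborel)"
      by (rule nn_integral_lborel_reflect[symmetric]) measurable
    then show "(\<integral>\<^sup>+y. g (x - y) * (indicator ?Q x * indicator (- ?Q) y) \<partial>lborel)
       = (\<integral>\<^sup>+h. g h * (indicator ?Q x * indicator (- ?Q) (x - h)) \<partial>lborel)" by simp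
  qed
  also have "\<dots> = (\<integral>\<^sup>+h. \<integral>\<^sup>+x. g h * (indicator ?Q x * indicator (- ?Q) (x - h)) \<partial>lborel \<partial>lborel)"
    using lborel_pair.Fubini'[of "\<lambda>h x. g h * (indicator ?Q x * indicator (- ?Q) (x - h))"]
    by (simp add: cube_def)
  also have "\<dots> = (\<integral>\<^sup>+h. g h * emeasure lborel {x \<in> ?Q. x - h \<notin> ?Q} \<partial>lborel)"
  proof (rule nn_integral_cong)
    fix h :: "real^'n"
    have "(\<integral>\<^sup>+x. g h * (indicator ?Q x * indicator (- ?Q) (x - h)) \<partial>lborel)
       = (\<integral>\<^sup>+x. g h * indicator {x \<in> ?Q. x - h \<notin> ?Q} x \<partial>lborel)"
      by (intro nn_integral_cong) (auto simp: indicator_def)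
    also have "\<dots> = g h * emeasure lborel {x \<in> ?Q. x - h \<notin> ?Q}"
      by (subst nn_integral_cmult) (auto simp: cube_def)
    finally show "(\<integral>\<^sup>+x. g h * (indicator ?Q x * indicator (- ?Q) (x - h)) \<partial>lborel) = g h * emeasure lborel {x \<in> ?Q. x - h \<notin> ?Q}" .
  qed
  also have "\<dots> \<le> (\<integral>\<^sup>+h. ennreal ?c * ennreal (kernel_min r h) \<partial>lborel)"
  proof (intro nn_integral_mono)
    fix h :: "real^'n"
    have "g h * emeasure lborel {x \<in> ?Q. x - h \<notin> ?Q} \<le> g h * ennreal (?c * min (infnorm h) r)"
      using r by (intro mult_left_mono emeasure_cube_diff_shift) auto
    also have "\<dots> = ennreal ?c * ennreal (kernel_min r h)"
      using r Lam infnorm_pos_le[of h] unfolding g_def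
      by (subst (1 2) ennreal_mult'[symmetric]) (auto simp: algebra_simps)
    finally show "g h * emeasure lborel {x \<in> ?Q. x - h \<notin> ?Q} \<le> ennreal ?c * ennreal (kernel_min r h)" .
  qed
  also have "\<dots> = ennreal ?c * (\<integral>\<^sup>+h. ennreal (kernel_min r h) \<partial>lborel)" by (rule nn_integral_cmult) simp
  also have "\<dots> \<le> ennreal ?c * ennreal (Lam * near_const (real CARD('n)) s * r powr (1 - s))"
    using r by (intro mult_left_mono nn_integral_kernel_min) auto
  also have "\<dots> < \<infinity>" by (simp add: ennreal_mult_less_top)
  finally show ?thesis .
qed

section \<open>Lower bounds for interactions\<close>

lemma interaction_lower:
  assumes [measurable]: "A \<in> sets borel" "B \<in> sets borel" and t: "0 < t"
    and near: "\<And>x y. x \<in> A \<Longrightarrow> y \<in> B \<Longrightarrow> infnorm (x - y) \<le> t" and disj: "A \<inter> B = {}"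
  shows "ennreal (lam * t powr - (real CARD('n) + s)) * (emeasure lborel A * emeasure lborel B) \<le> interaction A B"
proof -
  have "ennreal (lam * t powr - (real CARD('n) + s)) * (emeasure lborel A * emeasure lborel B)
    = (\<integral>\<^sup>+p. ennreal (lam * t powr - (real CARD('n) + s)) * indicator (A \<times> B) p \<partial>lborel)"
  proof (subst nn_integral_cmult)
    have "emeasure lborel (A \<times> B) = emeasure lborel A * emeasure lborel B"
      by (subst lborel_prod[symmetric], subst lborel.emeasure_pair_measure_Times) auto
    then show "ennreal (lam * t powr - (real CARD('n) + s)) * (emeasure lborel A * emeasure lborel B)
       = ennreal (lam * t powr - (real CARD('n) + s)) * (\<integral>\<^sup>+p. indicator (A \<times> B) p \<partial>lborel)"
      by (simp add: borel_Times)
  qed (auto simp: borel_Times intro!: borel_measurable_indicator)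
  also have "\<dots> \<le> interaction A B"
    unfolding interaction_nn_integral[OF assms(1,2)]
  proof (intro nn_integral_mono_AE)
    show "AE p in lborel. ennreal (lam * t powr - (real CARD('n) + s)) * indicator (A \<times> B) p \<le> K p * indicator (A \<times> B) p"
      using K_low
    proof eventually_elim
      case (elim p)
      show ?case
      proof (cases "p \<in> A \<times> B")
        case True
        \<comment> \<open>A negative power is 0 at distance 0, so the antitone comparison of powers
          holds only off the diagonal.\<close>
        then have "fst p \<noteq> snd p" using disj by auto
        then have "0 < infnorm (fst p - snd p)" by (simp add: infnorm_pos_lt)
        moreover have "infnorm (fst p - snd p) \<le> t" using near[of "fst p" "snd p"] True by auto
        ultimately have "lam * t powr - (real CARD('n) + s) \<le> lam * infnorm (fst p - snd p) powr - (real CARD('n) + s)"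
          using lam s by (intro mult_left_mono powr_mono2') auto
        then have "ennreal (lam * t powr - (real CARD('n) + s)) \<le> K p"
          using elim by (meson ennreal_leI order_trans)
        then show ?thesis using True by simp
      qed auto
    qed
  qed
  finally show ?thesis .
qed

text \<open>A cube with twice the volume of \<open>A\<close> lies at least half outside
  \<open>A\<close>, hence every point of \<open>A\<close> sees a volume \<open>v\<close> of the
  complement within distance \<rho>. This crude count already has the scaling exponent
  \<open>1 - s / d\<close> of the fractional isoperimetric inequality.\<close>

lemma isoperimetric:
  assumes [measurable]: "A \<in> sets borel" and v: "emeasure lborel A = ennreal v" "0 < v"
  shows "ennreal (lam * v powr (1 - s / real CARD('n))) \<le> interaction A (- A)"
proof -
  define D where "D = real CARD('n)"
  have D: "1 \<le> D" unfolding D_def by (simp add: Suc_leI)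
  define \<rho> where "\<rho> = (2 * v) powr (1 / D) / 2"
  have \<rho>: "0 < \<rho>" using v by (simp add: \<rho>_def)
  have \<rho>D: "(2 * \<rho>) ^ CARD('n) = 2 * v"
    using v D by (simp add: \<rho>_def powr_realpow[symmetric] powr_powr D_def[symmetric])
  let ?c = "ennreal (lam * \<rho> powr - (D + s))"
  have big: "ennreal v \<le> emeasure lborel (cube x \<rho> - A)" for x
  proof -
    have "emeasure lborel (cube x \<rho>) \<le> emeasure lborel (cube x \<rho> - A) + emeasure lborel A"
      by (rule order_trans[OF emeasure_mono emeasure_subadditive]) auto
    then have "ennreal (2 * v) \<le> ennreal v + emeasure lborel (cube x \<rho> - A)"
      using v emeasure_cube[of \<rho> x, unfolded \<rho>D] \<rho> by (simp add: add.commute)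
    moreover have "ennreal (2 * v) = ennreal v + ennreal v"
      using v by (subst ennreal_plus[symmetric]) auto
    ultimately show ?thesis by (simp add: ennreal_add_left_cancel_le)
  qed
  let ?S = "{p. fst p \<in> A \<and> snd p \<notin> A \<and> infnorm (fst p - snd p) < \<rho>}"
  have S[measurable]: "?S \<in> sets borel"
  proof -
    have "?S = {p \<in> space (borel \<Otimes>\<^sub>M borel). fst p \<in> A \<and> snd p \<notin> A \<and> infnorm (fst p - snd p) < \<rho>}"
      by (auto simp: space_pair_measure)
    also have "\<dots> \<in> sets (borel \<Otimes>\<^sub>M borel)" by measurable
    finally show ?thesis by (simp only: borel_prod)
  qed
  have "ennreal (lam * v powr (1 - s / D)) \<le> ?c * (ennreal v * ennreal v)"
  proof -
    have ex: "1 / D * - (D + s) = - (1 + s / D)" using D by (simp add: field_simps)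
    have "\<rho> powr - (D + s) = ((2 * v) powr (1 / D)) powr - (D + s) / 2 powr - (D + s)"
      unfolding \<rho>_def by (rule powr_divide)
    also have "\<dots> = (2 * v) powr (- (1 + s / D)) * 2 powr (D + s)"
      unfolding powr_powr ex by (simp only: powr_minus[of 2 "D + s"] divide_inverse inverse_inverse_eq)
    also have "\<dots> = v powr (- (1 + s / D)) * (2 powr (D + s) * 2 powr (- (1 + s / D)))"
      using v by (simp add: powr_mult)
    also have "2 powr (D + s) * 2 powr (- (1 + s / D)) = 2 powr (D + s - (1 + s / D))"
      by (subst powr_add[symmetric]) (simp only: diff_conv_add_uminus)
    finally have e: "\<rho> powr - (D + s) = v powr (- (1 + s / D)) * 2 powr (D + s - (1 + s / D))" .
    have "s / D \<le> s" using D s by (simp add: field_simps)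
    then have ge: "1 \<le> 2 powr (D + s - (1 + s / D))" using D by (intro ge_one_powr_ge_zero) auto
    have "v powr (1 - s / D) = v powr (- (1 + s / D)) * (v * v)"
    proof -
      have "v * v = v powr 2" using v by (simp add: power2_eq_square)
      then show ?thesis by (simp add: powr_add[symmetric] algebra_simps)
    qed
    also have "\<dots> \<le> v powr (- (1 + s / D)) * 2 powr (D + s - (1 + s / D)) * (v * v)"
      using ge v by (intro mult_right_mono) (auto simp: mult_le_cancel_left1)
    finally have "v powr (1 - s / D) \<le> \<rho> powr - (D + s) * (v * v)" unfolding e .
    then have "lam * v powr (1 - s / D) \<le> lam * \<rho> powr - (D + s) * (v * v)"
      unfolding mult.assoc using lam by (intro mult_left_mono) auto
    then show ?thesis using lam v by (simp add: ennreal_mult'[symmetric] ennreal_leI)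
  qed
  also have "?c * (ennreal v * ennreal v) = ?c * (\<integral>\<^sup>+x. ennreal v * indicator A x \<partial>lborel)"
    using v by (simp add: nn_integral_cmult)
  also have "\<dots> \<le> ?c * (\<integral>\<^sup>+x. emeasure lborel (cube x \<rho> - A) * indicator A x \<partial>lborel)"
    using big by (intro mult_left_mono nn_integral_mono) (auto simp: indicator_def)
  also have "\<dots> = ?c * (\<integral>\<^sup>+x. \<integral>\<^sup>+y. indicator ?S (x, y) \<partial>lborel \<partial>lborel)"
  proof (rule arg_cong[where f = "\<lambda>x. ?c * x"], rule nn_integral_cong)
    fix x
    have "(\<integral>\<^sup>+y. indicator ?S (x, y) \<partial>lborel) = (\<integral>\<^sup>+y. indicator (cube x \<rho> - A) y * indicator A x \<partial>lborel)"
      by (intro nn_integral_cong) (auto simp: indicator_def cube_def infnorm_sub)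
    then show "emeasure lborel (cube x \<rho> - A) * indicator A x = (\<integral>\<^sup>+y. indicator ?S (x, y) \<partial>lborel)"
      by (simp add: nn_integral_multc)
  qed
  also have "\<dots> = (\<integral>\<^sup>+p. ?c * indicator ?S p \<partial>lborel)"
    by (simp only: nn_integral_lborel_pair[of "indicator ?S", symmetric] borel_measurable_indicator S)
      (subst nn_integral_cmult, auto)
  also have "\<dots> \<le> interaction A (- A)"
    unfolding interaction_nn_integral[OF assms(1) borel_comp[OF assms(1)]]
  proof (intro nn_integral_mono_AE)
    show "AE p in lborel. ?c * indicator ?S p \<le> K p * indicator (A \<times> - A) p"
      using K_low
    proof eventually_elim
      case (elim p)
      show ?case
      proof (cases "p \<in> ?S")
        case True
        then have "fst p \<noteq> snd p" by auto
        then have "0 < infnorm (fst p - snd p)" by (simp add: infnorm_pos_lt)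
        then have "lam * \<rho> powr - (D + s) \<le> lam * infnorm (fst p - snd p) powr - (real CARD('n) + s)"
          using lam s True by (intro mult_left_mono) (auto simp: D_def intro!: powr_mono2')
        then have "?c \<le> K p" using elim by (meson ennreal_leI order_trans)
        then show ?thesis using True by (simp add: mem_Times_iff)
      qed auto
    qed
  qed
  finally show ?thesis by (simp add: D_def)
qed

end

subsection \<open>Perimeter and existence of minimizers\<close>

text \<open>Submodularity replaces compactness: if \<open>J (S n) \<le> m + 1/2^n\<close>, the tail unions of \<open>S\<close> have
  \<open>J \<le> m + 2/2^n\<close>, so the upper limit of \<open>S\<close> is a minimizer.\<close>
lemma lattice_min_exists:
  fixes J :: "'a set \<Rightarrow> ennreal"
  assumes ne: "\<A> \<noteq> {}"
    and Int: "\<And>A B. A \<in> \<A> \<Longrightarrow> B \<in> \<A> \<Longrightarrow> A \<inter> B \<in> \<A>"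
    and Un: "\<And>A B. A \<in> \<A> \<Longrightarrow> B \<in> \<A> \<Longrightarrow> A \<union> B \<in> \<A>"
    and UN: "\<And>A::nat \<Rightarrow> 'a set. range A \<subseteq> \<A> \<Longrightarrow> incseq A \<Longrightarrow> (\<Union>i. A i) \<in> \<A>"
    and INT: "\<And>A::nat \<Rightarrow> 'a set. range A \<subseteq> \<A> \<Longrightarrow> decseq A \<Longrightarrow> (\<Inter>i. A i) \<in> \<A>"
    and submod: "\<And>A B. A \<in> \<A> \<Longrightarrow> B \<in> \<A> \<Longrightarrow> J (A \<inter> B) + J (A \<union> B) \<le> J A + J B"
    and lscU: "\<And>A::nat \<Rightarrow> 'a set. range A \<subseteq> \<A> \<Longrightarrow> incseq A \<Longrightarrow> J (\<Union>i. A i) \<le> liminf (\<lambda>i. J (A i))"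
    and lscI: "\<And>A::nat \<Rightarrow> 'a set. range A \<subseteq> \<A> \<Longrightarrow> decseq A \<Longrightarrow> J (\<Inter>i. A i) \<le> liminf (\<lambda>i. J (A i))"
  shows "\<exists>S\<in>\<A>. \<forall>F\<in>\<A>. J S \<le> J F"
proof -
  define m where "m = (INF F\<in>\<A>. J F)"
  have m_le: "m \<le> J F" if "F \<in> \<A>" for F using that by (auto simp: m_def intro: INF_lower)
  show ?thesis
  proof (cases "m = \<infinity>")
    case True
    then show ?thesis using ne m_le by (metis ex_in_conv infinity_ennreal_def top.extremum_uniqueI top_greatest)
  next
    case False
    have "\<exists>S\<in>\<A>. J S \<le> m + ennreal ((1/2) ^ n)" for n :: nat
    proof -
      have "m < m + ennreal ((1/2) ^ n)"
        using False by (cases m) (auto simp: ennreal_plus[symmetric] simp del: ennreal_plus intro!: ennreal_lessI add_nonneg_pos)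
      then show ?thesis
        using INF_less_iff[of J \<A> "m + ennreal ((1/2) ^ n)", folded m_def] by (auto intro: less_imp_le)
    qed
    then obtain S where S: "\<And>n::nat. S n \<in> \<A>" "\<And>n. J (S n) \<le> m + ennreal ((1/2) ^ n)" by metis
    define U where "U n N = (\<Union>k\<in>{n..n+N}. S k)" for n N
    \<comment> \<open>The error is the sum of \<open>(1/2) ^ k\<close> for \<open>k\<close> from
      \<open>n\<close> to \<open>n + N\<close>.\<close>
    have U: "U n N \<in> \<A> \<and> J (U n N) \<le> m + ennreal (2 * (1/2) ^ n - (1/2) ^ (n + N))" for n N
    proof (induction N)
      case 0
      then show ?case using S[of n] by (simp add: U_def)
    next
      case (Suc N)
      have eq: "U n (Suc N) = U n N \<union> S (Suc (n + N))"
        by (auto simp: U_def atLeastAtMostSuc_conv)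
      have A: "U n (Suc N) \<in> \<A>" "U n N \<inter> S (Suc (n + N)) \<in> \<A>" using Suc S Un Int eq by auto
      have nn: "0 \<le> 2 * (1/2::real) ^ n - (1/2) ^ (n + N)"
        using power_decreasing[of n "n + N" "1/2::real"] zero_le_power[of "1/2::real" n] by linarith
      \<comment> \<open>The intersection is again in the lattice and costs at least
        \<open>m\<close>; cancelling \<open>m\<close> on both sides leaves the bound for the
        union.\<close>
      have "m + J (U n (Suc N)) \<le> J (U n N \<inter> S (Suc (n + N))) + J (U n (Suc N))"
        using m_le A by (intro add_mono) auto
      also have "\<dots> \<le> J (U n N) + J (S (Suc (n + N)))"
        unfolding eq using Suc S by (intro submod) auto
      also have "\<dots> \<le> (m + ennreal (2 * (1/2) ^ n - (1/2) ^ (n + N))) + (m + ennreal ((1/2) ^ Suc (n + N)))"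
        using Suc S(2)[of "Suc (n + N)"] by (intro add_mono) simp_all
      also have "\<dots> = m + (m + (ennreal (2 * (1/2) ^ n - (1/2) ^ (n + N)) + ennreal ((1/2) ^ Suc (n + N))))"
        by (simp add: ac_simps)
      also have "ennreal (2 * (1/2) ^ n - (1/2) ^ (n + N)) + ennreal ((1/2) ^ Suc (n + N))
          = ennreal (2 * (1/2) ^ n - (1/2) ^ (n + Suc N))"
        using nn by (subst ennreal_plus[symmetric]) (auto simp: field_simps)
      finally have "J (U n (Suc N)) \<le> m + ennreal (2 * (1/2) ^ n - (1/2) ^ (n + Suc N))"
        using False by (simp add: ennreal_add_left_cancel_le)
      then show ?case using A by simp
    qed
    define G where "G n = (\<Union>N. U n N)" for n
    have incU: "incseq (U n)" for n unfolding incseq_def U_def by (intro allI impI UN_mono) auto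
    have G: "G n \<in> \<A>" for n unfolding G_def using U incU by (intro UN) auto
    have JG: "J (G n) \<le> m + ennreal (2 * (1/2) ^ n)" for n
    proof -
      have "J (G n) \<le> liminf (\<lambda>N. J (U n N))" unfolding G_def using U incU by (intro lscU) auto
      also have "\<dots> \<le> liminf (\<lambda>N. m + ennreal (2 * (1/2) ^ n))"
      proof (intro Liminf_mono always_eventually allI)
        fix N
        have "J (U n N) \<le> m + ennreal (2 * (1/2) ^ n - (1/2) ^ (n + N))" using U by auto
        also have "\<dots> \<le> m + ennreal (2 * (1/2) ^ n)" by (intro add_left_mono ennreal_leI) auto
        finally show "J (U n N) \<le> m + ennreal (2 * (1/2) ^ n)" .
      qed
      finally show ?thesis by (simp add: Liminf_const)
    qed
    have decG: "decseq G"
    proof (rule decseq_SucI, rule subsetI)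
      fix n x assume "x \<in> G (Suc n)"
      then obtain N k where "k \<in> {Suc n..Suc n + N}" "x \<in> S k" by (auto simp: G_def U_def)
      then have "x \<in> U n (Suc N)" by (auto simp: U_def)
      then show "x \<in> G n" by (auto simp: G_def)
    qed
    have F: "(\<Inter>n. G n) \<in> \<A>" using G decG by (intro INT) auto
    have "J (\<Inter>n. G n) \<le> liminf (\<lambda>n. J (G n))" using G decG by (intro lscI) auto
    also have "\<dots> \<le> liminf (\<lambda>n. m + ennreal (2 * (1/2) ^ n))"
      using JG by (intro Liminf_mono always_eventually) auto
    also have "\<dots> = m"
    proof (rule lim_imp_Liminf)
      have "(\<lambda>n. 2 * (1/2::real) ^ n) \<longlonglongrightarrow> 2 * 0"
        by (intro tendsto_mult tendsto_const LIMSEQ_power_zero) auto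
      then have "(\<lambda>n. m + ennreal (2 * (1/2) ^ n)) \<longlonglongrightarrow> m + ennreal 0"
        by (intro tendsto_add tendsto_const tendsto_ennrealI) auto
      then show "(\<lambda>n. m + ennreal (2 * (1/2) ^ n)) \<longlonglongrightarrow> m" by simp
    qed simp
    finally show ?thesis using F m_le by (meson order_trans)
  qed
qed

lemma cut_borel [measurable, simp]:
  fixes E :: "'a::second_countable_topology set"
  assumes "E \<in> sets borel" "\<Omega> \<in> sets borel" shows "cut \<Omega> E \<in> sets borel"
proof -
  have "cut \<Omega> E = (E \<times> - E) \<inter> (\<Omega> \<times> UNIV \<union> UNIV \<times> \<Omega>)" by (auto simp: cut_def)
  then show ?thesis
    using assms by (simp only:) (intro sets.Int sets.Un borel_Times borel_comp, simp_all)
qed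

context kernel
begin

definition Per :: "(real^'n) set \<Rightarrow> (real^'n) set \<Rightarrow> ennreal" where "Per \<Omega> E = emeasure mu (cut \<Omega> E)"

lemma Per_cong:
  assumes "E \<sqsubseteq> F" "F \<sqsubseteq> E" and [measurable]: "E \<in> sets borel" "F \<in> sets borel" "\<Omega> \<in> sets borel"
  shows "Per \<Omega> E = Per \<Omega> F"
  unfolding Per_def
proof (rule emeasure_eq_AE)
  have "AE x in lborel. x \<in> E \<longleftrightarrow> x \<in> F" using assms(1,2) unfolding ae_subset_def by (auto elim: eventually_elim2)
  from AE_mu_pair[OF this] show "AE p in mu. (p \<in> cut \<Omega> E) = (p \<in> cut \<Omega> F)"
    by (rule eventually_mono) (auto simp: cut_def)
qed auto

text \<open>Pointwise: a pair cut by \<open>E \<inter> F\<close> or by \<open>E \<union> F\<close>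
  is cut by \<open>E\<close> or by \<open>F\<close>, and a pair cut by both of the former has its
  first end in both sets and its second in neither, so it is cut by both of the latter.\<close>

lemma Per_submod:
  assumes [measurable]: "E \<in> sets borel" "F \<in> sets borel" "\<Omega> \<in> sets borel"
  shows "Per \<Omega> (E \<inter> F) + Per \<Omega> (E \<union> F) \<le> Per \<Omega> E + Per \<Omega> F"
proof -
  have "Per \<Omega> (E \<inter> F) + Per \<Omega> (E \<union> F)
      = (\<integral>\<^sup>+p. indicator (cut \<Omega> (E \<inter> F)) p + indicator (cut \<Omega> (E \<union> F)) p \<partial>mu)"
    unfolding Per_def by (subst nn_integral_add) auto
  also have "\<dots> \<le> (\<integral>\<^sup>+p. indicator (cut \<Omega> E) p + indicator (cut \<Omega> F) p \<partial>mu)"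
    by (intro nn_integral_mono) (auto simp: indicator_def cut_def)
  also have "\<dots> = Per \<Omega> E + Per \<Omega> F"
    unfolding Per_def by (subst nn_integral_add) auto
  finally show ?thesis .
qed

text \<open>Fatou: for almost every pair both ends eventually have the membership that they have in
  \<open>F\<close>, so a pair cut by \<open>F\<close> is eventually cut by
  \<open>E n\<close>.\<close>

lemma Per_lsc:
  assumes [measurable]: "\<And>n::nat. E n \<in> sets borel" "F \<in> sets borel" "\<Omega> \<in> sets borel"
    and lim: "AE x in lborel. eventually (\<lambda>n. x \<in> E n \<longleftrightarrow> x \<in> F) sequentially"
  shows "Per \<Omega> F \<le> liminf (\<lambda>n. Per \<Omega> (E n))"
proof -
  have "Per \<Omega> F = (\<integral>\<^sup>+p. indicator (cut \<Omega> F) p \<partial>mu)" by (simp add: Per_def)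
  also have "\<dots> \<le> (\<integral>\<^sup>+p. liminf (\<lambda>n. indicator (cut \<Omega> (E n)) p) \<partial>mu)"
  proof (rule nn_integral_mono_AE)
    show "AE p in mu. indicator (cut \<Omega> F) p \<le> liminf (\<lambda>n. indicator (cut \<Omega> (E n)) p :: ennreal)"
      using AE_mu_pair[OF lim]
    proof eventually_elim
      case (elim p)
      then have "eventually (\<lambda>n. (fst p \<in> E n \<longleftrightarrow> fst p \<in> F) \<and> (snd p \<in> E n \<longleftrightarrow> snd p \<in> F)) sequentially"
        by (auto intro: eventually_conj)
      then have "eventually (\<lambda>n. indicator (cut \<Omega> F) p \<le> (indicator (cut \<Omega> (E n)) p :: ennreal)) sequentially"
        by eventually_elim (auto simp: cut_def indicator_def)
      then show ?case by (rule Liminf_bounded)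
    qed
  qed
  also have "\<dots> \<le> liminf (\<lambda>n. \<integral>\<^sup>+p. indicator (cut \<Omega> (E n)) p \<partial>mu)"
    by (rule nn_integral_liminf) auto
  finally show ?thesis by (simp add: Per_def)
qed

lemma Per_mono:
  assumes "\<Omega> \<subseteq> \<Omega>'" "E \<in> sets borel" "\<Omega>' \<in> sets borel"
  shows "Per \<Omega> E \<le> Per \<Omega>' E"
proof -
  have "cut \<Omega> E \<subseteq> cut \<Omega>' E" using assms(1) by (auto simp: cut_def)
  then show ?thesis unfolding Per_def using assms by (intro emeasure_mono) auto
qed

text \<open>Pairs that meet \<Omega>' but not \<Omega> see only the parts outside \<Omega>, where
  \<open>E\<close> and \<open>F\<close> agree. The common contribution is a summand and not a
  difference because perimeters may be infinite.\<close>

lemma Per_enlarge: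
  assumes [measurable]: "E \<in> sets borel" "F \<in> sets borel" "\<Omega> \<in> sets borel" "\<Omega>' \<in> sets borel"
    and sub: "\<Omega> \<subseteq> \<Omega>'" and eq: "E - \<Omega> = F - \<Omega>"
  obtains c where "Per \<Omega>' E = Per \<Omega> E + c" "Per \<Omega>' F = Per \<Omega> F + c"
proof -
  have 1: "Per \<Omega>' G = Per \<Omega> G + emeasure mu (cut \<Omega>' G - cut \<Omega> G)" if [measurable]: "G \<in> sets borel" for G
  proof -
    have "cut \<Omega>' G = cut \<Omega> G \<union> (cut \<Omega>' G - cut \<Omega> G)" using sub by (auto simp: cut_def)
    then have "Per \<Omega>' G = emeasure mu (cut \<Omega> G \<union> (cut \<Omega>' G - cut \<Omega> G))" by (simp add: Per_def)
    also have "\<dots> = Per \<Omega> G + emeasure mu (cut \<Omega>' G - cut \<Omega> G)"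
      unfolding Per_def by (subst plus_emeasure) auto
    finally show ?thesis .
  qed
  have mem: "x \<in> E \<longleftrightarrow> x \<in> F" if "x \<notin> \<Omega>" for x using eq that by blast
  have 2: "cut \<Omega>' E - cut \<Omega> E = cut \<Omega>' F - cut \<Omega> F"
    by (intro set_eqI) (auto simp: cut_def mem)
  show thesis
  proof (rule that)
    show "Per \<Omega>' E = Per \<Omega> E + emeasure mu (cut \<Omega>' E - cut \<Omega> E)" by (rule 1) simp
    show "Per \<Omega>' F = Per \<Omega> F + emeasure mu (cut \<Omega>' E - cut \<Omega> E)" unfolding 2 by (rule 1) simp
  qed
qed

lemma Per_le_enlarge:
  assumes "E \<in> sets borel" "F \<in> sets borel" "\<Omega> \<in> sets borel" "\<Omega>' \<in> sets borel"
    and "\<Omega> \<subseteq> \<Omega>'" "E - \<Omega> = F - \<Omega>" and le: "Per \<Omega> E \<le> Per \<Omega> F + c"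
  shows "Per \<Omega>' E \<le> Per \<Omega>' F + c"
proof -
  obtain d where d: "Per \<Omega>' E = Per \<Omega> E + d" "Per \<Omega>' F = Per \<Omega> F + d" using Per_enlarge[OF assms(1-6)] .
  have "Per \<Omega> E + d \<le> (Per \<Omega> F + c) + d" using le by (intro add_right_mono)
  then show ?thesis unfolding d by (simp add: ac_simps)
qed

text \<open>Finiteness of the larger perimeter permits cancelling the common summand of
  \<open>Per_enlarge\<close>.\<close>

lemma Per_le_shrink:
  assumes "E \<in> sets borel" "F \<in> sets borel" "\<Omega> \<in> sets borel" "\<Omega>' \<in> sets borel"
    and "\<Omega> \<subseteq> \<Omega>'" "E - \<Omega> = F - \<Omega>" and le: "Per \<Omega>' E \<le> Per \<Omega>' F" and fin: "Per \<Omega>' E < \<infinity>"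
  shows "Per \<Omega> E \<le> Per \<Omega> F"
proof -
  obtain d where d: "Per \<Omega>' E = Per \<Omega> E + d" "Per \<Omega>' F = Per \<Omega> F + d" using Per_enlarge[OF assms(1-6)] .
  have "d < \<infinity>" using fin d by (simp add: less_top)
  then show ?thesis using le unfolding d by (auto simp: add.commute[of _ d] ennreal_add_left_cancel_le)
qed

lemma Per_translate:
  assumes [measurable]: "E \<in> sets borel" "\<Omega> \<in> sets borel" and k: "k \<in> Zd"
  shows "Per (translate k \<Omega>) (translate k E) = Per \<Omega> E"
proof -
  have "cut (translate k \<Omega>) (translate k E) = {p. (fst p - k, snd p - k) \<in> cut \<Omega> E}" by (auto simp: cut_def)
  then show ?thesis unfolding Per_def using emeasure_mu_translate[of "cut \<Omega> E" k] k by simp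
qed

lemma Per_Compl:
  assumes [measurable]: "E \<in> sets borel" "\<Omega> \<in> sets borel"
  shows "Per \<Omega> (- E) = Per \<Omega> E"
proof -
  have "cut \<Omega> (- E) = {p. (snd p, fst p) \<in> cut \<Omega> E}" by (auto simp: cut_def)
  then show ?thesis unfolding Per_def using emeasure_mu_swap[of "cut \<Omega> E"] by simp
qed

text \<open>Only pairs with one end in \<Omega> and the other outside can be cut by the patched set
  without being cut by \<open>A\<close>.\<close>

lemma Per_patch:
  assumes [measurable]: "A \<in> sets borel" "E \<in> sets borel" "\<Omega> \<in> sets borel"
  shows "Per \<Omega> (A \<inter> \<Omega> \<union> (E - \<Omega>)) \<le> Per \<Omega> A + (interaction \<Omega> (- \<Omega>) + interaction \<Omega> (- \<Omega>))"
proof -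
  have [measurable, simp]: "\<Omega> \<times> - \<Omega> \<in> sets borel" "(- \<Omega>) \<times> \<Omega> \<in> sets borel"
    by (intro borel_Times borel_comp; simp)+
  have "cut \<Omega> (A \<inter> \<Omega> \<union> (E - \<Omega>)) \<subseteq> cut \<Omega> A \<union> (\<Omega> \<times> - \<Omega> \<union> (- \<Omega>) \<times> \<Omega>)"
    by (auto simp: cut_def)
  then have "Per \<Omega> (A \<inter> \<Omega> \<union> (E - \<Omega>)) \<le> emeasure mu (cut \<Omega> A \<union> (\<Omega> \<times> - \<Omega> \<union> (- \<Omega>) \<times> \<Omega>))"
    unfolding Per_def by (intro emeasure_mono) simp_all
  also have "\<dots> \<le> emeasure mu (cut \<Omega> A) + emeasure mu (\<Omega> \<times> - \<Omega> \<union> (- \<Omega>) \<times> \<Omega>)"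
    by (intro emeasure_subadditive) simp_all
  also have "\<dots> \<le> Per \<Omega> A + (interaction \<Omega> (- \<Omega>) + interaction (- \<Omega>) \<Omega>)"
    unfolding Per_def interaction_def by (intro add_left_mono emeasure_subadditive) simp_all
  also have "interaction (- \<Omega>) \<Omega> = interaction \<Omega> (- \<Omega>)" by (intro interaction_sym) auto
  finally show ?thesis .
qed

section \<open>Least minimizers between two sets\<close>

definition set_interval :: "(real^'n) set \<Rightarrow> (real^'n) set \<Rightarrow> (real^'n) set set" where
  "set_interval A0 A1 = {S \<in> sets borel. A0 \<subseteq> S \<and> S \<subseteq> A1}"

text \<open>\<open>lattice_min_exists\<close> is used twice: for \<open>Per \<Omega>\<close>, and
  then for the volume above \<open>A0\<close> on the minimizers, which form a lattice by
  submodularity. A minimizer of least volume lies in every other one, since intersecting the two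
  would otherwise reduce its volume.\<close>

lemma smallest_minimizer_exists:
  assumes [measurable]: "A0 \<in> sets borel" "A1 \<in> sets borel" "\<Omega> \<in> sets borel"
    and sub: "A0 \<subseteq> A1" and fin: "emeasure lborel (A1 - A0) < \<infinity>" and PerA0: "Per \<Omega> A0 < \<infinity>"
  obtains S where "S \<in> set_interval A0 A1" "\<And>F. F \<in> set_interval A0 A1 \<Longrightarrow> Per \<Omega> S \<le> Per \<Omega> F"
    "\<And>F. F \<in> set_interval A0 A1 \<Longrightarrow> Per \<Omega> F \<le> Per \<Omega> S \<Longrightarrow> S \<sqsubseteq> F"
proof -
  have mono_lim: "eventually (\<lambda>n. x \<in> A n \<longleftrightarrow> x \<in> (\<Union>i. A i)) sequentially" if "incseq A" for A :: "nat \<Rightarrow> (real^'n) set" and x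
  proof (cases "x \<in> (\<Union>i. A i)")
    case True
    then obtain N where N: "x \<in> A N" by auto
    then have "\<forall>n\<ge>N. x \<in> A n \<longleftrightarrow> x \<in> (\<Union>i. A i)" using that True by (auto simp: incseq_def)
    then show ?thesis by (auto simp: eventually_sequentially)
  qed auto
  have anti_lim: "eventually (\<lambda>n. x \<in> A n \<longleftrightarrow> x \<in> (\<Inter>i. A i)) sequentially" if "decseq A" for A :: "nat \<Rightarrow> (real^'n) set" and x
  proof (cases "x \<in> (\<Inter>i. A i)")
    case False
    then obtain N where N: "x \<notin> A N" by auto
    then have "\<forall>n\<ge>N. x \<in> A n \<longleftrightarrow> x \<in> (\<Inter>i. A i)" using that False by (auto simp: decseq_def)
    then show ?thesis by (auto simp: eventually_sequentially)
  qed auto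
  have lscU: "Per \<Omega> (\<Union>i. A i) \<le> liminf (\<lambda>i. Per \<Omega> (A i))" if "range A \<subseteq> sets borel" "incseq A" for A :: "nat \<Rightarrow> (real^'n) set"
    using that mono_lim[OF that(2)] by (intro Per_lsc) auto
  have lscI: "Per \<Omega> (\<Inter>i. A i) \<le> liminf (\<lambda>i. Per \<Omega> (A i))" if "range A \<subseteq> sets borel" "decseq A" for A :: "nat \<Rightarrow> (real^'n) set"
    using that anti_lim[OF that(2)] by (intro Per_lsc) auto
  have UN: "(\<Union>i. A i) \<in> set_interval A0 A1" if "range A \<subseteq> set_interval A0 A1" for A :: "nat \<Rightarrow> (real^'n) set"
  proof -
    have a: "A i \<in> sets borel" "A0 \<subseteq> A i" "A i \<subseteq> A1" for i using that by (auto simp: set_interval_def)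
    have "(\<Union>i. A i) \<in> sets borel" using a(1) by (intro sets.countable_UN) auto
    moreover have "A0 \<subseteq> (\<Union>i. A i)" "(\<Union>i. A i) \<subseteq> A1" using a(2,3) by blast+
    ultimately show ?thesis by (simp add: set_interval_def)
  qed
  have INT: "(\<Inter>i. A i) \<in> set_interval A0 A1" if "range A \<subseteq> set_interval A0 A1" for A :: "nat \<Rightarrow> (real^'n) set"
  proof -
    have a: "A i \<in> sets borel" "A0 \<subseteq> A i" "A i \<subseteq> A1" for i using that by (auto simp: set_interval_def)
    have "(\<Inter>i. A i) \<in> sets borel" using a(1) by (intro sets.countable_INT) auto
    moreover have "A0 \<subseteq> (\<Inter>i. A i)" "(\<Inter>i. A i) \<subseteq> A1" using a(2,3) by blast+
    ultimately show ?thesis by (simp add: set_interval_def)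
  qed
  have Int: "A \<inter> B \<in> set_interval A0 A1" and Un: "A \<union> B \<in> set_interval A0 A1" if "A \<in> set_interval A0 A1" "B \<in> set_interval A0 A1" for A B
    using that by (auto simp: set_interval_def)
  have b: "\<And>A. A \<in> set_interval A0 A1 \<Longrightarrow> A \<in> sets borel" by (auto simp: set_interval_def)
  have A0: "A0 \<in> set_interval A0 A1" using sub by (auto simp: set_interval_def)
  have "\<exists>S\<in>set_interval A0 A1. \<forall>F\<in>set_interval A0 A1. Per \<Omega> S \<le> Per \<Omega> F"
  proof (rule lattice_min_exists)
    show "set_interval A0 A1 \<noteq> {}" using A0 by auto
  qed (use UN INT Int Un lscU lscI b in \<open>auto intro!: Per_submod simp: image_subset_iff\<close>)
  then obtain S0 where S0: "S0 \<in> set_interval A0 A1" "\<And>F. F \<in> set_interval A0 A1 \<Longrightarrow> Per \<Omega> S0 \<le> Per \<Omega> F" by blast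
  define m where "m = Per \<Omega> S0"
  have m: "m < \<infinity>" using S0(2)[OF A0] PerA0 by (auto simp: m_def)
  define \<M> where "\<M> = {S \<in> set_interval A0 A1. Per \<Omega> S \<le> m}"
  have Mb: "\<And>A. A \<in> \<M> \<Longrightarrow> A \<in> sets borel" by (auto simp: \<M>_def set_interval_def)
  have MIU: "A \<inter> B \<in> \<M> \<and> A \<union> B \<in> \<M>" if "A \<in> \<M>" "B \<in> \<M>" for A B
  proof -
    have a: "A \<in> set_interval A0 A1" "B \<in> set_interval A0 A1" using that by (auto simp: \<M>_def)
    have le: "Per \<Omega> (A \<inter> B) + Per \<Omega> (A \<union> B) \<le> m + m"
      using Per_submod[of A B \<Omega>] b a that
      by (intro order_trans[OF Per_submod add_mono]) (auto simp: \<M>_def)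
    have ge: "m \<le> Per \<Omega> (A \<inter> B)" "m \<le> Per \<Omega> (A \<union> B)" using Int[OF a] Un[OF a] S0 by (auto simp: m_def)
    \<comment> \<open>Both values are at least \<open>m\<close> and their sum is at most
      \<open>m + m\<close>, so each equals \<open>m\<close>.\<close>
    have "m + Per \<Omega> (A \<union> B) \<le> m + m" using add_right_mono[OF ge(1)] le by (rule order_trans)
    moreover have "m + Per \<Omega> (A \<inter> B) \<le> m + m" using order_trans[OF add_left_mono[OF ge(2)] le] by (simp add: add.commute)
    ultimately show ?thesis using m Int[OF a] Un[OF a] by (auto simp: \<M>_def ennreal_add_left_cancel_le)
  qed
  have "\<exists>S\<in>\<M>. \<forall>F\<in>\<M>. emeasure lborel (S - A0) \<le> emeasure lborel (F - A0)"
  proof (rule lattice_min_exists)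
    show "\<M> \<noteq> {}" using S0(1) by (auto simp: \<M>_def m_def)
    show "(\<Union>i. A i) \<in> \<M>" if "range A \<subseteq> \<M>" "incseq A" for A :: "nat \<Rightarrow> (real^'n) set"
    proof -
      have "Per \<Omega> (\<Union>i. A i) \<le> liminf (\<lambda>i. Per \<Omega> (A i))" using that Mb by (intro lscU) auto
      also have "\<dots> \<le> liminf (\<lambda>i::nat. m)" using that by (intro Liminf_mono always_eventually) (auto simp: \<M>_def)
      finally have "Per \<Omega> (\<Union>i. A i) \<le> m" by (simp add: Liminf_const)
      then show ?thesis using UN[of A] that by (auto simp: \<M>_def)
    qed
    show "(\<Inter>i. A i) \<in> \<M>" if "range A \<subseteq> \<M>" "decseq A" for A :: "nat \<Rightarrow> (real^'n) set"
    proof -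
      have "Per \<Omega> (\<Inter>i. A i) \<le> liminf (\<lambda>i. Per \<Omega> (A i))" using that Mb by (intro lscI) auto
      also have "\<dots> \<le> liminf (\<lambda>i::nat. m)" using that by (intro Liminf_mono always_eventually) (auto simp: \<M>_def)
      finally have "Per \<Omega> (\<Inter>i. A i) \<le> m" by (simp add: Liminf_const)
      then show ?thesis using INT[of A] that by (auto simp: \<M>_def)
    qed
    show "emeasure lborel (A \<inter> B - A0) + emeasure lborel (A \<union> B - A0) \<le> emeasure lborel (A - A0) + emeasure lborel (B - A0)"
      if "A \<in> \<M>" "B \<in> \<M>" for A B
    proof -
      have [measurable]: "A \<in> sets borel" "B \<in> sets borel" using that Mb by auto
      have "emeasure lborel (A \<inter> B - A0) + emeasure lborel (A \<union> B - A0)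
          = (\<integral>\<^sup>+x. indicator (A \<inter> B - A0) x + indicator (A \<union> B - A0) x \<partial>lborel)"
        by (subst nn_integral_add) auto
      also have "\<dots> \<le> (\<integral>\<^sup>+x. indicator (A - A0) x + indicator (B - A0) x \<partial>lborel)"
        by (intro nn_integral_mono) (auto simp: indicator_def)
      also have "\<dots> = emeasure lborel (A - A0) + emeasure lborel (B - A0)"
        by (subst nn_integral_add) auto
      finally show ?thesis .
    qed
    show "emeasure lborel ((\<Union>i. A i) - A0) \<le> liminf (\<lambda>i. emeasure lborel (A i - A0))"
      if "range A \<subseteq> \<M>" "incseq A" for A :: "nat \<Rightarrow> (real^'n) set"
    proof -
      have "(\<lambda>i. emeasure lborel (A i - A0)) \<longlonglongrightarrow> emeasure lborel (\<Union>i. A i - A0)"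
        using that Mb by (intro Lim_emeasure_incseq) (auto simp: incseq_def)
      then have "liminf (\<lambda>i. emeasure lborel (A i - A0)) = emeasure lborel (\<Union>i. A i - A0)"
        by (intro lim_imp_Liminf) auto
      then show ?thesis by simp
    qed
    show "emeasure lborel ((\<Inter>i. A i) - A0) \<le> liminf (\<lambda>i. emeasure lborel (A i - A0))"
      if "range A \<subseteq> \<M>" "decseq A" for A :: "nat \<Rightarrow> (real^'n) set"
    proof (rule Liminf_bounded, rule always_eventually, rule allI)
      fix i
      show "emeasure lborel ((\<Inter>i. A i) - A0) \<le> emeasure lborel (A i - A0)"
      proof (rule emeasure_mono)
        have "A i \<in> \<M>" using that(1) by auto
        then show "A i - A0 \<in> sets lborel" using Mb by auto
      qed auto
    qed
  qed (use MIU in auto)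
  then obtain S where S: "S \<in> \<M>" "\<And>F. F \<in> \<M> \<Longrightarrow> emeasure lborel (S - A0) \<le> emeasure lborel (F - A0)" by blast
  have [measurable]: "S \<in> sets borel" using S Mb by auto
  have PS: "Per \<Omega> S = m" using S(1) S0(2) by (auto simp: \<M>_def m_def intro: antisym)
  show thesis
  proof
    show "S \<in> set_interval A0 A1" using S by (auto simp: \<M>_def)
    show "Per \<Omega> S \<le> Per \<Omega> F" if "F \<in> set_interval A0 A1" for F using S0(2)[OF that] PS by (simp add: m_def)
    show "S \<sqsubseteq> F" if F: "F \<in> set_interval A0 A1" "Per \<Omega> F \<le> Per \<Omega> S" for F
    proof -
      have [measurable]: "F \<in> sets borel" using F by (auto simp: set_interval_def)
      have SF: "S \<inter> F \<in> \<M>" using S(1) F PS MIU[of S F] by (auto simp: \<M>_def)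
      have finS: "emeasure lborel (S \<inter> F - A0) < \<infinity>"
      proof -
        have "emeasure lborel (S \<inter> F - A0) \<le> emeasure lborel (A1 - A0)"
          using S(1) by (intro emeasure_mono) (auto simp: \<M>_def set_interval_def)
        then show ?thesis using fin by (auto simp: less_top)
      qed
      \<comment> \<open>\<open>S \<inter> F\<close> is again a minimizer, so its volume above
        \<open>A0\<close> is not smaller than that of \<open>S\<close>, and the difference
        vanishes.\<close>
      have "emeasure lborel (S - F) = emeasure lborel ((S - A0) - (S \<inter> F - A0))"
        using F(1) by (intro arg_cong[where f = "emeasure lborel"]) (auto simp: set_interval_def)
      also have "\<dots> = emeasure lborel (S - A0) - emeasure lborel (S \<inter> F - A0)"
        using finS by (intro emeasure_Diff) auto
      also have "\<dots> = 0" using S(2)[OF SF] finS by (simp add: diff_eq_0_iff_ennreal)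
      finally show ?thesis by (intro ae_subsetI_null) auto
    qed
  qed
qed

text \<open>If adding \<open>S\<close> to \<open>F\<close> brings no gain, submodularity shows that
  \<open>S \<inter> F\<close> costs no more than \<open>S\<close>. Joining \<open>A0\<close>, a
  change by a null set only, makes it an element of the interval, where \<open>S\<close> is
  least.\<close>

lemma smallest_minimizer_ae_subset:
  assumes [measurable]: "A0 \<in> sets borel" "A1 \<in> sets borel" "\<Omega> \<in> sets borel" "F \<in> sets borel"
    and S: "S \<in> set_interval A0 A1" "\<And>F. F \<in> set_interval A0 A1 \<Longrightarrow> Per \<Omega> F \<le> Per \<Omega> S \<Longrightarrow> S \<sqsubseteq> F"
    and A0F: "A0 \<sqsubseteq> F" and fin: "Per \<Omega> F < \<infinity>" and le: "Per \<Omega> F \<le> Per \<Omega> (F \<union> S)"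
  shows "S \<sqsubseteq> F"
proof -
  have [measurable]: "S \<in> sets borel" using S by (auto simp: set_interval_def)
  let ?G = "S \<inter> F \<union> A0"
  have "Per \<Omega> (S \<inter> F) + Per \<Omega> F \<le> Per \<Omega> (S \<inter> F) + Per \<Omega> (S \<union> F)"
    using le by (intro add_left_mono) (simp add: Un_commute)
  also have "\<dots> \<le> Per \<Omega> S + Per \<Omega> F" by (intro Per_submod) auto
  finally have "Per \<Omega> (S \<inter> F) \<le> Per \<Omega> S"
    using fin by (auto simp: add.commute[of _ "Per \<Omega> F"] ennreal_add_left_cancel_le)
  moreover have "Per \<Omega> ?G = Per \<Omega> (S \<inter> F)"
  proof (rule Per_cong)
    show "?G \<sqsubseteq> S \<inter> F"
      using S(1) A0F by (intro ae_subset_Un ae_subset_Int) (auto simp: set_interval_def intro: ae_subset_subset)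
  qed (auto intro: ae_subset_subset)
  ultimately have "S \<sqsubseteq> ?G" using S(1) by (intro S(2)) (auto simp: set_interval_def)
  moreover have "?G \<sqsubseteq> F" using A0F by (intro ae_subset_Un) (auto intro: ae_subset_subset)
  ultimately show ?thesis by (rule ae_subset_trans)
qed

subsection \<open>Minimizers between obstacles\<close>

definition locally_finite :: "(real^'n) set \<Rightarrow> bool" where
  "locally_finite E \<longleftrightarrow> E \<in> sets borel \<and> (\<forall>R. Per (cube 0 R) E < \<infinity>)"

lemma locally_finite_borel: "locally_finite E \<Longrightarrow> E \<in> sets borel" by (simp add: locally_finite_def)

lemma locally_finite_bounded:
  assumes "locally_finite E" "\<Omega> \<in> sets borel" "bounded \<Omega>" shows "Per \<Omega> E < \<infinity>"
proof -
  obtain R where "\<Omega> \<subseteq> cube 0 R" using bounded_subset_cube[OF assms(3)] .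
  then have "Per \<Omega> E \<le> Per (cube 0 R) E" using assms by (intro Per_mono) (auto simp: locally_finite_def)
  then show ?thesis using assms(1) by (auto simp: locally_finite_def intro: le_less_trans)
qed

text \<open>Here \<open>L\<close> and \<open>U\<close> are obstacles; \<open>obstacle_min {} UNIV\<close> is the class A condition.\<close>
definition obstacle_min :: "(real^'n) set \<Rightarrow> (real^'n) set \<Rightarrow> (real^'n) set \<Rightarrow> bool" where
  "obstacle_min L U E \<longleftrightarrow> locally_finite E \<and> L \<sqsubseteq> E \<and> E \<sqsubseteq> U \<and>
    (\<forall>R F. F \<in> sets borel \<longrightarrow> L \<sqsubseteq> F \<longrightarrow> F \<sqsubseteq> U \<longrightarrow> F - cube 0 R = E - cube 0 R
       \<longrightarrow> Per (cube 0 R) E \<le> Per (cube 0 R) F)"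

lemma obstacle_min_locally_finite: "obstacle_min L U E \<Longrightarrow> locally_finite E" and obstacle_min_borel: "obstacle_min L U E \<Longrightarrow> E \<in> sets borel"
  and obstacle_min_lower: "obstacle_min L U E \<Longrightarrow> L \<sqsubseteq> E" and obstacle_min_upper: "obstacle_min L U E \<Longrightarrow> E \<sqsubseteq> U"
  by (auto simp: obstacle_min_def locally_finite_def)

text \<open>The definition tests only cubes around the origin. A competitor on \<Omega> is also one
  on a larger cube, and the common part cancels because the perimeter there is finite.\<close>

lemma obstacle_min_le:
  assumes E: "obstacle_min L U E" and \<Omega>: "\<Omega> \<in> sets borel" "bounded \<Omega>"
    and F: "F \<in> sets borel" "L \<sqsubseteq> F" "F \<sqsubseteq> U" "F - \<Omega> = E - \<Omega>"
  shows "Per \<Omega> E \<le> Per \<Omega> F"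
proof -
  obtain R where R: "\<Omega> \<subseteq> cube 0 R" using bounded_subset_cube[OF \<Omega>(2)] .
  have "F - cube 0 R = E - cube 0 R" using R F(4) by blast
  then have "Per (cube 0 R) E \<le> Per (cube 0 R) F" using E F by (auto simp: obstacle_min_def)
  moreover have "Per (cube 0 R) E < \<infinity>" using E by (auto simp: obstacle_min_def locally_finite_def)
  ultimately show ?thesis using R F \<Omega> obstacle_min_borel[OF E] by (intro Per_le_shrink[of E F \<Omega> "cube 0 R"]) auto
qed

lemma obstacle_min_cong:
  assumes E: "obstacle_min L U E" and "E \<sqsubseteq> E'" "E' \<sqsubseteq> E" and [measurable]: "E' \<in> sets borel"
  shows "obstacle_min L U E'"
proof -
  have [measurable]: "E \<in> sets borel" using E by (rule obstacle_min_borel)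
  have P: "Per (cube 0 R) E' = Per (cube 0 R) E" for R using assms by (intro Per_cong) auto
  have "Per (cube 0 R) E' \<le> Per (cube 0 R) F"
    if F: "F \<in> sets borel" "L \<sqsubseteq> F" "F \<sqsubseteq> U" "F - cube 0 R = E' - cube 0 R" for R F
  proof -
    have [measurable]: "F \<in> sets borel" by (rule F)
    \<comment> \<open>Competitors must agree exactly outside the cube, so the competitor of
      \<open>E'\<close> is pasted to \<open>E\<close> there.\<close>
    let ?F = "F \<inter> cube 0 R \<union> (E - cube 0 R)"
    have 1: "?F \<sqsubseteq> F"
      using assms(2) unfolding ae_subset_def by eventually_elim (use F(4) in blast)
    have 2: "F \<sqsubseteq> ?F"
      using assms(3) unfolding ae_subset_def by eventually_elim (use F(4) in blast)
    have "Per (cube 0 R) E \<le> Per (cube 0 R) ?F"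
    proof (rule obstacle_min_le[OF E])
      show "L \<sqsubseteq> ?F" using F(2) 2 by (rule ae_subset_trans)
      show "?F \<sqsubseteq> U" using 1 F(3) by (rule ae_subset_trans)
    qed (auto simp: bounded_cube)
    also have "\<dots> = Per (cube 0 R) F" using 1 2 by (intro Per_cong) auto
    finally show ?thesis by (simp add: P)
  qed
  then show ?thesis using E assms(2,3) P unfolding obstacle_min_def locally_finite_def by (auto intro: ae_subset_trans)
qed

lemma locally_finite_translate: "locally_finite E \<Longrightarrow> k \<in> Zd \<Longrightarrow> locally_finite (translate k E)"
  unfolding locally_finite_def
proof safe
  fix R assume E: "E \<in> sets borel" "\<forall>R. Per (cube 0 R) E < \<infinity>" and k: "k \<in> Zd"
  show "Per (cube 0 R) (translate k E) < \<infinity>"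
    using Per_translate[of E "cube (- k) R" k] locally_finite_bounded[of E "cube (- k) R"] E k
    by (simp add: translate_cube bounded_cube locally_finite_def)
qed auto

lemma obstacle_min_translate:
  assumes E: "obstacle_min L U E" and k: "k \<in> Zd"
  shows "obstacle_min (translate k L) (translate k U) (translate k E)"
proof -
  have [measurable]: "E \<in> sets borel" using E by (rule obstacle_min_borel)
  have "Per (cube 0 R) (translate k E) \<le> Per (cube 0 R) F"
    if F: "F \<in> sets borel" "translate k L \<sqsubseteq> F" "F \<sqsubseteq> translate k U" "F - cube 0 R = translate k E - cube 0 R" for R F
  proof -
    define F' where "F' = translate (- k) F"
    have FF': "F = translate k F'" by (simp add: F'_def translate_translate)
    have [measurable]: "F' \<in> sets borel" using F by (simp add: F'_def)
    have sub: "L \<sqsubseteq> F'" "F' \<sqsubseteq> U" using F by (simp_all add: FF' ae_subset_translate_iff)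
    have "translate (- k) (F - cube 0 R) = translate (- k) (translate k E - cube 0 R)" using F by simp
    then have "F' - cube (- k) R = E - cube (- k) R" by (simp add: translate_Diff translate_cube translate_translate F'_def)
    then have "Per (cube (- k) R) E \<le> Per (cube (- k) R) F'"
      using sub by (intro obstacle_min_le[OF E]) (auto simp: bounded_cube)
    then show ?thesis
      using Per_translate[of E "cube (- k) R" k] Per_translate[of F' "cube (- k) R" k] k by (simp add: FF' translate_cube)
  qed
  then show ?thesis using E locally_finite_translate[OF obstacle_min_locally_finite[OF E] k] by (auto simp: obstacle_min_def ae_subset_translate_iff)
qed

lemma locally_finite_Compl: "locally_finite E \<Longrightarrow> locally_finite (- E)"
  by (auto simp: locally_finite_def Per_Compl)

lemma obstacle_min_Compl:
  assumes E: "obstacle_min L U E"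
  shows "obstacle_min (- U) (- L) (- E)"
proof -
  have [measurable]: "E \<in> sets borel" using E by (rule obstacle_min_borel)
  have "Per (cube 0 R) (- E) \<le> Per (cube 0 R) F"
    if F: "F \<in> sets borel" "- U \<sqsubseteq> F" "F \<sqsubseteq> - L" "F - cube 0 R = - E - cube 0 R" for R F
  proof -
    have "Per (cube 0 R) E \<le> Per (cube 0 R) (- F)"
    proof (rule obstacle_min_le[OF E])
      show "L \<sqsubseteq> - F" using F(3) ae_subset_Compl_iff[of "- F" L] by simp
      show "- F \<sqsubseteq> U" using F(2) ae_subset_Compl_iff[of U "- F"] by simp
      show "- F - cube 0 R = E - cube 0 R" using F(4) by blast
    qed (use F in \<open>auto simp: bounded_cube\<close>)
    then show ?thesis using F by (simp add: Per_Compl)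
  qed
  then show ?thesis using E locally_finite_Compl[OF obstacle_min_locally_finite[OF E]] by (auto simp: obstacle_min_def ae_subset_Compl_iff)
qed

text \<open>A competitor \<open>F\<close> of the limit becomes one of \<open>E n\<close> by pasting
  \<open>E n\<close> outside the cube. The error is the interaction of the cube with the part of the
  limit not yet reached, and it tends to 0. The obstacles \<open>Lb n\<close> vary because
  translates of a minimizer carry translated obstacles; minimality is required only eventually
  because approximations on growing domains minimize only in cubes inside their domain.\<close>

lemma obstacle_min_limit:
  fixes E Lb :: "nat \<Rightarrow> (real^'n) set"
  assumes lfL: "locally_finite L" and LU: "L \<sqsubseteq> U"
    and [measurable]: "\<And>n. E n \<in> sets borel"
    and LE: "\<And>n. Lb n \<sqsubseteq> E n" and interaction': "\<And>n. Lb n \<sqsubseteq> L" and EU: "\<And>n. E n \<sqsubseteq> U"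
    and inc: "\<And>n. E n \<sqsubseteq> E (Suc n)" and lower: "L \<sqsubseteq> (\<Union>n. E n)"
    and min: "\<And>R. eventually (\<lambda>n. \<forall>F\<in>sets borel. Lb n \<sqsubseteq> F \<longrightarrow> F \<sqsubseteq> U \<longrightarrow> F - cube 0 R = E n - cube 0 R
        \<longrightarrow> Per (cube 0 R) (E n) \<le> Per (cube 0 R) F) sequentially"
  shows "obstacle_min L U (\<Union>n. E n)"
proof -
  define EE where "EE = (\<Union>n. E n)"
  have EE[measurable]: "EE \<in> sets borel" unfolding EE_def by measurable
  have [measurable]: "L \<in> sets borel" using lfL by (rule locally_finite_borel)
  have AEinc: "AE x in lborel. \<forall>n. x \<in> E n \<longrightarrow> x \<in> E (Suc n)"
    using inc unfolding ae_subset_def by (intro AE_all_countable[THEN iffD2] allI) auto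
  have stay: "x \<in> E m" if "\<forall>n. x \<in> E n \<longrightarrow> x \<in> E (Suc n)" "x \<in> E n" "n \<le> m" for x n m
    using that(3,2) by (induction rule: dec_induct) (use that(1) in auto)
  have lim: "AE x in lborel. eventually (\<lambda>n. x \<in> E n \<longleftrightarrow> x \<in> EE) sequentially"
    using AEinc
  proof eventually_elim
    case (elim x)
    show ?case
    proof (cases "x \<in> EE")
      case True
      then obtain N where "x \<in> E N" by (auto simp: EE_def)
      then have "\<forall>n\<ge>N. x \<in> E n \<longleftrightarrow> x \<in> EE" using stay[OF elim] True by blast
      then show ?thesis by (auto simp: eventually_sequentially)
    qed (auto simp: EE_def)
  qed
  have EEU: "EE \<sqsubseteq> U" unfolding EE_def by (rule ae_subset_UN[OF EU])
  \<comment> \<open>Pasting the obstacle \<open>L\<close> into the cube gives competitors whose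
    energy is bounded uniformly in \<open>n\<close>.\<close>
  have fin: "Per (cube 0 R) EE < \<infinity>" for R
  proof -
    let ?Q = "cube (0::real^'n) R"
    let ?c = "interaction ?Q (- ?Q) + interaction ?Q (- ?Q)"
    have "Per ?Q EE \<le> liminf (\<lambda>n. Per ?Q (E n))" using lim by (intro Per_lsc) auto
    also have "\<dots> \<le> liminf (\<lambda>n. Per ?Q L + ?c)"
    proof (rule Liminf_mono)
      show "eventually (\<lambda>n. Per ?Q (E n) \<le> Per ?Q L + ?c) sequentially"
        using min[of R]
      proof eventually_elim
        case (elim n)
        have "Per ?Q (E n) \<le> Per ?Q (L \<inter> ?Q \<union> (E n - ?Q))"
        proof (rule elim[rule_format])
          show "Lb n \<sqsubseteq> L \<inter> ?Q \<union> (E n - ?Q)"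
            using LE[of n] interaction'[of n] unfolding ae_subset_def by eventually_elim auto
          show "L \<inter> ?Q \<union> (E n - ?Q) \<sqsubseteq> U"
            using LU EU[of n] unfolding ae_subset_def by eventually_elim auto
        qed auto
        also have "\<dots> \<le> Per ?Q L + ?c" by (intro Per_patch) auto
        finally show ?case .
      qed
    qed
    also have "\<dots> = Per ?Q L + ?c" by (simp add: Liminf_const)
    also have "\<dots> < \<infinity>" using interaction_cube_finite[of 0 R] lfL by (auto simp: locally_finite_def less_top)
    finally show ?thesis .
  qed
  have "Per (cube 0 R) EE \<le> Per (cube 0 R) F"
    if F: "F \<in> sets borel" "L \<sqsubseteq> F" "F \<sqsubseteq> U" "F - cube 0 R = EE - cube 0 R" for R F
  proof -
    let ?Q = "cube (0::real^'n) R"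
    have [measurable]: "F \<in> sets borel" by (rule F)
    \<comment> \<open>The union over \<open>i \<le> n\<close> makes this sequence decreasing
      everywhere, whereas the inclusions between the \<open>E n\<close> hold only almost
      everywhere.\<close>
    define D where "D n = (EE - (\<Union>i\<le>n. E i)) - ?Q" for n
    have D[measurable]: "D n \<in> sets borel" for n unfolding D_def by measurable
    have le: "Per ?Q (F \<inter> ?Q \<union> (E n - ?Q)) \<le> Per ?Q F + interaction ?Q (D n)" for n
    proof -
      let ?G = "F \<inter> ?Q \<union> (E n - ?Q)"
      have F': "F = F \<inter> ?Q \<union> (EE - ?Q)" using F(4) by blast
      have m1: "?Q \<times> ((EE - E n) - ?Q) \<in> sets borel" by (intro borel_Times) auto
      have "cut ?Q ?G \<subseteq> cut ?Q F \<union> (?Q \<times> ((EE - E n) - ?Q))"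
        by (subst F') (auto simp: cut_def EE_def)
      then have "Per ?Q ?G \<le> emeasure mu (cut ?Q F \<union> (?Q \<times> ((EE - E n) - ?Q)))"
        unfolding Per_def using m1 by (intro emeasure_mono) auto
      also have "\<dots> \<le> Per ?Q F + interaction ?Q ((EE - E n) - ?Q)"
        unfolding Per_def interaction_def using m1 by (intro emeasure_subadditive) auto
      also have "interaction ?Q ((EE - E n) - ?Q) = interaction ?Q (D n)"
        unfolding interaction_def
      proof (rule emeasure_eq_AE)
        show "AE p in mu. (p \<in> ?Q \<times> ((EE - E n) - ?Q)) = (p \<in> ?Q \<times> D n)"
          using AE_mu_pair[OF AEinc]
        proof eventually_elim
          case (elim p)
          have "(\<exists>i\<le>n. snd p \<in> E i) \<longleftrightarrow> snd p \<in> E n" using stay[of "snd p"] elim by blast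
          then show ?case by (auto simp: D_def mem_Times_iff)
        qed
      qed (use m1 in \<open>auto intro!: borel_Times\<close>)
      finally show ?thesis .
    qed
    have "(\<lambda>n. emeasure mu (?Q \<times> D n)) \<longlonglongrightarrow> emeasure mu (\<Inter>n. ?Q \<times> D n)"
    proof (rule Lim_emeasure_decseq)
      show "range (\<lambda>n. ?Q \<times> D n) \<subseteq> sets mu" by (auto intro!: borel_Times)
      show "decseq (\<lambda>n. ?Q \<times> D n)" by (auto simp: decseq_def D_def)
      show "emeasure mu (?Q \<times> D n) \<noteq> \<infinity>" for n
      proof -
        have "interaction ?Q (D n) \<le> interaction ?Q (- ?Q)" by (intro interaction_mono) (auto simp: D_def)
        then show ?thesis using interaction_cube_finite[of 0 R] by (auto simp: interaction_def less_top)
      qed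
    qed
    moreover have "(\<Inter>n. ?Q \<times> D n) = {}" by (auto simp: D_def EE_def)
    ultimately have LLD: "(\<lambda>n. interaction ?Q (D n)) \<longlonglongrightarrow> 0" by (simp add: interaction_def)
    have "Per ?Q EE \<le> liminf (\<lambda>n. Per ?Q (E n))" using lim by (intro Per_lsc) auto
    also have "\<dots> \<le> liminf (\<lambda>n. Per ?Q F + interaction ?Q (D n))"
    proof (rule Liminf_mono)
      show "eventually (\<lambda>n. Per ?Q (E n) \<le> Per ?Q F + interaction ?Q (D n)) sequentially"
        using min[of R]
      proof eventually_elim
        case (elim n)
        have "Per ?Q (E n) \<le> Per ?Q (F \<inter> ?Q \<union> (E n - ?Q))"
        proof (rule elim[rule_format])
          show "Lb n \<sqsubseteq> F \<inter> ?Q \<union> (E n - ?Q)"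
            using LE[of n] interaction'[of n] F(2) unfolding ae_subset_def by eventually_elim auto
          show "F \<inter> ?Q \<union> (E n - ?Q) \<sqsubseteq> U"
            using F(3) EU[of n] unfolding ae_subset_def by eventually_elim auto
        qed auto
        also note le
        finally show ?case .
      qed
    qed
    also have "\<dots> = Per ?Q F"
    proof (rule lim_imp_Liminf)
      show "(\<lambda>n. Per ?Q F + interaction ?Q (D n)) \<longlonglongrightarrow> Per ?Q F"
        using tendsto_add[OF tendsto_const LLD, of "Per ?Q F"] by simp
    qed simp
    finally show ?thesis .
  qed
  then show ?thesis using fin lower EEU EE unfolding obstacle_min_def locally_finite_def EE_def by blast
qed

text \<open>The second property places \<open>E\<close> below every \<open>F\<close> above
  \<open>L\<close> that cannot be improved by adding parts of \<open>E\<close>. This one-sided form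
  lets \<open>F\<close> be a minimizer between other obstacles.\<close>

lemma least_obstacle_min_exists:
  assumes lfL: "locally_finite L" and U[measurable]: "U \<in> sets borel" and LU: "L \<subseteq> U"
  obtains E where "obstacle_min L U E"
    "\<And>F. locally_finite F \<Longrightarrow> L \<sqsubseteq> F \<Longrightarrow>
       (\<And>R G. G \<in> sets borel \<Longrightarrow> F \<subseteq> G \<Longrightarrow> G \<subseteq> F \<union> E \<Longrightarrow> G - F \<subseteq> cube 0 R \<Longrightarrow> Per (cube 0 R) F \<le> Per (cube 0 R) G)
       \<Longrightarrow> E \<sqsubseteq> F"
proof -
  define Q :: "nat \<Rightarrow> (real^'n) set" where "Q n = cube 0 (real n)" for n
  \<comment> \<open>Outside \<open>Q n\<close> the set is forced to be \<open>L\<close>, so the room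
    between the two bounds has finite volume.\<close>
  define A1 where "A1 n = L \<union> (Q n \<inter> U)" for n
  have L[measurable]: "L \<in> sets borel" using lfL by (rule locally_finite_borel)
  have Q[measurable]: "Q n \<in> sets borel" for n by (simp add: Q_def)
  have A1[measurable]: "A1 n \<in> sets borel" for n by (simp add: A1_def)
  have "\<exists>S. S \<in> set_interval L (A1 n) \<and> (\<forall>F \<in> set_interval L (A1 n). Per (Q n) S \<le> Per (Q n) F)
      \<and> (\<forall>F \<in> set_interval L (A1 n). Per (Q n) F \<le> Per (Q n) S \<longrightarrow> S \<sqsubseteq> F)" for n
  proof -
    have 1: "L \<subseteq> A1 n" by (auto simp: A1_def)
    have "emeasure lborel (A1 n - L) \<le> emeasure lborel (Q n)" by (intro emeasure_mono) (auto simp: A1_def)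
    also have "\<dots> < \<infinity>" unfolding Q_def by (rule emeasure_cube_finite)
    finally have 2: "emeasure lborel (A1 n - L) < \<infinity>" .
    have 3: "Per (Q n) L < \<infinity>" using lfL by (auto simp: Q_def locally_finite_def)
    show ?thesis by (rule smallest_minimizer_exists[OF L A1 Q 1 2 3]) blast
  qed
  then obtain M where M: "\<And>n. M n \<in> set_interval L (A1 n)" "\<And>n F. F \<in> set_interval L (A1 n) \<Longrightarrow> Per (Q n) (M n) \<le> Per (Q n) F"
      "\<And>n F. F \<in> set_interval L (A1 n) \<Longrightarrow> Per (Q n) F \<le> Per (Q n) (M n) \<Longrightarrow> M n \<sqsubseteq> F"
    by metis
  have Mb[measurable]: "M n \<in> sets borel" and LM: "L \<subseteq> M n" and MA: "M n \<subseteq> A1 n" for n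
    using M(1)[of n] by (auto simp: set_interval_def)
  have MU: "M n \<subseteq> U" for n using MA[of n] LU by (auto simp: A1_def)
  have Mmin: "Per (cube 0 R) (M n) \<le> Per (cube 0 R) F"
    if F: "F \<in> sets borel" "L \<sqsubseteq> F" "F \<sqsubseteq> U" "F - cube 0 R = M n - cube 0 R" and R: "R \<le> real n" for n F R
  proof -
    have [measurable]: "F \<in> sets borel" by (rule F)
    have sub: "cube 0 R \<subseteq> Q n" unfolding Q_def by (rule cube_mono[OF R])
    let ?F = "(F \<union> L) \<inter> A1 n"
    have FA: "AE x in lborel. x \<in> F \<longrightarrow> x \<in> A1 n"
      using F(3) unfolding ae_subset_def
    proof eventually_elim
      case (elim x)
      show ?case
      proof
        assume x: "x \<in> F"
        show "x \<in> A1 n"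
        proof (cases "x \<in> cube 0 R")
          case True then show ?thesis using x elim sub by (auto simp: A1_def)
        next
          case False then show ?thesis using x F(4) MA[of n] by blast
        qed
      qed
    qed
    have "Per (Q n) (M n) \<le> Per (Q n) ?F" by (rule M(2)) (auto simp: set_interval_def A1_def)
    also have "\<dots> = Per (Q n) F"
    proof (rule Per_cong)
      show "?F \<sqsubseteq> F" using F(2) unfolding ae_subset_def by eventually_elim auto
      show "F \<sqsubseteq> ?F" using FA unfolding ae_subset_def by eventually_elim auto
    qed auto
    finally have le: "Per (Q n) (M n) \<le> Per (Q n) F" .
    have "Per (Q n) (M n) \<le> Per (Q n) L" by (rule M(2)) (auto simp: set_interval_def A1_def)
    also have "\<dots> < \<infinity>" using lfL by (auto simp: Q_def locally_finite_def)
    finally show ?thesis using le sub F(4) by (intro Per_le_shrink[of "M n" F "cube 0 R" "Q n"]) auto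
  qed
  have comp: "M n \<sqsubseteq> F"
    if F: "F \<in> sets borel" "L \<sqsubseteq> F" "Per (Q n) F < \<infinity>" "Per (Q n) F \<le> Per (Q n) (F \<union> (M n \<inter> Q n))" for n F
  proof (rule smallest_minimizer_ae_subset[OF L A1 Q F(1) M(1) M(3) F(2,3)])
    have [measurable]: "F \<in> sets borel" by (rule F)
    have "Per (Q n) (F \<union> (M n \<inter> Q n)) = Per (Q n) (F \<union> M n)"
    proof (rule Per_cong)
      show "F \<union> M n \<sqsubseteq> F \<union> (M n \<inter> Q n)"
        using F(2) unfolding ae_subset_def by eventually_elim (use MA[of n] in \<open>auto simp: A1_def\<close>)
    qed (auto intro: ae_subset_subset)
    then show "Per (Q n) F \<le> Per (Q n) (F \<union> M n)" using F(4) by simp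
  qed
  \<comment> \<open>\<open>M (Suc n)\<close> cannot be improved by additions inside
    \<open>Q n\<close>, so the least minimizer of the smaller problem lies below it.\<close>
  have inc: "M n \<sqsubseteq> M (Suc n)" for n
  proof (rule comp)
    show "L \<sqsubseteq> M (Suc n)" using LM by (rule ae_subset_subset)
    have "Per (Q n) (M (Suc n)) \<le> Per (Q (Suc n)) (M (Suc n))"
      by (intro Per_mono) (auto simp: Q_def intro!: cube_mono)
    also have "\<dots> \<le> Per (Q (Suc n)) L" by (rule M(2)) (auto simp: set_interval_def A1_def)
    also have "\<dots> < \<infinity>" using lfL by (auto simp: Q_def locally_finite_def)
    finally show "Per (Q n) (M (Suc n)) < \<infinity>" .
    show "Per (Q n) (M (Suc n)) \<le> Per (Q n) (M (Suc n) \<union> (M n \<inter> Q n))"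
      unfolding Q_def
    proof (rule Mmin)
      show "M (Suc n) \<union> M n \<inter> cube 0 (real n) - cube 0 (real n) = M (Suc n) - cube 0 (real n)" by auto
      show "L \<sqsubseteq> M (Suc n) \<union> M n \<inter> cube 0 (real n)" using LM[of "Suc n"] by (auto intro: ae_subset_subset)
      show "M (Suc n) \<union> M n \<inter> cube 0 (real n) \<sqsubseteq> U" using MU by (intro ae_subset_subset) auto
    qed auto
  qed auto
  show thesis
  proof
    show cm: "obstacle_min L U (\<Union>n. M n)"
    proof (rule obstacle_min_limit[where Lb = "\<lambda>_. L"])
      fix R
      show "eventually (\<lambda>n. \<forall>F\<in>sets borel. L \<sqsubseteq> F \<longrightarrow> F \<sqsubseteq> U \<longrightarrow> F - cube 0 R = M n - cube 0 R
        \<longrightarrow> Per (cube 0 R) (M n) \<le> Per (cube 0 R) F) sequentially"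
        using eventually_ge_at_top[of "nat \<lceil>R\<rceil>"]
      proof eventually_elim
        case (elim n)
        then have "R \<le> real n" by linarith
        then show ?case using Mmin by blast
      qed
      show "L \<sqsubseteq> (\<Union>n. M n)" using LM[of 0] by (auto intro: ae_subset_subset)
    qed (use lfL inc LU[THEN ae_subset_subset] LM[THEN ae_subset_subset] MU[THEN ae_subset_subset] in auto)
    fix F
    assume F: "locally_finite F" "L \<sqsubseteq> F" and outer: "\<And>R G. G \<in> sets borel \<Longrightarrow> F \<subseteq> G \<Longrightarrow> G \<subseteq> F \<union> (\<Union>n. M n)
       \<Longrightarrow> G - F \<subseteq> cube 0 R \<Longrightarrow> Per (cube 0 R) F \<le> Per (cube 0 R) G"
    show "(\<Union>n. M n) \<sqsubseteq> F"
    proof (rule ae_subset_UN, rule comp)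
      fix n
      show "F \<in> sets borel" using F by (simp add: locally_finite_def)
      show "Per (Q n) F < \<infinity>" using F by (auto simp: locally_finite_def Q_def)
      show "Per (Q n) F \<le> Per (Q n) (F \<union> M n \<inter> Q n)"
        unfolding Q_def using locally_finite_borel[OF F(1)] by (intro outer) auto
    qed (rule F)
  qed
qed

end

subsection \<open>Birkhoff property\<close>

text \<open>The bound says that the l1 norm of \<omega>, dual to \<open>infnorm\<close>, is at most
  1; a cube of radius \<open>r\<close> then spans only heights within \<open>r\<close> of that of
  its centre.\<close>

definition unit_dir :: "real^'n \<Rightarrow> bool" where
  "unit_dir \<omega> \<longleftrightarrow> \<omega> \<noteq> 0 \<and> (\<forall>x. \<bar>\<omega> \<bullet> x\<bar> \<le> infnorm x)"

lemma unit_dir_uminus: "unit_dir \<omega> \<Longrightarrow> unit_dir (- \<omega>)" by (auto simp: unit_dir_def)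
lemma unit_dir_le: "unit_dir \<omega> \<Longrightarrow> \<omega> \<bullet> x \<le> infnorm x" by (auto simp: unit_dir_def abs_le_iff)
lemma unit_dir_ge: "unit_dir \<omega> \<Longrightarrow> - infnorm x \<le> \<omega> \<bullet> x" unfolding unit_dir_def by (metis abs_le_iff minus_le_iff)

text \<open>Obstacles made of integer cubes: unlike half spaces, they have locally finite perimeter for
  elementary reasons, and integer translations permute them exactly.\<close>
definition staircase :: "real^'n \<Rightarrow> real \<Rightarrow> (real^'n) set" where
  "staircase \<omega> t = (\<Union>k\<in>{k\<in>Zd. \<omega> \<bullet> k < t}. cube k 1)"

lemma staircase_borel[measurable, simp]: "staircase \<omega> t \<in> sets borel"
  unfolding staircase_def by (intro borel_open open_UN) (auto simp: cube_eq_box)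

lemma staircase_mono: "t \<le> t' \<Longrightarrow> staircase \<omega> t \<subseteq> staircase \<omega> t'" by (auto simp: staircase_def)

lemma translate_staircase: assumes "k \<in> Zd" shows "translate k (staircase \<omega> t) = staircase \<omega> (t + \<omega> \<bullet> k)"
proof (intro set_eqI iffI)
  fix x assume "x \<in> translate k (staircase \<omega> t)"
  then obtain l where l: "l \<in> Zd" "\<omega> \<bullet> l < t" "infnorm (x - k - l) < 1" by (auto simp: staircase_def cube_def)
  then have "l + k \<in> Zd" "\<omega> \<bullet> (l + k) < t + \<omega> \<bullet> k" "infnorm (x - (l + k)) < 1"
    using assms by (auto simp: Zd_add inner_add_right algebra_simps)
  then show "x \<in> staircase \<omega> (t + \<omega> \<bullet> k)" unfolding staircase_def cube_def by blast
next
  fix x assume "x \<in> staircase \<omega> (t + \<omega> \<bullet> k)"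
  then obtain l where l: "l \<in> Zd" "\<omega> \<bullet> l < t + \<omega> \<bullet> k" "infnorm (x - l) < 1" by (auto simp: staircase_def cube_def)
  then have "l - k \<in> Zd" "\<omega> \<bullet> (l - k) < t" "infnorm (x - k - (l - k)) < 1"
    using assms by (auto simp: Zd_diff inner_diff_right)
  then show "x \<in> translate k (staircase \<omega> t)" unfolding staircase_def cube_def mem_translate by blast
qed

lemma Zd_near: obtains k :: "real^'n" where "k \<in> Zd" "infnorm (x - k) < 1"
proof
  show "(\<chi> i. of_int \<lfloor>x $ i\<rfloor>) \<in> Zd" by (auto simp: Zd_def)
  show "infnorm (x - (\<chi> i. of_int \<lfloor>x $ i\<rfloor>)) < 1"
    unfolding infnorm_less_iff_cart by (auto simp: abs_less_iff) linarith+
qed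

lemma staircase_lower: assumes "unit_dir \<omega>" "\<omega> \<bullet> x < t - 1" shows "x \<in> staircase \<omega> t"
proof -
  obtain k where k: "k \<in> Zd" "infnorm (x - k) < 1" using Zd_near .
  have "\<omega> \<bullet> k = \<omega> \<bullet> x - \<omega> \<bullet> (x - k)" by (simp add: inner_diff_right)
  then have "\<omega> \<bullet> k < t" using unit_dir_ge[OF assms(1), of "x - k"] k assms(2) by linarith
  then show ?thesis using k by (auto simp: staircase_def cube_def)
qed

lemma staircase_upper: assumes "unit_dir \<omega>" "x \<in> staircase \<omega> t" shows "\<omega> \<bullet> x < t + 1"
proof -
  obtain k where k: "k \<in> Zd" "\<omega> \<bullet> k < t" "infnorm (x - k) < 1" using assms by (auto simp: staircase_def cube_def)
  have "\<omega> \<bullet> x = \<omega> \<bullet> k + \<omega> \<bullet> (x - k)" by (simp add: inner_diff_right)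
  then show ?thesis using unit_dir_le[OF assms(1), of "x - k"] k by linarith
qed

lemma finite_Zd_bounded: "finite {k\<in>(Zd :: (real^'n) set). infnorm k \<le> R}"
proof -
  let ?N = "\<lceil>R\<rceil>"
  have "{k\<in>(Zd :: (real^'n) set). infnorm k \<le> R}
      \<subseteq> (\<lambda>f. \<chi> i. of_int (f i)) ` (PiE UNIV (\<lambda>_. {- ?N..?N}) :: ('n \<Rightarrow> int) set)"
  proof
    fix k :: "real^'n" assume k: "k \<in> {k\<in>Zd. infnorm k \<le> R}"
    then have le: "\<bar>k $ i\<bar> \<le> R" for i by (auto simp: infnorm_le_iff_cart)
    have eq: "of_int \<lfloor>k $ i\<rfloor> = k $ i" for i using k by (auto simp: Zd_def elim: Ints_cases)
    have "k = (\<chi> i. of_int ((\<lambda>i. \<lfloor>k $ i\<rfloor>) i))" by (simp add: vec_eq_iff eq)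
    moreover have "(\<lambda>i. \<lfloor>k $ i\<rfloor>) \<in> PiE UNIV (\<lambda>_. {- ?N..?N})"
    proof (rule PiE_I)
      fix i
      have "- R \<le> k $ i" "k $ i \<le> R" using le[of i] by auto
      then have "\<lfloor>k $ i\<rfloor> \<le> ?N" "- ?N \<le> \<lfloor>k $ i\<rfloor>" by linarith+
      then show "\<lfloor>k $ i\<rfloor> \<in> {- ?N..?N}" by simp
    qed auto
    ultimately show "k \<in> (\<lambda>f. \<chi> i. of_int (f i)) ` (PiE UNIV (\<lambda>_. {- ?N..?N}) :: ('n \<Rightarrow> int) set)"
      by (rule image_eqI)
  qed
  then show ?thesis by (rule finite_subset) (intro finite_imageI finite_PiE, auto)
qed

lemma countable_Zd: "countable (Zd :: (real^'n) set)"
proof -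
  have "(Zd :: (real^'n) set) = (\<Union>n::nat. {k\<in>Zd. infnorm k \<le> real n})"
    using real_arch_simple by auto
  also have "countable \<dots>" by (intro countable_UN) (auto intro: countable_finite finite_Zd_bounded)
  finally show ?thesis .
qed

text \<open>When \<omega> \<bullet> k = 0 both \<open>k\<close> and \<open>- k\<close> are included,
  so lattice vectors orthogonal to \<omega> leave the set invariant up to null sets.\<close>

definition birkhoff :: "real^'n \<Rightarrow> (real^'n) set \<Rightarrow> bool" where
  "birkhoff \<omega> E \<longleftrightarrow> (\<forall>k\<in>Zd. \<omega> \<bullet> k \<le> 0 \<longrightarrow> translate k E \<sqsubseteq> E)"

lemma birkhoffD: "birkhoff \<omega> E \<Longrightarrow> k \<in> Zd \<Longrightarrow> \<omega> \<bullet> k \<le> 0 \<Longrightarrow> translate k E \<sqsubseteq> E" by (simp add: birkhoff_def)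

lemma birkhoffD_mono:
  assumes "birkhoff \<omega> E" "k \<in> Zd" "l \<in> Zd" "\<omega> \<bullet> k \<le> \<omega> \<bullet> l" shows "translate k E \<sqsubseteq> translate l E"
proof -
  have "translate (k - l) E \<sqsubseteq> E" using assms by (intro birkhoffD[OF assms(1)]) (auto simp: Zd_diff inner_diff_right)
  then have "translate l (translate (k - l) E) \<sqsubseteq> translate l E" by (simp add: ae_subset_translate_iff)
  then show ?thesis by (simp add: translate_translate)
qed

text \<open>A unit cube missed by a Birkhoff set confines the set to one side of it, since its integer
  translates in the directions of increasing \<open>\<omega> \<bullet> k\<close> cover a half space.\<close>
lemma birkhoff_clean_cube:
  assumes unit_dir: "unit_dir \<omega>" and birkhoff: "birkhoff \<omega> E" and [measurable]: "E \<in> sets borel"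
    and clean: "emeasure lborel (E \<inter> cube c 1) = 0"
  shows "E \<sqsubseteq> staircase \<omega> (\<omega> \<bullet> c + 2)"
proof -
  have null: "cube (c + k) 1 \<sqsubseteq> - E" if k: "k \<in> Zd" "0 \<le> \<omega> \<bullet> k" for k
  proof -
    have "cube c 1 \<sqsubseteq> - E"
      using clean by (intro ae_subsetI_null) (auto simp: Int_commute Diff_eq)
    then have "translate k (cube c 1) \<sqsubseteq> translate k (- E)" by (simp add: ae_subset_translate_iff)
    also have "translate k (- E) \<sqsubseteq> - E"
      using birkhoffD_mono[OF birkhoff Zd_zero k(1)] k(2) by (simp add: translate_Compl ae_subset_Compl_iff)
    finally show ?thesis by (simp add: translate_cube)
  qed
  have "AE x in lborel. \<forall>k\<in>{k\<in>Zd. 0 \<le> \<omega> \<bullet> k}. x \<in> cube (c + k) 1 \<longrightarrow> x \<in> - E"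
  proof (rule AE_ball_countable[THEN iffD2])
    show "countable {k\<in>Zd. 0 \<le> \<omega> \<bullet> k}" using countable_Zd by (rule countable_subset[rotated]) auto
  qed (use null in \<open>auto simp: ae_subset_def\<close>)
  then show ?thesis
    unfolding ae_subset_def
  proof eventually_elim
    case (elim x)
    show ?case
    proof
      assume xE: "x \<in> E"
      obtain k where k: "k \<in> Zd" "infnorm (x - c - k) < 1" using Zd_near .
      have "\<omega> \<bullet> k < 0"
      proof (rule ccontr)
        assume "\<not> \<omega> \<bullet> k < 0"
        then have "x \<in> - E" using elim k by (auto simp: cube_def algebra_simps)
        then show False using xE by simp
      qed
      moreover have "\<omega> \<bullet> x = \<omega> \<bullet> c + \<omega> \<bullet> k + \<omega> \<bullet> (x - c - k)" by (simp add: inner_diff_right)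
      ultimately have "\<omega> \<bullet> x < \<omega> \<bullet> c + 2 - 1" using unit_dir_le[OF unit_dir, of "x - c - k"] k by linarith
      then show "x \<in> staircase \<omega> (\<omega> \<bullet> c + 2)" by (rule staircase_lower[OF unit_dir])
    qed
  qed
qed

text \<open>The solution \<open>e\<close> of
  \<open>C powr p * 2 powr (s * p) * e powr (p - 1) = q\<close> with
  \<open>q = 2 powr (- s * p / (p - 1))\<close>. From a start below it, the bound
  \<open>V j \<le> e * q powr real j\<close> reproduces itself.\<close>

definition recursion_threshold :: "real \<Rightarrow> real \<Rightarrow> real \<Rightarrow> real" where
  "recursion_threshold C s p = (2 powr (- s * p / (p - 1)) / (C powr p * 2 powr (s * p))) powr (1 / (p - 1))"

lemma recursion_threshold_pos: "0 < C \<Longrightarrow> 0 < recursion_threshold C s p"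
  by (simp add: recursion_threshold_def)

text \<open>De Giorgi iteration. Raising a bound that decays like \<open>q powr real j\<close> to
  the power \<open>p > 1\<close> gains \<open>q powr (p - 1)\<close> in each step, and
  \<open>q\<close> is chosen so that this equals the growth \<open>2 powr (s * p)\<close>
  inverted.\<close>

lemma superlinear_recursion_tendsto:
  fixes V :: "nat \<Rightarrow> real"
  assumes C: "0 < C" and p: "1 < p" and s: "0 < s" and V: "\<And>j. 0 \<le> V j"
    and rec: "\<And>j. V (Suc j) \<le> (C * 2 powr (s * real (Suc j)) * V j) powr p"
    and start: "V 0 \<le> recursion_threshold C s p"
  shows "V \<longlonglongrightarrow> 0"
proof -
  define q where "q = 2 powr (- s * p / (p - 1))"
  define e where "e = recursion_threshold C s p"
  have q: "0 < q" "q < 1" using p s by (auto simp: q_def intro!: two_powr_less_one divide_neg_pos)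
  have e: "0 < e" using C by (simp add: e_def recursion_threshold_pos)
  have ep: "e powr (p - 1) = q / (C powr p * 2 powr (s * p))"
    using p C by (simp add: e_def recursion_threshold_def powr_powr q_def)
  have qp: "q powr (p - 1) = 2 powr (- s * p)"
    using p by (simp add: q_def powr_powr)
  have main: "V j \<le> e * q powr real j" for j
  proof (induction j)
    case 0
    then show ?case using start q by (simp add: e_def)
  next
    case (Suc j)
    have "V (Suc j) \<le> (C * 2 powr (s * real (Suc j)) * V j) powr p" by (rule rec)
    also have "\<dots> \<le> (C * 2 powr (s * real (Suc j)) * (e * q powr real j)) powr p"
      using Suc C p V by (intro powr_mono2 mult_left_mono mult_nonneg_nonneg) auto
    also have "\<dots> = C powr p * 2 powr (s * real (Suc j) * p) * (e powr p * q powr (real j * p))"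
      using C e q by (simp add: powr_mult powr_powr)
    also have "e powr p = e * e powr (p - 1)" using e by (simp add: powr_diff)
    also have "2 powr (s * real (Suc j) * p) = 2 powr (s * p) * 2 powr (s * p * real j)"
      by (simp add: powr_add[symmetric] algebra_simps)
    also have "q powr (real j * p) = q powr real j * (q powr (p - 1)) powr real j"
      by (simp add: powr_powr powr_add[symmetric] algebra_simps)
    also have "(q powr (p - 1)) powr real j = 2 powr (- (s * p * real j))"
      unfolding qp by (simp add: powr_powr)
    also have "C powr p * (2 powr (s * p) * 2 powr (s * p * real j)) * (e * e powr (p - 1) * (q powr real j * 2 powr (- (s * p * real j))))
        = (C powr p * 2 powr (s * p) * e powr (p - 1)) * e * q powr real j * (2 powr (s * p * real j) * 2 powr (- (s * p * real j)))"
      by (simp add: algebra_simps)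
    also have "2 powr (s * p * real j) * 2 powr (- (s * p * real j)) = (1::real)"
      by (subst powr_add[symmetric]) simp
    also have "C powr p * 2 powr (s * p) * e powr (p - 1) = q" using C by (simp add: ep)
    also have "q * e * q powr real j * 1 = e * q powr real (Suc j)" using q by (simp add: powr_add)
    finally show ?case .
  qed
  have "(\<lambda>j. e * q ^ j) \<longlonglongrightarrow> e * 0" using q by (intro tendsto_mult tendsto_const LIMSEQ_power_zero) auto
  then have "(\<lambda>j. e * q powr real j) \<longlonglongrightarrow> 0" using q by (simp add: powr_realpow)
  then show ?thesis by (rule real_tendsto_sandwich[rotated 3, OF _ , where f = "\<lambda>_. 0"]) (use V main in auto)
qed

context kernel
begin

text \<open>A cut pair starting in the cube leaves one of the finitely many lattice cubes near it,
  each of which has finite interaction with its complement; every other cut pair crosses the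
  boundary of the cube.\<close>

lemma locally_finite_staircase: "locally_finite (staircase \<omega> t)"
  unfolding locally_finite_def
proof safe
  fix R
  let ?Q = "cube (0::real^'n) R"
  let ?J = "{k\<in>(Zd::(real^'n) set). infnorm k \<le> R + 1}"
  have b[simp]: "cube k 1 \<times> - cube k 1 \<in> sets borel" "(- ?Q) \<times> ?Q \<in> sets borel" for k :: "real^'n"
    by (intro borel_Times borel_comp; simp)+
  have J: "finite ?J" by (rule finite_Zd_bounded)
  have UJ[simp]: "(\<Union>k\<in>?J. cube k 1 \<times> - cube k 1) \<in> sets borel" by (intro sets.finite_UN J) auto
  have "cut ?Q (staircase \<omega> t) \<subseteq> (\<Union>k\<in>?J. cube k 1 \<times> - cube k 1) \<union> (- ?Q) \<times> ?Q"
  proof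
    fix p assume p: "p \<in> cut ?Q (staircase \<omega> t)"
    then obtain k where k: "k \<in> Zd" "\<omega> \<bullet> k < t" "fst p \<in> cube k 1" by (auto simp: cut_def staircase_def)
    have y: "snd p \<notin> cube k 1" using p k by (auto simp: cut_def staircase_def)
    show "p \<in> (\<Union>k\<in>?J. cube k 1 \<times> - cube k 1) \<union> (- ?Q) \<times> ?Q"
    proof (cases "fst p \<in> ?Q")
      case True
      have "infnorm k \<le> infnorm (fst p) + infnorm (fst p - k)"
        using infnorm_triangle[of "fst p" "k - fst p"] by (simp add: infnorm_sub)
      then have "k \<in> ?J" using True k by (auto simp: cube_def)
      then show ?thesis using k y by (auto simp: mem_Times_iff)
    next
      case False
      then show ?thesis using p by (auto simp: cut_def mem_Times_iff)
    qed
  qed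
  then have "Per ?Q (staircase \<omega> t) \<le> emeasure mu ((\<Union>k\<in>?J. cube k 1 \<times> - cube k 1) \<union> (- ?Q) \<times> ?Q)"
    unfolding Per_def by (intro emeasure_mono) (simp_all add: UJ b(2) sets.Un[OF UJ b(2)])
  also have "\<dots> \<le> emeasure mu (\<Union>k\<in>?J. cube k 1 \<times> - cube k 1) + emeasure mu ((- ?Q) \<times> ?Q)"
    by (intro emeasure_subadditive) (simp_all add: UJ b(2) sets.Un[OF UJ b(2)])
  also have "\<dots> \<le> (\<Sum>k\<in>?J. interaction (cube k 1) (- cube k 1)) + interaction (- ?Q) ?Q"
    unfolding interaction_def using J by (intro add_mono emeasure_subadditive_finite) auto
  also have "\<dots> < \<infinity>"
    using J interaction_cube_finite interaction_cube_finite[of 0 R] by (auto simp: interaction_sym[of "- ?Q" ?Q] less_top)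
  finally show "Per ?Q (staircase \<omega> t) < \<infinity>" .
qed simp

definition least_obstacle_min :: "(real^'n) set \<Rightarrow> (real^'n) set \<Rightarrow> (real^'n) set \<Rightarrow> bool" where
  "least_obstacle_min L U E \<longleftrightarrow> obstacle_min L U E \<and>
    (\<forall>F. locally_finite F \<longrightarrow> L \<sqsubseteq> F \<longrightarrow>
       (\<forall>R G. G \<in> sets borel \<longrightarrow> F \<subseteq> G \<longrightarrow> G \<subseteq> F \<union> E \<longrightarrow> G - F \<subseteq> cube 0 R \<longrightarrow> Per (cube 0 R) F \<le> Per (cube 0 R) G)
       \<longrightarrow> E \<sqsubseteq> F)"

lemma least_obstacle_min_staircase: assumes "a \<le> b" obtains E where "least_obstacle_min (staircase \<omega> a) (staircase \<omega> b) E"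
  by (rule least_obstacle_min_exists[OF locally_finite_staircase staircase_borel staircase_mono[OF assms]]) (auto simp: least_obstacle_min_def)

text \<open>Adding parts of \<open>E\<close> to \<open>F\<close> stays below \<open>U'\<close>, and
  above \<open>L'\<close> because \<open>F\<close> is contained in the result; so minimality of
  \<open>F\<close> between its own obstacles suffices. This is the comparison principle used
  throughout.\<close>

lemma least_obstacle_min_ae_subset:
  assumes E: "least_obstacle_min L U E" and F: "obstacle_min L' U' F" and LF: "L \<sqsubseteq> F" and EU: "E \<sqsubseteq> U'"
  shows "E \<sqsubseteq> F"
proof -
  have "Per (cube 0 R) F \<le> Per (cube 0 R) G"
    if G: "G \<in> sets borel" "F \<subseteq> G" "G \<subseteq> F \<union> E" "G - F \<subseteq> cube 0 R" for R G
  proof (rule obstacle_min_le[OF F])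
    show "L' \<sqsubseteq> G" using obstacle_min_lower[OF F] ae_subset_subset[OF G(2)] by (rule ae_subset_trans)
    show "G \<sqsubseteq> U'" using ae_subset_subset[OF G(3)] ae_subset_Un[OF obstacle_min_upper[OF F] EU] by (rule ae_subset_trans)
    show "G - cube 0 R = F - cube 0 R" using G by blast
  qed (use G in \<open>auto simp: bounded_cube\<close>)
  then show ?thesis using E obstacle_min_locally_finite[OF F] LF by (auto simp: least_obstacle_min_def)
qed

lemma least_obstacle_min_imp: "least_obstacle_min L U E \<Longrightarrow> obstacle_min L U E" by (simp add: least_obstacle_min_def)

text \<open>For \<omega> \<bullet> k \<le> 0 the translate by \<open>- k\<close> is a minimizer
  between obstacles at least as high, so the least minimizer lies below it.\<close>

lemma least_obstacle_min_birkhoff: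
  assumes E: "least_obstacle_min (staircase \<omega> a) (staircase \<omega> b) E"
  shows "birkhoff \<omega> E"
  unfolding birkhoff_def
proof safe
  fix k assume k: "k \<in> Zd" "\<omega> \<bullet> k \<le> 0"
  note cE = least_obstacle_min_imp[OF E]
  have c: "obstacle_min (staircase \<omega> (a - \<omega> \<bullet> k)) (staircase \<omega> (b - \<omega> \<bullet> k)) (translate (- k) E)"
    using obstacle_min_translate[OF cE Zd_uminus[OF k(1)]] by (simp add: translate_staircase Zd_uminus k(1))
  have "E \<sqsubseteq> translate (- k) E"
  proof (rule least_obstacle_min_ae_subset[OF E c])
    show "staircase \<omega> a \<sqsubseteq> translate (- k) E"
      using k(2) by (intro ae_subset_trans[OF ae_subset_subset[OF staircase_mono] obstacle_min_lower[OF c]]) auto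
    show "E \<sqsubseteq> staircase \<omega> (b - \<omega> \<bullet> k)"
      using k(2) by (intro ae_subset_trans[OF obstacle_min_upper[OF cE] ae_subset_subset[OF staircase_mono]]) auto
  qed
  then have "translate k E \<sqsubseteq> translate k (translate (- k) E)" by (simp only: ae_subset_translate_iff)
  then show "translate k E \<sqsubseteq> E" by (simp add: translate_translate)
qed

subsection \<open>Density estimates\<close>

lemma interaction_Un:
  assumes "A \<in> sets borel" "B \<in> sets borel" "C \<in> sets borel" "B \<inter> C = {}"
  shows "interaction A (B \<union> C) = interaction A B + interaction A C"
proof -
  have "A \<times> (B \<union> C) = A \<times> B \<union> A \<times> C" by auto
  then show ?thesis unfolding interaction_def using assms by (subst plus_emeasure) (auto intro: borel_Times)
qed

text \<open>Removing \<open>E \<inter> Q\<close> destroys its contacts with \<open>- E\<close> and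
  creates contacts with \<open>E - Q\<close>. Minimality bounds the former by the latter, and the
  latter cross the boundary of \<open>Q\<close>.\<close>

lemma interaction_removal:
  assumes [measurable]: "E \<in> sets borel" "Q \<in> sets borel"
    and le: "Per Q E \<le> Per Q (E - Q)" and fin: "Per Q E < \<infinity>"
  shows "interaction (E \<inter> Q) (- (E \<inter> Q)) \<le> 2 * interaction (E \<inter> Q) (- Q)"
proof -
  let ?A = "E \<inter> Q"
  have b: "A \<times> B \<in> sets mu" if "A \<in> sets borel" "B \<in> sets borel" for A B :: "(real^'n) set"
    using that by (simp add: borel_Times)
  have "cut Q E = ?A \<times> (- E) \<union> (E - Q) \<times> (Q - E)" by (auto simp: cut_def)
  then have 1: "Per Q E = interaction ?A (- E) + interaction (E - Q) (Q - E)"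
    unfolding Per_def interaction_def by (simp only:) (rule plus_emeasure[symmetric]; (rule b)?; auto)
  have "cut Q (E - Q) = (E - Q) \<times> (?A \<union> (Q - E))" by (auto simp: cut_def)
  then have "Per Q (E - Q) = interaction (E - Q) (?A \<union> (Q - E))" by (simp add: Per_def interaction_def)
  also have "\<dots> = interaction (E - Q) ?A + interaction (E - Q) (Q - E)" by (rule interaction_Un) auto
  finally have "interaction (E - Q) (Q - E) + interaction ?A (- E) \<le> interaction (E - Q) (Q - E) + interaction (E - Q) ?A"
    using le unfolding 1 by (simp add: add.commute)
  moreover have "interaction (E - Q) (Q - E) < \<infinity>" using fin unfolding 1 by (simp add: less_top)
  ultimately have "interaction ?A (- E) \<le> interaction (E - Q) ?A" by (auto simp: ennreal_add_left_cancel_le)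
  also have "\<dots> = interaction ?A (E - Q)" by (rule interaction_sym) auto
  finally have 2: "interaction ?A (- E) \<le> interaction ?A (E - Q)" .
  have "- ?A = (- E) \<union> (E - Q)" by auto
  then have "interaction ?A (- ?A) = interaction ?A (- E) + interaction ?A (E - Q)" 
    by (simp only:) (rule interaction_Un; auto)
  also have "\<dots> \<le> interaction ?A (E - Q) + interaction ?A (E - Q)" using 2 by (intro add_right_mono)
  also have "\<dots> \<le> interaction ?A (- Q) + interaction ?A (- Q)" by (intro add_mono interaction_mono) auto
  finally show ?thesis by (simp add: mult_2)
qed

text \<open>The factor \<open>2 * c / lam\<close>, with \<open>c\<close> the averaging constant,
  comes from removal, averaging and isoperimetry; the exponent is the inverse of the isoperimetric
  exponent \<open>1 - s / d\<close>.\<close>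

abbreviation density_threshold :: "'n itself \<Rightarrow> real" where
  "density_threshold _ \<equiv> recursion_threshold (2 * (Lam * near_const (real CARD('n)) s) / lam) s (1 / (1 - s / real CARD('n)))"

text \<open>The volume of \<open>E\<close> in cubes with radii shrinking from 2 to 1 obeys a
  superlinear recursion: isoperimetry bounds a power \<theta> < 1 of the volume by an interaction,
  minimality moves this interaction to the boundary of the cube, and averaging over radii bounds it
  by the volume in a slightly larger cube.\<close>

lemma small_density_vanishes:
  assumes [measurable]: "E \<in> sets borel"
    and fin: "\<And>r. Per (cube c r) E < \<infinity>"
    and le: "\<And>r. 1 \<le> r \<Longrightarrow> r \<le> 2 \<Longrightarrow> Per (cube c r) E \<le> Per (cube c r) (E - cube c r)"
    and small: "emeasure lborel (E \<inter> cube c 2) \<le> ennreal (density_threshold TYPE('n))"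
  shows "emeasure lborel (E \<inter> cube c 1) = 0"
proof (rule ccontr)
  assume pos: "emeasure lborel (E \<inter> cube c 1) \<noteq> 0"
  define D where "D = real CARD('n)"
  define cK where "cK = Lam * near_const D s"
  define \<theta> where "\<theta> = 1 - s / D"
  have D: "1 \<le> D" unfolding D_def by (simp add: Suc_leI)
  have \<theta>: "0 < \<theta>" "\<theta> < 1" using s D by (auto simp: \<theta>_def field_simps)
  have cK: "0 < cK" using kernel_const_pos by (simp add: cK_def D_def)
  define V where "V r = measure lborel (E \<inter> cube c r)" for r
  have Vem: "emeasure lborel (E \<inter> cube c r) = ennreal (V r)" for r
  proof -
    have "emeasure lborel (E \<inter> cube c r) \<le> emeasure lborel (cube c r)" by (intro emeasure_mono) auto
    also have "\<dots> < \<infinity>" by (rule emeasure_cube_finite)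
    finally show ?thesis unfolding V_def by (intro emeasure_eq_ennreal_measure) auto
  qed
  have Vmono: "V r \<le> V r'" if "r \<le> r'" for r r'
  proof -
    have "emeasure lborel (E \<inter> cube c r) \<le> emeasure lborel (E \<inter> cube c r')"
      using cube_mono[OF that, of c] by (intro emeasure_mono) auto
    then show ?thesis by (simp add: Vem V_def)
  qed
  have V1: "0 < V 1" using pos Vem[of 1] by (auto simp: V_def zero_less_measure_iff emeasure_eq_ennreal_measure)
  have Vpos: "0 < V r" if "1 \<le> r" for r using V1 Vmono[OF that] by linarith
  have half: "ennreal (a / 2) \<le> y" if "ennreal a \<le> 2 * y" "0 \<le> a" for a y
  proof (cases y)
    case (real b)
    then have "ennreal a \<le> ennreal (2 * b)" using that by (simp add: ennreal_mult')
    then show ?thesis using real by (simp add: ennreal_leI)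
  qed simp
  have step: "V r1 powr \<theta> \<le> (2 * cK / lam) * (r2 - r1) powr (- s) * V r2" if r: "1 \<le> r1" "r1 < r2" "r2 \<le> 2" for r1 r2
  proof -
    have "ennreal ((r2 - r1) * (lam * V r1 powr \<theta> / 2)) = (\<integral>\<^sup>+r. indicator {r1..r2} r * ennreal (lam * V r1 powr \<theta> / 2) \<partial>lborel)"
      using r lam by (subst nn_integral_multc) (auto simp: ennreal_mult'[symmetric])
    also have "\<dots> \<le> (\<integral>\<^sup>+r. indicator {r1..r2} r * interaction (E \<inter> cube c r) (UNIV - cube c r) \<partial>lborel)"
    proof (intro nn_integral_mono)
      fix r
      show "indicator {r1..r2} r * ennreal (lam * V r1 powr \<theta> / 2) \<le> indicator {r1..r2} r * interaction (E \<inter> cube c r) (UNIV - cube c r)"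
      proof (cases "r \<in> {r1..r2}")
        case True
        have "ennreal (lam * V r1 powr \<theta>) \<le> ennreal (lam * V r powr \<theta>)"
          using True lam \<theta> Vmono[of r1 r] Vpos r by (intro ennreal_leI mult_left_mono powr_mono2) (auto intro: less_imp_le)
        also have "\<dots> \<le> interaction (E \<inter> cube c r) (- (E \<inter> cube c r))"
          unfolding \<theta>_def D_def using Vpos[of r] True r by (intro isoperimetric Vem) auto
        also have "\<dots> \<le> 2 * interaction (E \<inter> cube c r) (- cube c r)"
          using True r by (intro interaction_removal le fin) auto
        finally have "ennreal (lam * V r1 powr \<theta> / 2) \<le> interaction (E \<inter> cube c r) (- cube c r)"
          using half[of "lam * V r1 powr \<theta>" "interaction (E \<inter> cube c r) (- cube c r)"] lam by simp
        then show ?thesis using True by (simp add: Compl_eq_Diff_UNIV)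
      qed auto
    qed
    also have "\<dots> \<le> ennreal (cK * (r2 - r1) powr (1 - s)) * emeasure lborel (E \<inter> cube c r2)"
      unfolding cK_def D_def using r by (intro nn_integral_interaction_cube_fst) auto
    also have "\<dots> = ennreal (cK * (r2 - r1) powr (1 - s) * V r2)"
      using cK Vpos[of r2] r by (simp add: Vem ennreal_mult'')
    finally have "(r2 - r1) * (lam * V r1 powr \<theta> / 2) \<le> cK * (r2 - r1) powr (1 - s) * V r2"
      using cK Vpos[of r2] r by (subst (asm) ennreal_le_iff) auto
    then have "(r2 - r1) * (lam * V r1 powr \<theta>) \<le> 2 * (cK * (r2 - r1) powr (1 - s) * V r2)" by simp
    also have "(r2 - r1) powr (1 - s) = (r2 - r1) * (r2 - r1) powr (- s)"
      using r by (simp add: powr_diff powr_minus_divide)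
    finally have "(r2 - r1) * (lam * V r1 powr \<theta>) \<le> (r2 - r1) * (lam * ((2 * cK / lam) * (r2 - r1) powr (- s) * V r2))"
      using lam by (simp add: algebra_simps)
    then have "lam * V r1 powr \<theta> \<le> lam * ((2 * cK / lam) * (r2 - r1) powr (- s) * V r2)"
      using r by (simp only: mult_le_cancel_left_pos diff_gt_0_iff_gt)
    then show ?thesis using lam by (simp only: mult_le_cancel_left_pos)
  qed
  \<comment> \<open>Consecutive radii differ by \<open>2 powr - real (Suc j)\<close>, whose power
    \<open>- s\<close> is the growing factor of the recursion.\<close>
  define W where "W j = V (1 + (1/2) ^ j)" for j :: nat
  have "W \<longlonglongrightarrow> 0"
  proof (rule superlinear_recursion_tendsto)
    show "0 < 2 * cK / lam" using cK lam by simp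
    show "1 < 1 / \<theta>" using \<theta> by (simp add: field_simps)
    show "0 < s" by (rule s(1))
    show "0 \<le> W j" for j using Vpos[of "1 + (1/2) ^ j"] by (auto simp: W_def intro: less_imp_le)
    show "W (Suc j) \<le> (2 * cK / lam * 2 powr (s * real (Suc j)) * W j) powr (1 / \<theta>)" for j
    proof -
      have "(1/2::real) ^ j \<le> 1" by (intro power_le_one) auto
      then have "V (1 + (1/2) ^ Suc j) powr \<theta> \<le> (2 * cK / lam) * ((1 + (1/2) ^ j) - (1 + (1/2) ^ Suc j)) powr (- s) * V (1 + (1/2) ^ j)"
        by (intro step) auto
      also have "(1 + (1/2::real) ^ j) - (1 + (1/2) ^ Suc j) = 2 powr (- real (Suc j))"
        by (simp add: powr_minus powr_realpow field_simps del: of_nat_Suc)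
      also have "(2 powr (- real (Suc j))) powr (- s) = 2 powr (s * real (Suc j))"
        by (simp add: powr_powr mult.commute del: of_nat_Suc)
      finally have "(W (Suc j) powr \<theta>) powr (1 / \<theta>) \<le> (2 * cK / lam * 2 powr (s * real (Suc j)) * W j) powr (1 / \<theta>)"
        unfolding W_def using \<theta> by (intro powr_mono2) auto
      moreover have "(W (Suc j) powr \<theta>) powr (1 / \<theta>) = W (Suc j)"
        using \<theta> Vpos[of "1 + (1/2) ^ Suc j"] by (simp add: powr_powr W_def)
      ultimately show ?thesis by simp
    qed
    have "ennreal (V 2) \<le> ennreal (recursion_threshold (2 * cK / lam) s (1 / \<theta>))"
      using small by (simp add: Vem cK_def D_def \<theta>_def)
    then show "W 0 \<le> recursion_threshold (2 * cK / lam) s (1 / \<theta>)"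
      using cK lam by (subst (asm) ennreal_le_iff) (auto simp: W_def recursion_threshold_pos less_imp_le)
  qed
  moreover have "V 1 \<le> W j" for j unfolding W_def by (rule Vmono) auto
  ultimately have "V 1 \<le> 0" by (intro LIMSEQ_le_const) auto
  then show False using V1 by simp
qed

text \<open>The perimeter in the cube of radius \<open>R\<close> is at most that in every larger
  concentric cube, hence at most the average, over radii up to \<open>2 * R\<close>, of the
  interaction of a cube with its complement.\<close>

lemma energy_bound:
  assumes [measurable]: "E \<in> sets borel" and R: "0 < R"
    and le: "\<And>r. R \<le> r \<Longrightarrow> r \<le> 2 * R \<Longrightarrow> Per (cube z r) E \<le> interaction (cube z r) (- cube z r)"
  shows "Per (cube z R) E \<le> ennreal (Lam * near_const (real CARD('n)) s * 4 ^ CARD('n) * R powr (real CARD('n) - s))"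
proof -
  define cK where "cK = Lam * near_const (real CARD('n)) s"
  have cK: "0 < cK" using kernel_const_pos by (simp add: cK_def)
  have "ennreal R * Per (cube z R) E = (\<integral>\<^sup>+r. indicator {R..2*R} r * Per (cube z R) E \<partial>lborel)"
    using R by (subst nn_integral_multc) auto
  also have "\<dots> \<le> (\<integral>\<^sup>+r. indicator {R..2*R} r * interaction (UNIV \<inter> cube z r) (UNIV - cube z r) \<partial>lborel)"
  proof (intro nn_integral_mono)
    fix r
    have "Per (cube z R) E \<le> interaction (UNIV \<inter> cube z r) (UNIV - cube z r)" if "r \<in> {R..2*R}"
    proof -
      have "Per (cube z R) E \<le> Per (cube z r) E" using that by (intro Per_mono cube_mono) auto
      also have "\<dots> \<le> interaction (cube z r) (- cube z r)" using that by (intro le) auto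
      finally show ?thesis by (simp add: Compl_eq_Diff_UNIV)
    qed
    then show "indicator {R..2*R} r * Per (cube z R) E \<le> indicator {R..2*R} r * interaction (UNIV \<inter> cube z r) (UNIV - cube z r)"
      by (auto simp: indicator_def)
  qed
  also have "\<dots> \<le> ennreal (cK * (2 * R - R) powr (1 - s)) * emeasure lborel (UNIV \<inter> cube z (2 * R))"
    unfolding cK_def using R by (intro nn_integral_interaction_cube_fst) auto
  also have "\<dots> = ennreal (cK * R powr (1 - s) * (4 * R) ^ CARD('n))"
    using R cK emeasure_cube[of "2 * R" z] by (simp add: ennreal_mult'[symmetric])
  also have "cK * R powr (1 - s) * (4 * R) ^ CARD('n) = R * (cK * 4 ^ CARD('n) * R powr (real CARD('n) - s))"
  proof -
    have "R powr (1 - s) * R ^ CARD('n) = R powr (1 - s + real CARD('n))"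
      using R by (simp add: powr_add powr_realpow)
    also have "\<dots> = R * R powr (real CARD('n) - s)" using R by (simp add: powr_diff powr_add field_simps)
    finally show ?thesis by (simp add: power_mult_distrib algebra_simps)
  qed
  also have "ennreal \<dots> = ennreal R * ennreal (cK * 4 ^ CARD('n) * R powr (real CARD('n) - s))"
    using R by (simp add: ennreal_mult')
  finally show ?thesis using R unfolding cK_def
    by (subst (asm) ennreal_mult_le_mult_iff) auto
qed

text \<open>Pairs inside disjoint subcubes are disjoint parts of the cut. If all
  \<open>m ^ d\<close> subcubes of radius 2 contained more than \<epsilon> of both \<open>E\<close>
  and its complement, their contributions would add up to more than \<open>C\<close>.\<close>

lemma exists_cube_small_density:
  assumes [measurable]: "E \<in> sets borel" and m: "0 < m"
    and en: "Per (cube z (2 * real m)) E \<le> ennreal C"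
    and \<epsilon>: "0 < \<epsilon>" and small: "C < real m ^ CARD('n) * (lam * 4 powr - (real CARD('n) + s) * \<epsilon> ^ 2)"
  obtains c where "cube c 2 \<subseteq> cube z (2 * real m)"
    "emeasure lborel (E \<inter> cube c 2) \<le> ennreal \<epsilon> \<or> emeasure lborel (cube c 2 - E) \<le> ennreal \<epsilon>"
proof (rule ccontr)
  assume "\<not> thesis"
  with that have none: "ennreal \<epsilon> < emeasure lborel (E \<inter> cube c 2) \<and> ennreal \<epsilon> < emeasure lborel (cube c 2 - E)"
    if "cube c 2 \<subseteq> cube z (2 * real m)" for c
    using that by (meson not_le)
  define I :: "('n \<Rightarrow> nat) set" where "I = PiE UNIV (\<lambda>_. {..<m})"
  \<comment> \<open>A grid of spacing 4: the open cubes of radius 2 around these centres are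
    disjoint and fill the large cube up to a null set.\<close>
  define c :: "('n \<Rightarrow> nat) \<Rightarrow> real^'n" where "c a = (\<chi> i. z $ i - 2 * real m + 4 * real (a i) + 2)" for a
  have I: "finite I" "card I = m ^ CARD('n)" unfolding I_def by (auto intro!: finite_PiE simp: card_PiE)
  have sub: "cube (c a) 2 \<subseteq> cube z (2 * real m)" if "a \<in> I" for a
  proof (rule cube_subset_cube)
    have "infnorm (c a - z) \<le> 2 * real m - 2"
      unfolding infnorm_le_iff_cart
    proof
      fix i
      have "a i < m" using that by (auto simp: I_def PiE_def Pi_def)
      then have "real (a i) + 1 \<le> real m" by linarith
      then show "\<bar>(c a - z) $ i\<bar> \<le> 2 * real m - 2" by (auto simp: c_def abs_le_iff)
    qed
    then show "infnorm (c a - z) + 2 \<le> 2 * real m" by simp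
  qed
  have disj: "cube (c a) 2 \<inter> cube (c b) 2 = {}" if ab: "a \<noteq> b" for a b
  proof (rule ccontr)
    assume "\<not> ?thesis"
    then obtain x where x: "x \<in> cube (c a) 2" "x \<in> cube (c b) 2" by auto
    obtain i where i: "a i \<noteq> b i" using ab by auto
    have "\<bar>(x - c a) $ i\<bar> < 2" "\<bar>(x - c b) $ i\<bar> < 2" using x by (auto simp: cube_def infnorm_less_iff_cart)
    moreover have "(x - c b) $ i - (x - c a) $ i = 4 * (real (a i) - real (b i))" by (simp add: c_def)
    moreover have "1 \<le> \<bar>real (a i) - real (b i)\<bar>" using i by linarith
    moreover have "False" if "\<bar>p\<bar> < 2" "\<bar>q\<bar> < 2" "q - p = 4 * e" "1 \<le> \<bar>e\<bar>" for p q e :: real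
      using that by linarith
    ultimately show False by blast
  qed
  define F where "F a = (E \<inter> cube (c a) 2) \<times> (cube (c a) 2 - E)" for a
  have Fb: "F a \<in> sets mu" for a unfolding F_def by (simp add: borel_Times)
  define \<kappa> where "\<kappa> = lam * 4 powr - (real CARD('n) + s) * \<epsilon> ^ 2"
  have \<kappa>: "0 < \<kappa>" using lam \<epsilon> by (simp add: \<kappa>_def)
  have low: "ennreal \<kappa> \<le> emeasure mu (F a)" if a: "a \<in> I" for a
  proof -
    have "ennreal \<kappa> = ennreal (lam * 4 powr - (real CARD('n) + s)) * (ennreal \<epsilon> * ennreal \<epsilon>)"
      using lam \<epsilon> by (simp add: \<kappa>_def ennreal_mult'[symmetric] power2_eq_square)
    also have "\<dots> \<le> ennreal (lam * 4 powr - (real CARD('n) + s)) * (emeasure lborel (E \<inter> cube (c a) 2) * emeasure lborel (cube (c a) 2 - E))"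
      using none[OF sub[OF a]] by (intro mult_left_mono mult_mono) (auto intro: less_imp_le)
    also have "\<dots> \<le> interaction (E \<inter> cube (c a) 2) (cube (c a) 2 - E)"
    proof (rule interaction_lower)
      fix x y assume "x \<in> E \<inter> cube (c a) 2" "y \<in> cube (c a) 2 - E"
      then have "infnorm (x - c a) < 2" "infnorm (c a - y) < 2" by (auto simp: cube_def infnorm_sub)
      then show "infnorm (x - y) \<le> 4" using infnorm_triangle[of "x - c a" "c a - y"] by simp
    qed auto
    finally show ?thesis by (simp add: interaction_def F_def)
  qed
  have "ennreal (real m ^ CARD('n) * \<kappa>) = (\<Sum>a\<in>I. ennreal \<kappa>)"
    using I \<kappa> by (simp add: ennreal_mult' ennreal_of_nat_eq_real_of_nat)
  also have "\<dots> \<le> (\<Sum>a\<in>I. emeasure mu (F a))" by (intro sum_mono low)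
  also have "\<dots> = emeasure mu (\<Union>a\<in>I. F a)"
  proof (rule sum_emeasure)
    show "disjoint_family_on F I" using disj by (auto simp: disjoint_family_on_def F_def)
  qed (use I Fb in auto)
  also have "\<dots> \<le> Per (cube z (2 * real m)) E"
  proof -
    have "F a \<subseteq> cut (cube z (2 * real m)) E" if "a \<in> I" for a
      using sub[OF that] by (auto simp: F_def cut_def)
    then show ?thesis unfolding Per_def by (intro emeasure_mono) auto
  qed
  also have "\<dots> \<le> ennreal C" by (rule en)
  finally have "real m ^ CARD('n) * \<kappa> \<le> C" using \<kappa> m
    by (metis ennreal_le_iff2 linorder_not_le mult_pos_pos of_nat_0_less_iff zero_less_power)
  then show False using small by (simp add: \<kappa>_def)
qed

end

subsection \<open>Removing the obstacles\<close>

lemma unit_dir_short_step: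
  assumes "unit_dir (\<omega> :: real^'n)"
  obtains k where "k \<in> Zd" "0 < \<omega> \<bullet> k" "\<omega> \<bullet> k \<le> 1"
proof -
  obtain i where i: "\<omega> $ i \<noteq> 0" using assms by (auto simp: unit_dir_def vec_eq_iff)
  define k where "k = (if 0 < \<omega> $ i then axis i 1 else - axis i (1::real))"
  have "infnorm (axis i 1 :: real^'n) \<le> 1" by (auto simp: infnorm_le_iff_cart axis_def)
  then have "infnorm k \<le> 1" by (auto simp: k_def infnorm_neg)
  then have "\<omega> \<bullet> k \<le> 1" using unit_dir_le[OF assms, of k] by linarith
  moreover have "k \<in> Zd" by (auto simp: k_def Zd_def axis_def)
  moreover have "0 < \<omega> \<bullet> k" using i by (auto simp: k_def inner_axis)
  ultimately show thesis using that by blast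
qed

context kernel
begin

lemma Per_removal_le: 
  assumes [measurable]: "E \<in> sets borel"
  shows "Per (cube z r) (E - cube z r) \<le> interaction (cube z r) (- cube z r)"
proof -
  have b: "(- cube z r) \<times> cube z r \<in> sets borel" by (intro borel_Times borel_comp; simp)
  have "cut (cube z r) (E - cube z r) \<subseteq> (- cube z r) \<times> cube z r" by (auto simp: cut_def)
  then have "Per (cube z r) (E - cube z r) \<le> interaction (- cube z r) (cube z r)"
    unfolding Per_def interaction_def using b by (intro emeasure_mono) simp_all
  also have "\<dots> = interaction (cube z r) (- cube z r)" by (rule interaction_sym) auto
  finally show ?thesis .
qed

lemma Per_fill_le: 
  assumes [measurable]: "E \<in> sets borel"
  shows "Per (cube z r) (E \<union> cube z r) \<le> interaction (cube z r) (- cube z r)"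
proof -
  have b: "cube z r \<times> (- cube z r) \<in> sets borel" by (intro borel_Times borel_comp; simp)
  have "cut (cube z r) (E \<union> cube z r) \<subseteq> cube z r \<times> (- cube z r)" by (auto simp: cut_def)
  then show ?thesis
    unfolding Per_def interaction_def using b by (intro emeasure_mono) simp_all
qed

text \<open>A staircase reaches less than one unit above its level, so the cube misses the obstacle
  and removing it is admissible.\<close>

lemma obstacle_min_removal:
  assumes unit_dir: "unit_dir \<omega>" and E: "obstacle_min (staircase \<omega> a) U E" and far: "a + 1 \<le> \<omega> \<bullet> z - r"
  shows "Per (cube z r) E \<le> Per (cube z r) (E - cube z r)"
proof (rule obstacle_min_le[OF E])
  have disj: "staircase \<omega> a \<inter> cube z r = {}"
  proof (rule ccontr)
    assume "\<not> ?thesis"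
    then obtain x where x: "x \<in> staircase \<omega> a" "infnorm (x - z) < r" by (auto simp: cube_def)
    have "\<omega> \<bullet> x = \<omega> \<bullet> z + \<omega> \<bullet> (x - z)" by (simp add: inner_diff_right)
    then show False using unit_dir_ge[OF unit_dir, of "x - z"] staircase_upper[OF unit_dir x(1)] x(2) far by linarith
  qed
  show "staircase \<omega> a \<sqsubseteq> E - cube z r"
    using obstacle_min_lower[OF E] unfolding ae_subset_def by eventually_elim (use disj in auto)
  show "E - cube z r \<sqsubseteq> U"
    by (rule ae_subset_trans[OF ae_subset_subset obstacle_min_upper[OF E]]) auto
qed (use obstacle_min_borel[OF E] in \<open>auto simp: bounded_cube\<close>)

lemma locally_finite_cube: "locally_finite E \<Longrightarrow> Per (cube z r) E < \<infinity>"
  by (rule locally_finite_bounded) (auto simp: bounded_cube)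

lemma obstacle_min_clean_cube:
  assumes unit_dir: "unit_dir \<omega>" and E: "obstacle_min (staircase \<omega> a) U E" and birkhoff: "birkhoff \<omega> E" and far: "a + 3 \<le> \<omega> \<bullet> c"
    and small: "emeasure lborel (E \<inter> cube c 2) \<le> ennreal (density_threshold TYPE('n))"
  shows "E \<sqsubseteq> staircase \<omega> (\<omega> \<bullet> c + 2)"
proof (rule birkhoff_clean_cube[OF unit_dir birkhoff obstacle_min_borel[OF E]])
  show "emeasure lborel (E \<inter> cube c 1) = 0"
  proof (rule small_density_vanishes[OF obstacle_min_borel[OF E] locally_finite_cube[OF obstacle_min_locally_finite[OF E]] _ small])
    show "Per (cube c r) E \<le> Per (cube c r) (E - cube c r)" if "1 \<le> r" "r \<le> 2" for r
      using that far by (intro obstacle_min_removal[OF unit_dir E]) auto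
  qed
qed

text \<open>\<open>E\<close> is the least minimizer between its obstacles, and \<open>- E'\<close> lies above it. A cube almost
  contained in \<open>E\<close> is therefore almost disjoint from \<open>E'\<close>, so that the density lemma is needed only
  for removals.\<close>
lemma least_obstacle_min_dichotomy:
  assumes unit_dir: "unit_dir \<omega>" and m: "2 \<le> m"
    and large: "Lam * near_const (real CARD('n)) s * 4 ^ CARD('n) * (2 * real m) powr (real CARD('n) - s)
       < real m ^ CARD('n) * (lam * 4 powr - (real CARD('n) + s) * (density_threshold TYPE('n)) ^ 2)"
    and b: "b = 8 * real m + 10"
    and E: "least_obstacle_min (staircase \<omega> 0) (staircase \<omega> b) E"
    and E': "least_obstacle_min (staircase (- \<omega>) (- 2 - b)) (staircase (- \<omega>) (- 2)) E'"
  shows "E \<sqsubseteq> staircase \<omega> (b - 1) \<or> E' \<sqsubseteq> staircase (- \<omega>) (- 3)"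
proof -
  define R where "R = 2 * real m"
  have R: "4 \<le> R" "b = 4 * R + 10" using m b by (auto simp: R_def)
  note unit_dir' = unit_dir_uminus[OF unit_dir]
  note cE = least_obstacle_min_imp[OF E] and cE' = least_obstacle_min_imp[OF E']
  have [measurable]: "E \<in> sets borel" "E' \<in> sets borel" using cE cE' by (auto intro: obstacle_min_borel)
  have "\<omega> \<noteq> 0" using unit_dir by (simp add: unit_dir_def)
  \<comment> \<open>At this height all cubes around \<open>z\<close> of radius up to
    \<open>2 * R\<close> avoid the lower obstacle, as the energy bound at radius \<open>R\<close>
    requires.\<close>
  define z where "z = ((2 * R + 1) / (\<omega> \<bullet> \<omega>)) *\<^sub>R \<omega>"
  have z: "\<omega> \<bullet> z = 2 * R + 1" using \<open>\<omega> \<noteq> 0\<close> by (simp add: z_def)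
  \<comment> \<open>Each staircase overshoots its level by less than 1; the shift of the levels of
    \<open>E'\<close> by 2 therefore makes opposite staircases disjoint, and the obstacles of
    \<open>- E'\<close> contain those of \<open>E\<close>.\<close>
  have EE': "E \<sqsubseteq> - E'"
  proof (rule least_obstacle_min_ae_subset[OF E obstacle_min_Compl[OF cE']])
    have "staircase (- \<omega>) (- 2) \<subseteq> - staircase \<omega> 0"
      using staircase_upper[OF unit_dir] staircase_upper[OF unit_dir'] by fastforce
    then have "E' \<sqsubseteq> - staircase \<omega> 0" using obstacle_min_upper[OF cE'] ae_subset_subset by (blast intro: ae_subset_trans)
    then show "staircase \<omega> 0 \<sqsubseteq> - E'" using ae_subset_Compl_iff[of "- staircase \<omega> 0" E'] by simp
    have "staircase \<omega> b \<subseteq> - staircase (- \<omega>) (- 2 - b)"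
      using staircase_upper[OF unit_dir] staircase_upper[OF unit_dir'] by fastforce
    then show "E \<sqsubseteq> - staircase (- \<omega>) (- 2 - b)" using obstacle_min_upper[OF cE] ae_subset_subset by (blast intro: ae_subset_trans)
  qed
  have en: "Per (cube z R) E \<le> ennreal (Lam * near_const (real CARD('n)) s * 4 ^ CARD('n) * R powr (real CARD('n) - s))"
  proof (rule energy_bound)
    show "Per (cube z r) E \<le> interaction (cube z r) (- cube z r)" if "R \<le> r" "r \<le> 2 * R" for r
      using that z by (intro order_trans[OF obstacle_min_removal[OF unit_dir cE] Per_removal_le]) auto
  qed (use R in auto)
  have eps: "0 < density_threshold TYPE('n)" using kernel_const_pos lam by (intro recursion_threshold_pos) simp
  obtain c where c: "cube c 2 \<subseteq> cube z R"
    "emeasure lborel (E \<inter> cube c 2) \<le> ennreal (density_threshold TYPE('n)) \<or> emeasure lborel (cube c 2 - E) \<le> ennreal (density_threshold TYPE('n))"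
    using exists_cube_small_density[OF \<open>E \<in> sets borel\<close> _ en[unfolded R_def] eps large] m unfolding R_def by auto
  have "c \<in> cube c 2" by (simp add: cube_def infnorm_0)
  then have "c \<in> cube z R" using c(1) by blast
  then have "infnorm (c - z) < R" by (simp add: cube_def)
  moreover have "\<omega> \<bullet> c = \<omega> \<bullet> z + \<omega> \<bullet> (c - z)" by (simp add: inner_diff_right)
  ultimately have wc: "R + 1 \<le> \<omega> \<bullet> c" "\<omega> \<bullet> c \<le> 3 * R + 1"
    using unit_dir_le[OF unit_dir, of "c - z"] unit_dir_ge[OF unit_dir, of "c - z"] z by linarith+
  from c(2) show ?thesis
  proof
    assume "emeasure lborel (E \<inter> cube c 2) \<le> ennreal (density_threshold TYPE('n))"
    then have "E \<sqsubseteq> staircase \<omega> (\<omega> \<bullet> c + 2)"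
      using wc R by (intro obstacle_min_clean_cube[OF unit_dir cE least_obstacle_min_birkhoff[OF E]]) auto
    also have "staircase \<omega> (\<omega> \<bullet> c + 2) \<sqsubseteq> staircase \<omega> (b - 1)" using wc R by (intro ae_subset_subset staircase_mono) auto
    finally show ?thesis ..
  next
    assume small: "emeasure lborel (cube c 2 - E) \<le> ennreal (density_threshold TYPE('n))"
    have "E' \<inter> cube c 2 \<sqsubseteq> cube c 2 - E"
      using EE' unfolding ae_subset_def by eventually_elim auto
    then have "emeasure lborel (E' \<inter> cube c 2) \<le> emeasure lborel (cube c 2 - E)"
      by (intro ae_subset_emeasure_mono) auto
    also note small
    finally have "E' \<sqsubseteq> staircase (- \<omega>) (- \<omega> \<bullet> c + 2)"
      using wc R by (intro obstacle_min_clean_cube[OF unit_dir' cE' least_obstacle_min_birkhoff[OF E']]) auto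
    also have "staircase (- \<omega>) (- \<omega> \<bullet> c + 2) \<sqsubseteq> staircase (- \<omega>) (- 3)" using wc R by (intro ae_subset_subset staircase_mono) auto
    finally show ?thesis ..
  qed
qed

text \<open>A least minimizer that stays away from its upper obstacle does not feel it: when the obstacle
  is raised by \<open>t = \<omega> \<bullet> k\<close>, the new least minimizer lies below \<open>translate k E\<close>, hence still below the
  old obstacle.\<close>
lemma obstacle_min_remove_upper:
  assumes unit_dir: "unit_dir \<omega>" and ab: "a \<le> b" and E: "least_obstacle_min (staircase \<omega> a) (staircase \<omega> b) E" and room: "E \<sqsubseteq> staircase \<omega> (b - 1)"
  shows "obstacle_min (staircase \<omega> a) UNIV E"
proof -
  obtain k where k: "k \<in> Zd" "0 < \<omega> \<bullet> k" "\<omega> \<bullet> k \<le> 1" using unit_dir_short_step[OF unit_dir] .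
  define t where "t = \<omega> \<bullet> k"
  have Eb: "E \<sqsubseteq> staircase \<omega> b" by (rule ae_subset_trans[OF room ae_subset_subset[OF staircase_mono]]) simp
  \<comment> \<open>The obstacle is raised in steps of \<open>t\<close>, whose multiples exceed
    every level, while \<open>E\<close> stays the same.\<close>
  have main: "obstacle_min (staircase \<omega> a) (staircase \<omega> (b + real j * t)) E" for j :: nat
  proof (induction j)
    case 0
    then show ?case using least_obstacle_min_imp[OF E] by simp
  next
    case (Suc j)
    let ?b = "b + real j * t" and ?b' = "b + real (Suc j) * t"
    have bb: "b \<le> ?b" "?b + t = ?b'" "b \<le> ?b'" using k by (auto simp: t_def algebra_simps)
    obtain E' where E': "least_obstacle_min (staircase \<omega> a) (staircase \<omega> ?b') E'" using ab bb least_obstacle_min_staircase[of a ?b' \<omega>] by auto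
    have trE: "obstacle_min (staircase \<omega> (a + t)) (staircase \<omega> ?b') (translate k E)"
      using obstacle_min_translate[OF Suc k(1), unfolded translate_staircase[OF k(1)] translate_UNIV, folded t_def, unfolded bb(2)] .
    have "E' \<sqsubseteq> translate k E"
    proof (rule least_obstacle_min_ae_subset[OF E' trE])
      show "staircase \<omega> a \<sqsubseteq> translate k E"
        using k by (intro ae_subset_trans[OF ae_subset_subset[OF staircase_mono] obstacle_min_lower[OF trE]]) (simp add: t_def)
      show "E' \<sqsubseteq> staircase \<omega> ?b'" by (rule obstacle_min_upper[OF least_obstacle_min_imp[OF E']])
    qed
    also have "translate k E \<sqsubseteq> translate k (staircase \<omega> (b - 1))" using room by (simp add: ae_subset_translate_iff)
    \<comment> \<open>The free unit below \<open>b\<close> absorbs the translation because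
      \<open>t \<le> 1\<close>.\<close>
    also have "translate k (staircase \<omega> (b - 1)) \<sqsubseteq> staircase \<omega> ?b" using k bb by (simp add: translate_staircase) (intro ae_subset_subset staircase_mono, simp)
    finally have "E' \<sqsubseteq> staircase \<omega> ?b" .
    then have "E' \<sqsubseteq> E" by (intro least_obstacle_min_ae_subset[OF E' Suc obstacle_min_lower[OF Suc]])
    moreover have "E \<sqsubseteq> E'"
    proof (rule least_obstacle_min_ae_subset[OF E least_obstacle_min_imp[OF E'] obstacle_min_lower[OF least_obstacle_min_imp[OF E']]])
      show "E \<sqsubseteq> staircase \<omega> ?b'" using bb by (intro ae_subset_trans[OF Eb ae_subset_subset[OF staircase_mono]])
    qed
    ultimately show ?case
      using least_obstacle_min_imp[OF E'] obstacle_min_borel[OF least_obstacle_min_imp[OF E]] by (intro obstacle_min_cong[of _ _ E' E])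
  qed
  have "Per (cube 0 R) E \<le> Per (cube 0 R) F"
    if F: "F \<in> sets borel" "staircase \<omega> a \<sqsubseteq> F" "F - cube 0 R = E - cube 0 R" for R F
  proof -
    obtain j :: nat where j: "R + 1 - b < real j * t" using reals_Archimedean3[of t] k by (auto simp: t_def)
    \<comment> \<open>Once the raised obstacle contains the cube, it no longer restricts competitors
      there.\<close>
    have "cube 0 R \<subseteq> staircase \<omega> (b + real j * t)"
    proof
      fix x :: "real^'n" assume "x \<in> cube 0 R"
      then have "\<omega> \<bullet> x < R" using unit_dir_le[OF unit_dir, of x] by (simp add: cube_def)
      then show "x \<in> staircase \<omega> (b + real j * t)" using j by (intro staircase_lower[OF unit_dir]) auto
    qed
    then have "F \<sqsubseteq> staircase \<omega> (b + real j * t)"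
      using obstacle_min_upper[OF main[of j]] F(3) unfolding ae_subset_def by (auto elim!: eventually_mono)
    then show ?thesis using F by (intro obstacle_min_le[OF main[of j]]) (auto simp: bounded_cube)
  qed
  then show ?thesis using main[of 0] unfolding obstacle_min_def by auto
qed

end

text \<open>A Birkhoff set contains its translates with \<omega> \<bullet> k \<le> 0; here they must
  also fill it, locally in measure, as \<omega> \<bullet> k tends to 0. Monotonicity alone does not
  give this.\<close>

definition left_cont :: "real^'n \<Rightarrow> (real^'n) set \<Rightarrow> bool" where
  "left_cont \<omega> E \<longleftrightarrow> (\<forall>R. \<forall>\<epsilon>>0. \<exists>\<eta>>0. \<forall>k\<in>Zd. - \<eta> < \<omega> \<bullet> k \<longrightarrow> \<omega> \<bullet> k \<le> 0 \<longrightarrow>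
     emeasure lborel (E \<inter> cube 0 R - translate k E) < ennreal \<epsilon>)"

context kernel
begin

text \<open>If \<omega> \<bullet> k has no small negative values, only translations leaving
  \<open>E\<close> invariant are tested. Otherwise \<open>E'\<close> is the increasing union of
  translates of \<open>E\<close> whose heights increase to 0 from below; it inherits minimality from
  the limit lemma.\<close>

lemma left_continuous_version:
  assumes E: "obstacle_min (staircase \<omega> a) UNIV E" and birkhoff: "birkhoff \<omega> E" and Eb: "E \<sqsubseteq> staircase \<omega> b"
  obtains E' where "obstacle_min (staircase \<omega> a) UNIV E'" "birkhoff \<omega> E'" "E' \<sqsubseteq> staircase \<omega> b" "left_cont \<omega> E'"
proof (cases "\<exists>\<eta>>0. \<forall>k\<in>Zd. \<not> (- \<eta> < \<omega> \<bullet> k \<and> \<omega> \<bullet> k < 0)")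
  case True
  then obtain \<eta> where \<eta>: "0 < \<eta>" "\<And>k. k \<in> Zd \<Longrightarrow> - \<eta> < \<omega> \<bullet> k \<Longrightarrow> 0 \<le> \<omega> \<bullet> k" by force
  have [measurable]: "E \<in> sets borel" using E by (rule obstacle_min_borel)
  have "left_cont \<omega> E"
    unfolding left_cont_def
  proof (intro allI impI exI[of _ \<eta>] conjI ballI)
    fix R \<epsilon> :: real and k :: "real^'n"
    assume \<epsilon>: "0 < \<epsilon>" and k: "k \<in> Zd" "- \<eta> < \<omega> \<bullet> k"
    have "E \<sqsubseteq> translate k E" using birkhoffD_mono[OF birkhoff Zd_zero k(1)] \<eta>(2)[OF k] by simp
    then have "E \<inter> cube 0 R \<sqsubseteq> translate k E" by (rule ae_subset_trans[OF ae_subset_subset, rotated]) auto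
    then have "emeasure lborel (E \<inter> cube 0 R - translate k E) = 0" by (intro ae_subset_null) auto
    then show "emeasure lborel (E \<inter> cube 0 R - translate k E) < ennreal \<epsilon>" using \<epsilon> by simp
  qed (rule \<eta>(1))
  then show thesis using that E birkhoff Eb by blast
next
  case False
  then have small: "\<exists>k\<in>Zd. - \<eta> < \<omega> \<bullet> k \<and> \<omega> \<bullet> k < 0" if "0 < \<eta>" for \<eta> using that by blast
  have "\<exists>k. \<forall>n::nat. (k n \<in> Zd \<and> - 1 / real (Suc n) < \<omega> \<bullet> k n \<and> \<omega> \<bullet> k n < 0) \<and> \<omega> \<bullet> k n \<le> \<omega> \<bullet> k (Suc n)"
  proof (rule dependent_nat_choice)
    show "\<exists>k. k \<in> Zd \<and> - 1 / real (Suc 0) < \<omega> \<bullet> k \<and> \<omega> \<bullet> k < 0" using small[of 1] by auto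
    fix k n assume k: "k \<in> Zd \<and> - 1 / real (Suc n) < \<omega> \<bullet> k \<and> \<omega> \<bullet> k < 0"
    obtain k' where "k' \<in> Zd" "- min (1 / real (Suc (Suc n))) (- (\<omega> \<bullet> k)) < \<omega> \<bullet> k'" "\<omega> \<bullet> k' < 0"
      using small[of "min (1 / real (Suc (Suc n))) (- (\<omega> \<bullet> k))"] k by auto
    then show "\<exists>y. (y \<in> Zd \<and> - 1 / real (Suc (Suc n)) < \<omega> \<bullet> y \<and> \<omega> \<bullet> y < 0) \<and> \<omega> \<bullet> k \<le> \<omega> \<bullet> y"
      by (intro exI[of _ k']) auto
  qed
  then obtain k where k: "\<And>n::nat. k n \<in> Zd" "\<And>n. - 1 / real (Suc n) < \<omega> \<bullet> k n" "\<And>n. \<omega> \<bullet> k n < 0"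
    "\<And>n. \<omega> \<bullet> k n \<le> \<omega> \<bullet> k (Suc n)" by metis
  have close: "\<exists>n. x < \<omega> \<bullet> k n" if neg: "x < 0" for x
  proof -
    obtain n where "inverse (real (Suc n)) < - x" using reals_Archimedean[of "- x"] neg by auto
    then show ?thesis using k(2)[of n] by (intro exI[of _ n]) (simp add: inverse_eq_divide)
  qed
  have mono: "\<omega> \<bullet> k i \<le> \<omega> \<bullet> k j" if "i \<le> j" for i j
    using that by (induction rule: dec_induct) (auto intro: order_trans k(4))
  have [measurable]: "E \<in> sets borel" using E by (rule obstacle_min_borel)
  define E' where "E' = (\<Union>n. translate (k n) E)"
  have [measurable]: "E' \<in> sets borel" unfolding E'_def by measurable
  have sub: "translate (k n) E \<sqsubseteq> E'" for n unfolding E'_def by (rule ae_subset_subset) auto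
  have trE: "obstacle_min (staircase \<omega> (a + \<omega> \<bullet> k n)) UNIV (translate (k n) E)" for n
    using obstacle_min_translate[OF E k(1)[of n]] by (simp add: translate_staircase k(1))
  have "obstacle_min (staircase \<omega> a) UNIV E'"
    unfolding E'_def
  proof (rule obstacle_min_limit[OF locally_finite_staircase, where Lb = "\<lambda>n. staircase \<omega> (a + \<omega> \<bullet> k n)"])
    show "staircase \<omega> (a + \<omega> \<bullet> k n) \<sqsubseteq> translate (k n) E" for n by (rule obstacle_min_lower[OF trE])
    show "staircase \<omega> (a + \<omega> \<bullet> k n) \<sqsubseteq> staircase \<omega> a" for n
      using k(3)[of n] by (intro ae_subset_subset staircase_mono) simp
    show "translate (k n) E \<sqsubseteq> translate (k (Suc n)) E" for n by (intro birkhoffD_mono[OF birkhoff] k)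
    show "staircase \<omega> a \<sqsubseteq> (\<Union>n. translate (k n) E)"
    proof -
      \<comment> \<open>The strict inequality in \<open>staircase\<close> makes the obstacle the
        union of its lower translates, so the limit keeps the level \<open>a\<close>.\<close>
      have "staircase \<omega> a \<subseteq> (\<Union>n. staircase \<omega> (a + \<omega> \<bullet> k n))"
      proof
        fix x assume "x \<in> staircase \<omega> a"
        then obtain l where l: "l \<in> Zd" "\<omega> \<bullet> l < a" "x \<in> cube l 1" by (auto simp: staircase_def)
        obtain n where "\<omega> \<bullet> l - a < \<omega> \<bullet> k n" using close[of "\<omega> \<bullet> l - a"] l by auto
        then have "\<omega> \<bullet> l < a + \<omega> \<bullet> k n" by simp
        then show "x \<in> (\<Union>n. staircase \<omega> (a + \<omega> \<bullet> k n))" using l by (auto simp: staircase_def)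
      qed
      then have "staircase \<omega> a \<sqsubseteq> (\<Union>n. staircase \<omega> (a + \<omega> \<bullet> k n))" by (rule ae_subset_subset)
      also have "(\<Union>n. staircase \<omega> (a + \<omega> \<bullet> k n)) \<sqsubseteq> E'"
        using obstacle_min_lower[OF trE] sub by (intro ae_subset_UN) (blast intro: ae_subset_trans)
      finally show ?thesis by (simp add: E'_def)
    qed
    show "eventually (\<lambda>n. \<forall>F\<in>sets borel. staircase \<omega> (a + \<omega> \<bullet> k n) \<sqsubseteq> F \<longrightarrow> F \<sqsubseteq> UNIV \<longrightarrow> F - cube 0 R = translate (k n) E - cube 0 R
        \<longrightarrow> Per (cube 0 R) (translate (k n) E) \<le> Per (cube 0 R) F) sequentially" for R
      using trE unfolding obstacle_min_def by (intro always_eventually) blast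
  qed auto
  moreover have "birkhoff \<omega> E'"
    unfolding birkhoff_def
  proof safe
    fix l assume l: "l \<in> Zd" "\<omega> \<bullet> l \<le> 0"
    have "translate (l + k n) E \<sqsubseteq> E'" for n
      using l by (intro ae_subset_trans[OF birkhoffD_mono[OF birkhoff] sub[of n]]) (auto simp: Zd_add k inner_add_right)
    then show "translate l E' \<sqsubseteq> E'" unfolding E'_def translate_UN translate_translate by (intro ae_subset_UN) (simp add: E'_def)
  qed
  moreover have "E' \<sqsubseteq> staircase \<omega> b"
    unfolding E'_def using k(3)
    by (intro ae_subset_UN ae_subset_trans[OF birkhoffD[OF birkhoff] Eb]) (auto simp: k(1) less_imp_le)
  moreover have "left_cont \<omega> E'"
    unfolding left_cont_def
  proof (intro allI impI)
    fix R \<epsilon> :: real assume \<epsilon>: "0 < \<epsilon>"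
    define B where "B n = E' \<inter> cube 0 R - (\<Union>i\<le>n. translate (k i) E)" for n
    have [measurable]: "B n \<in> sets borel" for n unfolding B_def by measurable
    have "(\<lambda>n. emeasure lborel (B n)) \<longlonglongrightarrow> emeasure lborel (\<Inter>n. B n)"
    proof (rule Lim_emeasure_decseq)
      show "decseq B" by (fastforce simp: decseq_def B_def)
      show "emeasure lborel (B n) \<noteq> \<infinity>" for n
      proof -
        have "emeasure lborel (B n) \<le> emeasure lborel (cube (0::real^'n) R)" by (intro emeasure_mono) (auto simp: B_def)
        then show ?thesis using emeasure_cube_finite[of "0::real^'n" R] by (auto simp: top_unique)
      qed
    qed auto
    moreover have "(\<Inter>n. B n) = {}" by (auto simp: B_def E'_def)
    ultimately have "(\<lambda>n. emeasure lborel (B n)) \<longlonglongrightarrow> 0" by simp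
    then have "eventually (\<lambda>n. emeasure lborel (B n) < ennreal \<epsilon>) sequentially"
      using \<epsilon> by (intro order_tendstoD) auto
    then obtain n where n: "emeasure lborel (B n) < ennreal \<epsilon>" by (auto simp: eventually_sequentially)
    show "\<exists>\<eta>>0. \<forall>l\<in>Zd. - \<eta> < \<omega> \<bullet> l \<longrightarrow> \<omega> \<bullet> l \<le> 0 \<longrightarrow> emeasure lborel (E' \<inter> cube 0 R - translate l E') < ennreal \<epsilon>"
    proof (intro exI[of _ "- (\<omega> \<bullet> k n)"] conjI ballI impI)
      show "0 < - (\<omega> \<bullet> k n)" using k(3)[of n] by simp
      fix l assume l: "l \<in> Zd" "- (- (\<omega> \<bullet> k n)) < \<omega> \<bullet> l" "\<omega> \<bullet> l \<le> 0"
      \<comment> \<open>With this \<open>j\<close> the vector \<open>l + k j\<close> is higher than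
        \<open>k n\<close>, hence than all \<open>k i\<close> with \<open>i \<le> n\<close>, so
        \<open>translate l E'\<close> contains everything reached up to stage
        \<open>n\<close>.\<close>
      obtain j where j: "\<omega> \<bullet> k n - \<omega> \<bullet> l < \<omega> \<bullet> k j" using close[of "\<omega> \<bullet> k n - \<omega> \<bullet> l"] l by auto
      have "translate (k i) E \<sqsubseteq> translate l E'" if "i \<le> n" for i
      proof -
        have "translate (k i) E \<sqsubseteq> translate (l + k j) E"
          using mono[OF that] j l by (intro birkhoffD_mono[OF birkhoff]) (auto simp: Zd_add k inner_add_right)
        also have "translate (l + k j) E \<sqsubseteq> translate l E'"
          using sub[of j] by (simp add: translate_translate[symmetric] ae_subset_translate_iff)
        finally show ?thesis .
      qed
      then have "AE x in lborel. \<forall>i\<in>{..n}. x \<in> translate (k i) E \<longrightarrow> x \<in> translate l E'"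
        by (intro AE_finite_allI) (auto simp: ae_subset_def)
      then have "E' \<inter> cube 0 R - translate l E' \<sqsubseteq> B n"
        unfolding ae_subset_def by eventually_elim (auto simp: B_def)
      then have "emeasure lborel (E' \<inter> cube 0 R - translate l E') \<le> emeasure lborel (B n)"
        by (intro ae_subset_emeasure_mono) auto
      then show "emeasure lborel (E' \<inter> cube 0 R - translate l E') < ennreal \<epsilon>" using n by (rule le_less_trans)
    qed
  qed
  ultimately show thesis using that by blast
qed

text \<open>Let \<open>F\<close> be better than \<open>E\<close>. Without an upper obstacle
  \<open>E \<union> F\<close> is admissible and costs at least as much as \<open>E\<close>; by
  submodularity \<open>E \<inter> F\<close> is no worse than \<open>F\<close>. The gain thus comes
  from removing \<open>A = E - F\<close>.\<close>

lemma obstacle_min_not_free_gain: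
  assumes E: "obstacle_min L UNIV E" and not: "\<not> obstacle_min {} UNIV E"
  obtains R A \<delta> where "0 < R" "0 < \<delta>" "A \<in> sets borel" "A \<subseteq> E" "A \<subseteq> cube 0 R"
    "Per (cube 0 R) (E - A) + ennreal \<delta> \<le> Per (cube 0 R) E"
proof -
  have [measurable]: "E \<in> sets borel" using E by (rule obstacle_min_borel)
  obtain R F where F: "F \<in> sets borel" "F - cube 0 R = E - cube 0 R" "Per (cube 0 R) F < Per (cube 0 R) E"
    using not E unfolding obstacle_min_def by (auto simp: not_le)
  have [measurable]: "F \<in> sets borel" by (rule F)
  let ?Q = "cube (0::real^'n) R"
  have fin: "Per ?Q E < \<infinity>" using obstacle_min_locally_finite[OF E] by (simp add: locally_finite_def)
  have "Per ?Q E \<le> Per ?Q (E \<union> F)"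
  proof (rule obstacle_min_le[OF E])
    show "L \<sqsubseteq> E \<union> F" by (rule ae_subset_trans[OF obstacle_min_lower[OF E] ae_subset_subset]) auto
    show "E \<union> F - ?Q = E - ?Q" using F(2) by blast
  qed (auto simp: bounded_cube)
  then have "Per ?Q (E \<inter> F) + Per ?Q E \<le> Per ?Q (E \<inter> F) + Per ?Q (E \<union> F)" by (rule add_left_mono)
  also have "\<dots> \<le> Per ?Q E + Per ?Q F" by (rule Per_submod) auto
  finally have "Per ?Q (E \<inter> F) \<le> Per ?Q F"
    using fin by (auto simp: add.commute[of _ "Per ?Q E"] ennreal_add_left_cancel_le)
  then have less: "Per ?Q (E \<inter> F) < Per ?Q E" using F(3) by simp
  obtain x where x: "Per ?Q (E \<inter> F) = ennreal x" "0 \<le> x" using less by (cases "Per ?Q (E \<inter> F)") auto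
  obtain y where y: "Per ?Q E = ennreal y" "0 \<le> y" using fin by (cases "Per ?Q E") auto
  have xy: "x < y" using less x y by (simp add: ennreal_less_iff)
  have "?Q \<noteq> {}"
  proof
    assume "?Q = {}"
    then have "F = E" using F(2) by simp
    then show False using F(3) by simp
  qed
  then have R: "0 < R" using infnorm_pos_le by (auto simp: cube_def intro: le_less_trans)
  show thesis
  proof (rule that[of R "y - x" "E - F"])
    have "E - (E - F) = E \<inter> F" by auto
    then show "Per ?Q (E - (E - F)) + ennreal (y - x) \<le> Per ?Q E"
      using x y xy by (simp add: ennreal_plus[symmetric] del: ennreal_plus)
    show "E - F \<subseteq> ?Q" using F(2) by blast
  qed (use R xy in auto)
qed

text \<open>Semicontinuity made quantitative. If it failed for sets of volume below
  \<open>(1/2) ^ n\<close>, then by Borel-Cantelli almost every point would lie in only finitely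
  many of them, contradicting \<open>Per_lsc\<close>.\<close>

lemma Per_remove_small:
  assumes [measurable]: "E \<in> sets borel" and fin: "Per Q E < \<infinity>" and [measurable]: "Q \<in> sets borel" and \<delta>: "0 < \<delta>"
  obtains \<epsilon> where "0 < \<epsilon>" "\<And>A. A \<in> sets borel \<Longrightarrow> emeasure lborel A < ennreal \<epsilon> \<Longrightarrow> Per Q E \<le> Per Q (E - A) + ennreal \<delta>"
proof -
  have "\<exists>\<epsilon>>0. \<forall>A\<in>sets borel. emeasure lborel A < ennreal \<epsilon> \<longrightarrow> Per Q E \<le> Per Q (E - A) + ennreal \<delta>"
  proof (rule ccontr)
    assume no: "\<not> ?thesis"
    have "\<exists>A. A \<in> sets borel \<and> emeasure lborel A < ennreal \<epsilon> \<and> \<not> Per Q E \<le> Per Q (E - A) + ennreal \<delta>" if "0 < \<epsilon>" for \<epsilon>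
      using that no by blast
    then have "\<forall>n::nat. \<exists>A. A \<in> sets borel \<and> emeasure lborel A < ennreal ((1/2) ^ n) \<and> \<not> Per Q E \<le> Per Q (E - A) + ennreal \<delta>"
      by auto
    then obtain A where A: "\<And>n. A n \<in> sets borel" "\<And>n::nat. emeasure lborel (A n) < ennreal ((1/2) ^ n)"
      "\<And>n. Per Q (E - A n) + ennreal \<delta> < Per Q E"
      by (metis not_le)
    have [measurable]: "A n \<in> sets borel" for n by (rule A)
    have finA: "emeasure lborel (A n) < \<infinity>" for n using less_trans[OF A(2)[of n] ennreal_less_top] by simp
    have mA: "measure lborel (A n) \<le> (1/2) ^ n" for n
    proof -
      have "ennreal (measure lborel (A n)) = emeasure lborel (A n)"
        using finA[of n] by (intro emeasure_eq_ennreal_measure[symmetric]) auto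
      then have "ennreal (measure lborel (A n)) \<le> ennreal ((1/2) ^ n)" using A(2)[of n] by simp
      then show ?thesis by (subst (asm) ennreal_le_iff) auto
    qed
    have "AE x in lborel. eventually (\<lambda>n. x \<in> space lborel - A n) sequentially"
    proof (rule borel_cantelli_AE1)
      show "summable (\<lambda>n. measure lborel (A n))"
        by (rule summable_comparison_test'[where g = "\<lambda>n. (1/2) ^ n" and N = 0]) (use mA in \<open>auto intro: summable_geometric\<close>)
    qed (use finA in auto)
    then have "AE x in lborel. eventually (\<lambda>n. x \<in> E - A n \<longleftrightarrow> x \<in> E) sequentially"
      by (auto elim!: eventually_mono)
    then have "Per Q E \<le> liminf (\<lambda>n. Per Q (E - A n))" by (intro Per_lsc) auto
    obtain y where y: "Per Q E = ennreal y" "0 \<le> y" using fin by (cases "Per Q E") auto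
    have "Per Q (E - A n) \<le> ennreal (y - \<delta>) \<and> \<delta> < y" for n
    proof -
      have less: "Per Q (E - A n) + ennreal \<delta> < ennreal y" using A(3)[of n] y by simp
      then obtain x where x: "Per Q (E - A n) = ennreal x" "0 \<le> x" by (cases "Per Q (E - A n)") auto
      have "x + \<delta> < y" using less x \<delta> y by (simp add: ennreal_plus[symmetric] ennreal_less_iff del: ennreal_plus)
      then show ?thesis using x by (auto intro: ennreal_leI)
    qed
    then have le: "\<And>n. Per Q (E - A n) \<le> ennreal (y - \<delta>)" and y\<delta>: "\<delta> < y" by auto
    have "ennreal y \<le> liminf (\<lambda>n. Per Q (E - A n))" using \<open>Per Q E \<le> _\<close> y by simp
    also have "\<dots> \<le> liminf (\<lambda>n::nat. ennreal (y - \<delta>))" using le by (intro Liminf_mono always_eventually) auto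
    also have "\<dots> = ennreal (y - \<delta>)" by (simp add: Liminf_const)
    finally show False using \<delta> y\<delta> by (simp add: ennreal_le_iff)
  qed
  then show thesis using that by blast
qed

lemma Per_domain_diff:
  assumes [measurable]: "E \<in> sets borel" "\<Omega> \<in> sets borel" "\<Omega>' \<in> sets borel"
  shows "Per \<Omega> E \<le> Per \<Omega>' E + Per (\<Omega> - \<Omega>') E"
proof -
  have "cut \<Omega> E \<subseteq> cut \<Omega>' E \<union> cut (\<Omega> - \<Omega>') E" by (auto simp: cut_def)
  then have "Per \<Omega> E \<le> emeasure mu (cut \<Omega>' E \<union> cut (\<Omega> - \<Omega>') E)"
    unfolding Per_def by (intro emeasure_mono) auto
  also have "\<dots> \<le> Per \<Omega>' E + Per (\<Omega> - \<Omega>') E"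
    unfolding Per_def by (intro emeasure_subadditive) auto
  finally show ?thesis .
qed

text \<open>Submodularity turns the gain at one place into a gain at every almost-period: a translate
  \<open>translate l E\<close> lies above \<open>G\<close>, so removing \<open>translate l A\<close> from \<open>G\<close> gains at least as much as removing it
  from \<open>translate l E\<close>, up to the small part of \<open>translate l A\<close> not covered by \<open>G\<close>.\<close>
lemma Per_remove_translate:
  assumes [measurable]: "E \<in> sets borel" "A \<in> sets borel" "G \<in> sets borel" "Q \<in> sets borel" and \<delta>: "0 < \<delta>"
    and AR: "A \<subseteq> cube 0 R"
    and gain: "Per (cube 0 R) (E - A) + ennreal \<delta> \<le> Per (cube 0 R) E"
    and small: "\<And>A'. A' \<in> sets borel \<Longrightarrow> emeasure lborel A' < ennreal \<epsilon> \<Longrightarrow> Per (cube 0 R) E \<le> Per (cube 0 R) (E - A') + ennreal (\<delta>/2)"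
    and l: "l \<in> Zd" and GE: "G \<sqsubseteq> translate l E" and fit: "cube l R \<subseteq> Q"
    and rest: "emeasure lborel (translate l A - G) < ennreal \<epsilon>"
    and finG: "Per Q G < \<infinity>" and finE: "Per Q (translate l E) < \<infinity>"
  shows "Per Q (G - translate l A) + ennreal (\<delta>/2) \<le> Per Q G"
proof -
  let ?Y = "translate l E - translate l A" and ?A' = "translate l A - G"
  have trQ: "translate l (cube 0 R) = cube l R" by (simp add: translate_cube)
  have AQ: "translate l A \<subseteq> cube l R" using translate_mono[OF AR, of l] by (simp add: trQ)
  have 1: "Per Q ?Y + ennreal \<delta> \<le> Per Q (translate l E)"
  proof -
    have g: "Per (cube l R) ?Y + ennreal \<delta> \<le> Per (cube l R) (translate l E)"
      using gain Per_translate[of "E - A" "cube 0 R" l] Per_translate[of E "cube 0 R" l] l by (simp add: trQ translate_Diff)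
    obtain d where d: "Per Q ?Y = Per (cube l R) ?Y + d" "Per Q (translate l E) = Per (cube l R) (translate l E) + d"
      using AQ by (rule_tac Per_enlarge[of ?Y "translate l E" "cube l R" Q]) (use fit in auto)
    have "(Per (cube l R) ?Y + ennreal \<delta>) + d \<le> Per (cube l R) (translate l E) + d" using g by (rule add_right_mono)
    then show ?thesis unfolding d by (simp add: ac_simps)
  qed
  \<comment> \<open>\<open>?A'\<close> is the part of the translated piece that \<open>G\<close>
    does not contain; its volume is below \<epsilon>, so removing it lowers the energy of the
    translate by at most \<open>\<delta>/2\<close>.\<close>
  have 2: "Per Q (translate l E) \<le> Per Q (translate l E - ?A') + ennreal (\<delta>/2)"
  proof (rule Per_le_enlarge[where \<Omega> = "cube l R"])
    let ?B = "translate (- l) ?A'"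
    have B: "?A' = translate l ?B" by (simp add: translate_translate)
    have "Per (cube 0 R) E \<le> Per (cube 0 R) (E - ?B) + ennreal (\<delta>/2)"
      using rest by (intro small) (auto simp: emeasure_translate)
    then show "Per (cube l R) (translate l E) \<le> Per (cube l R) (translate l E - ?A') + ennreal (\<delta>/2)"
      using Per_translate[of "E - ?B" "cube 0 R" l] Per_translate[of E "cube 0 R" l] l
      by (subst B) (simp add: trQ translate_Diff)
  qed (use fit AQ in auto)
  have XY: "Per Q (G \<inter> ?Y) = Per Q (G - translate l A)"
  proof (rule Per_cong)
    show "G - translate l A \<sqsubseteq> G \<inter> ?Y" using GE unfolding ae_subset_def by eventually_elim auto
  qed (auto intro: ae_subset_subset)
  \<comment> \<open>Since \<open>G\<close> lies below \<open>translate l E\<close>, its union with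
    \<open>?Y\<close> misses only the uncovered part \<open>?A'\<close>.\<close>
  have XUY: "Per Q (G \<union> ?Y) = Per Q (translate l E - ?A')"
  proof (rule Per_cong)
    show "G \<union> ?Y \<sqsubseteq> translate l E - ?A'" using GE unfolding ae_subset_def by eventually_elim auto
    show "translate l E - ?A' \<sqsubseteq> G \<union> ?Y" by (rule ae_subset_subset) auto
  qed auto
  let ?p = "Per Q (translate l E - ?A')"
  have sub: "Per Q (G - translate l A) + ?p \<le> Per Q G + Per Q ?Y"
    using Per_submod[of G ?Y Q] by (simp add: XY XUY)
  have finY: "Per Q ?Y < \<infinity>" using 1 finE by (auto simp: less_top[symmetric] top_unique)
  have finp: "?p < \<infinity>"
  proof -
    have "?p \<le> Per Q G + Per Q ?Y" using sub by (rule order_trans[rotated]) simp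
    also have "\<dots> < \<infinity>" using finG finY by simp
    finally show ?thesis .
  qed
  have half: "ennreal \<delta> = ennreal (\<delta>/2) + ennreal (\<delta>/2)" using \<delta> by (subst ennreal_plus[symmetric]) auto
  have "(Per Q (G - translate l A) + ?p) + ennreal \<delta> \<le> (Per Q G + Per Q ?Y) + ennreal \<delta>" using sub by (rule add_right_mono)
  also have "\<dots> = Per Q G + (Per Q ?Y + ennreal \<delta>)" by (simp add: ac_simps)
  also have "\<dots> \<le> Per Q G + (?p + ennreal (\<delta>/2))" using 1 2 by (intro add_left_mono) (rule order_trans)
  finally have "(?p + ennreal (\<delta>/2)) + (Per Q (G - translate l A) + ennreal (\<delta>/2)) \<le> (?p + ennreal (\<delta>/2)) + Per Q G"
    unfolding half by (simp add: ac_simps)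
  moreover have "?p + ennreal (\<delta>/2) < \<infinity>" using finp by simp
  ultimately show ?thesis by (auto simp: ennreal_add_left_cancel_le)
qed

text \<open>Inside the cube \<open>E\<close> is lifted to \<open>translate k0 E\<close>, and the
  copies of \<open>A\<close> at all \<open>k + k0\<close> are removed from the lifted set. The lift
  leaves room above the obstacle, so the result is admissible, and each removal gains at least half
  of \<delta>. Minimality bounds the total gain by the cost of the lift: the shift of the domain and
  the mismatch across the boundary of the cube.\<close>

lemma removal_cost:
  assumes unit_dir: "unit_dir \<omega>" and E: "obstacle_min (staircase \<omega> a) UNIV E" and birkhoff: "birkhoff \<omega> E"
    and A[measurable]: "A \<in> sets borel" and AE: "A \<subseteq> E" and AR: "A \<subseteq> cube 0 R" and \<delta>: "0 < \<delta>"
    and gain: "Per (cube 0 R) (E - A) + ennreal \<delta> \<le> Per (cube 0 R) E"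
    and small: "\<And>A'. A' \<in> sets borel \<Longrightarrow> emeasure lborel A' < ennreal \<epsilon> \<Longrightarrow> Per (cube 0 R) E \<le> Per (cube 0 R) (E - A') + ennreal (\<delta>/2)"
    and left_cont: "\<And>k. k \<in> Zd \<Longrightarrow> - \<eta> < \<omega> \<bullet> k \<Longrightarrow> \<omega> \<bullet> k \<le> 0 \<Longrightarrow> emeasure lborel (E \<inter> cube 0 R - translate k E) < ennreal \<epsilon>"
    and S: "finite S" "\<And>k. k \<in> S \<Longrightarrow> k \<in> Zd \<and> 0 \<le> \<omega> \<bullet> k \<and> \<omega> \<bullet> k < \<eta>"
    and sep: "\<And>k l. k \<in> S \<Longrightarrow> l \<in> S \<Longrightarrow> k \<noteq> l \<Longrightarrow> cube k R \<inter> cube l R = {}"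
    and k0: "k0 \<in> Zd" "a + 1 + R \<le> \<omega> \<bullet> k0" "0 \<le> \<omega> \<bullet> k0"
    and fit: "\<And>k. k \<in> S \<Longrightarrow> cube (k + k0) R \<subseteq> cube 0 n"
  shows "ennreal (real (card S) * (\<delta>/2)) \<le> Per (cube (- k0) n - cube 0 n) E + interaction (cube 0 n) (translate k0 E - E - cube 0 n)"
proof -
  let ?Q = "cube (0::real^'n) n" and ?D = "translate k0 E"
  let ?B = "?D - E - ?Q"
  have [measurable]: "E \<in> sets borel" using E by (rule obstacle_min_borel)
  have lfE: "locally_finite E" using E by (rule obstacle_min_locally_finite)
  have ED: "E \<sqsubseteq> ?D" using birkhoffD_mono[OF birkhoff Zd_zero k0(1)] k0(3) by simp
  define V where "V = ?D \<inter> ?Q \<union> (E - ?Q)"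
  have [measurable]: "V \<in> sets borel" by (simp add: V_def)
  have VD: "V \<sqsubseteq> ?D" using ED unfolding ae_subset_def V_def by eventually_elim auto
  have EV: "E \<sqsubseteq> V" using ED unfolding ae_subset_def V_def by eventually_elim auto
  have lfD: "locally_finite ?D" by (rule locally_finite_translate[OF lfE k0(1)])
  have finV: "Per ?Q V < \<infinity>"
  proof -
    have "Per ?Q V \<le> Per ?Q ?D + (interaction ?Q (- ?Q) + interaction ?Q (- ?Q))" unfolding V_def by (rule Per_patch) auto
    also have "\<dots> < \<infinity>" using locally_finite_cube[OF lfD] interaction_cube_finite[of 0 n] by simp
    finally show ?thesis .
  qed
  define G where "G T = V - (\<Union>k\<in>T. translate (k + k0) A)" for T
  have AQ: "translate (k + k0) A \<subseteq> cube (k + k0) R" for k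
    using translate_mono[OF AR, of "k + k0"] by (simp add: translate_cube)
  have G_b[measurable]: "G T \<in> sets borel" if "finite T" for T
    unfolding G_def using that by (intro sets.Diff sets.finite_UN) auto
  have main: "Per ?Q (G T) + ennreal (real (card T) * (\<delta>/2)) \<le> Per ?Q V" if "finite T" "T \<subseteq> S" for T
    using that
  proof (induction T)
    case empty
    then show ?case by (simp add: G_def)
  next
    case (insert k T)
    have k: "k \<in> S" "k \<in> Zd" "0 \<le> \<omega> \<bullet> k" "\<omega> \<bullet> k < \<eta>" using insert S by auto
    have [measurable]: "G T \<in> sets borel" using insert by (intro G_b)
    have eq: "G (insert k T) = G T - translate (k + k0) A" by (auto simp: G_def)
    have GT: "Per ?Q (G T) \<le> Per ?Q V"
      using insert by (intro order_trans[OF _ insert.IH]) auto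
    have disj: "translate (k + k0) A \<inter> translate (j + k0) A = {}" if "j \<in> T" for j
    proof -
      have "cube k R \<inter> cube j R = {}" using insert k that by (intro sep) auto
      then have "translate k A \<inter> translate j A = {}" using translate_mono[OF AR, of k] translate_mono[OF AR, of j] by (auto simp: translate_cube)
      then have "translate k0 (translate k A \<inter> translate j A) = {}" by (auto simp: translate_def)
      then show ?thesis by (simp add: translate_Int translate_translate add.commute)
    qed
    \<comment> \<open>Copies removed earlier are disjoint from the present one, so what
      \<open>G T\<close> lacks of it is a translate of \<open>translate k A - E\<close>, whose
      volume is small by left continuity at \<open>- k\<close>.\<close>
    have rest_eq: "translate (k + k0) A - G T = translate k0 (translate k A - E)"
    proof -
      have "translate (k + k0) A - G T = translate (k + k0) A - V" using disj by (auto simp: G_def)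
      also have "\<dots> = translate (k + k0) A - ?D" using AQ[of k] fit[OF k(1)] by (auto simp: V_def)
      also have "\<dots> = translate k0 (translate k A - E)" by (simp add: translate_Diff translate_translate add.commute)
      finally show ?thesis .
    qed
    have "Per ?Q (G T - translate (k + k0) A) + ennreal (\<delta>/2) \<le> Per ?Q (G T)"
    proof (rule Per_remove_translate[OF _ A _ _ \<delta> AR gain small, where \<epsilon> = \<epsilon>])
      show "k + k0 \<in> Zd" using k k0 by (simp add: Zd_add)
      have "G T \<sqsubseteq> ?D" using VD by (intro ae_subset_trans[OF ae_subset_subset VD]) (auto simp: G_def)
      also have "?D \<sqsubseteq> translate (k + k0) E"
        using k k0 by (intro birkhoffD_mono[OF birkhoff]) (auto simp: Zd_add inner_add_right)
      finally show "G T \<sqsubseteq> translate (k + k0) E" .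
      show "cube (k + k0) R \<subseteq> ?Q" by (rule fit[OF k(1)])
      have "emeasure lborel (translate (k + k0) A - G T) = emeasure lborel (translate k A - E)"
        unfolding rest_eq by (rule emeasure_translate) simp
      also have "translate k A - E = translate k (A - translate (- k) E)" by (simp add: translate_Diff translate_translate)
      also have "emeasure lborel (translate k (A - translate (- k) E)) = emeasure lborel (A - translate (- k) E)"
        by (rule emeasure_translate) simp
      also have "\<dots> \<le> emeasure lborel (E \<inter> cube 0 R - translate (- k) E)"
        using AE AR by (intro emeasure_mono) auto
      also have "\<dots> < ennreal \<epsilon>" using k by (intro left_cont) (auto simp: Zd_uminus)
      finally show "emeasure lborel (translate (k + k0) A - G T) < ennreal \<epsilon>" .
      show "Per ?Q (G T) < \<infinity>" using GT finV by (rule le_less_trans)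
      show "Per ?Q (translate (k + k0) E) < \<infinity>" using k k0 by (intro locally_finite_cube locally_finite_translate[OF lfE]) (simp add: Zd_add)
    qed auto
    then have "Per ?Q (G (insert k T)) + ennreal (\<delta>/2) + ennreal (real (card T) * (\<delta>/2))
        \<le> Per ?Q (G T) + ennreal (real (card T) * (\<delta>/2))"
      unfolding eq by (rule add_right_mono)
    also have "\<dots> \<le> Per ?Q V" using insert by (intro insert.IH) auto
    finally have "Per ?Q (G (insert k T)) + (ennreal (\<delta>/2) + ennreal (real (card T) * (\<delta>/2))) \<le> Per ?Q V"
      by (simp add: ac_simps)
    also have "ennreal (\<delta>/2) + ennreal (real (card T) * (\<delta>/2)) = ennreal (real (card (insert k T)) * (\<delta>/2))"
    proof -
      have "real (card (insert k T)) * (\<delta>/2) = \<delta>/2 + real (card T) * (\<delta>/2)"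
        using insert by (simp add: algebra_simps add_divide_distrib)
      then show ?thesis using \<delta> by (simp only:) (rule ennreal_plus[symmetric], auto)
    qed
    finally show ?case .
  qed
  have GS[measurable]: "G S \<in> sets borel" using S(1) by (rule G_b)
  have comp: "Per ?Q E \<le> Per ?Q (G S)"
  proof (rule obstacle_min_le[OF E])
    \<comment> \<open>The height of \<open>k0\<close> exceeds the level \<open>a\<close> by the
      overshoot 1 of the obstacle and the radius \<open>R\<close> of \<open>A\<close>.\<close>
    have far: "x \<notin> staircase \<omega> a" if x: "x \<in> translate (k + k0) A" "k \<in> S" for x k
    proof
      assume "x \<in> staircase \<omega> a"
      then have "\<omega> \<bullet> x < a + 1" by (rule staircase_upper[OF unit_dir])
      moreover have "infnorm (x - (k + k0)) < R" using AQ[of k] x by (auto simp: cube_def)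
      moreover have "\<omega> \<bullet> x = \<omega> \<bullet> k + \<omega> \<bullet> k0 + \<omega> \<bullet> (x - (k + k0))" by (simp add: inner_diff_right inner_add_right)
      ultimately show False using unit_dir_ge[OF unit_dir, of "x - (k + k0)"] k0 S(2)[OF x(2)] by linarith
    qed
    have "staircase \<omega> a \<sqsubseteq> V" using obstacle_min_lower[OF E] EV by (rule ae_subset_trans)
    then show "staircase \<omega> a \<sqsubseteq> G S"
      unfolding ae_subset_def by eventually_elim (use far in \<open>auto simp: G_def\<close>)
    have "G S - ?Q = V - ?Q" using AQ fit by (fastforce simp: G_def)
    then show "G S - ?Q = E - ?Q" by (auto simp: V_def)
  qed (auto simp: bounded_cube)
  have PV: "Per ?Q V \<le> Per ?Q ?D + interaction ?Q ?B"
  proof -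
    have b: "?Q \<times> ?B \<in> sets borel" by (intro borel_Times) auto
    have "Per ?Q V \<le> emeasure mu (cut ?Q ?D \<union> ?Q \<times> ?B)"
      unfolding Per_def
    proof (rule emeasure_mono_AE)
      show "AE p in mu. p \<in> cut ?Q V \<longrightarrow> p \<in> cut ?Q ?D \<union> ?Q \<times> ?B"
        using AE_mu_pair[OF VD[unfolded ae_subset_def]]
        by (rule eventually_mono) (auto simp: cut_def V_def)
    qed (use b in \<open>auto intro!: sets.Un\<close>)
    also have "\<dots> \<le> Per ?Q ?D + interaction ?Q ?B"
      unfolding Per_def interaction_def using b by (intro emeasure_subadditive) auto
    finally show ?thesis .
  qed
  \<comment> \<open>Translating back by \<open>k0\<close> turns the energy of the lifted set in the
    cube into that of \<open>E\<close> in a shifted cube.\<close>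
  have PD: "Per ?Q ?D \<le> Per ?Q E + Per (cube (- k0) n - ?Q) E"
  proof -
    have "Per ?Q ?D = Per (cube (- k0) n) E"
      using Per_translate[of E "cube (- k0) n" k0] k0 by (simp add: translate_cube)
    also have "\<dots> \<le> Per ?Q E + Per (cube (- k0) n - ?Q) E" by (rule Per_domain_diff) auto
    finally show ?thesis .
  qed
  have "Per ?Q E + ennreal (real (card S) * (\<delta>/2)) \<le> Per ?Q (G S) + ennreal (real (card S) * (\<delta>/2))"
    using comp by (rule add_right_mono)
  also have "\<dots> \<le> Per ?Q V" using S(1) by (intro main) auto
  also note PV
  also have "Per ?Q ?D + interaction ?Q ?B \<le> (Per ?Q E + Per (cube (- k0) n - ?Q) E) + interaction ?Q ?B"
    using PD by (rule add_right_mono)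
  finally have "Per ?Q E + ennreal (real (card S) * (\<delta>/2)) \<le> Per ?Q E + (Per (cube (- k0) n - ?Q) E + interaction ?Q ?B)"
    by (simp add: ac_simps)
  moreover have "Per ?Q E < \<infinity>" by (rule locally_finite_cube[OF lfE])
  ultimately show ?thesis by (auto simp: ennreal_add_left_cancel_le)
qed

end

text \<open>Pigeonhole. The coordinates other than \<open>i0\<close> run through a grid of spacing
  \<rho>, and the coordinate \<open>i0\<close> brings the height \<omega> \<bullet> k into
  \<open>[0, 1)\<close>. At least a fraction \<open>1 / J\<close> of these
  \<open>m ^ (d - 1)\<close> vectors have heights in a common interval of length
  \<open>1 / J\<close>; their differences with the lowest of them are the almost-periods.\<close>

lemma almost_periods:
  fixes \<omega> :: "real^'n" and \<rho> :: nat
  assumes unit_dir: "unit_dir \<omega>" and \<rho>: "0 < \<rho>" and \<eta>: "0 < \<eta>"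
  obtains C c where "0 < C" "0 < c"
    "\<forall>m::nat. 1 \<le> m \<longrightarrow> (\<exists>S. finite S \<and> (\<forall>k\<in>S. k \<in> Zd \<and> 0 \<le> \<omega> \<bullet> k \<and> \<omega> \<bullet> k < \<eta> \<and> infnorm k \<le> C * real m)
       \<and> (\<forall>k\<in>S. \<forall>l\<in>S. k \<noteq> l \<longrightarrow> real \<rho> \<le> infnorm (k - l)) \<and> c * real m ^ (CARD('n) - 1) \<le> real (card S))"
proof -
  obtain i0 where i0: "\<omega> $ i0 \<noteq> 0" using unit_dir by (auto simp: unit_dir_def vec_eq_iff)
  define w where "w = \<bar>\<omega> $ i0\<bar>"
  have \<omega>1: "\<bar>\<omega> $ i\<bar> \<le> 1" for i
  proof -
    have "infnorm (axis i 1 :: real^'n) \<le> 1" by (auto simp: infnorm_le_iff_cart axis_def)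
    moreover have "\<bar>\<omega> \<bullet> axis i 1\<bar> \<le> infnorm (axis i 1 :: real^'n)" using unit_dir unfolding unit_dir_def by blast
    ultimately show ?thesis by (simp add: inner_axis)
  qed
  have w: "0 < w" "w \<le> 1" using i0 \<omega>1[of i0] by (auto simp: w_def)
  define J where "J = nat \<lceil>1 / \<eta>\<rceil>"
  have J: "0 < J" "1 / real J \<le> \<eta>"
  proof -
    have "1 / \<eta> \<le> real J" unfolding J_def by linarith
    moreover have "0 < 1 / \<eta>" using \<eta> by simp
    ultimately have "0 < real J" by linarith
    then show "0 < J" by simp
    then show "1 / real J \<le> \<eta>" using \<open>1 / \<eta> \<le> real J\<close> \<eta> by (simp add: field_simps)
  qed
  define T where "T a = (\<Sum>j\<in>UNIV - {i0}. \<omega> $ j * (real \<rho> * real (a j)))" for a :: "'n \<Rightarrow> nat"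
  \<comment> \<open>The least integer that makes the height nonnegative; one unit of it changes the
    height by \<open>w \<le> 1\<close>.\<close>
  define h where "h a = \<lceil>- T a / w\<rceil>" for a
  define k where "k a = (\<chi> i. if i = i0 then sgn (\<omega> $ i0) * of_int (h a) else real \<rho> * real (a i))" for a
  have k_Zd: "k a \<in> Zd" for a
    by (auto simp: k_def Zd_def sgn_real_def)
  have \<omega>k: "\<omega> \<bullet> k a = T a + w * of_int (h a)" for a
  proof -
    have "\<omega> \<bullet> k a = \<omega> $ i0 * k a $ i0 + (\<Sum>j\<in>UNIV - {i0}. \<omega> $ j * k a $ j)"
      by (simp add: inner_vec_def sum.remove[of UNIV i0])
    also have "(\<Sum>j\<in>UNIV - {i0}. \<omega> $ j * k a $ j) = T a" unfolding T_def by (intro sum.cong) (auto simp: k_def)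
    also have "\<omega> $ i0 * k a $ i0 = w * of_int (h a)" by (simp add: k_def w_def abs_sgn)
    finally show ?thesis by simp
  qed
  have range: "0 \<le> \<omega> \<bullet> k a" "\<omega> \<bullet> k a < 1" for a
  proof -
    have "- T a / w \<le> of_int (h a)" "of_int (h a) < - T a / w + 1" unfolding h_def by linarith+
    then have "- T a \<le> w * of_int (h a)" "w * of_int (h a) < - T a + w" using w by (auto simp: field_simps)
    then show "0 \<le> \<omega> \<bullet> k a" "\<omega> \<bullet> k a < 1" using w by (auto simp: \<omega>k)
  qed
  \<comment> \<open>The first summand bounds the grid coordinates. The second bounds the coordinate
    \<open>i0\<close>, whose variation is read off from the heights and divided by
    \<open>w\<close>.\<close>
  define C where "C = real \<rho> + (1 + real CARD('n) * real \<rho>) / w"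
  have C: "0 < C" using \<rho> w by (auto simp: C_def intro!: add_pos_pos divide_pos_pos add_pos_nonneg)
  have "\<forall>m::nat. 1 \<le> m \<longrightarrow> (\<exists>S. finite S \<and> (\<forall>k\<in>S. k \<in> Zd \<and> 0 \<le> \<omega> \<bullet> k \<and> \<omega> \<bullet> k < \<eta> \<and> infnorm k \<le> C * real m)
       \<and> (\<forall>k\<in>S. \<forall>l\<in>S. k \<noteq> l \<longrightarrow> real \<rho> \<le> infnorm (k - l)) \<and> 1 / real J * real m ^ (CARD('n) - 1) \<le> real (card S))"
  proof (intro allI impI)
    fix m :: nat assume m: "1 \<le> m"
    define I where "I = PiE (UNIV - {i0}) (\<lambda>_. {..<m})"
    have I: "finite I" "card I = m ^ (CARD('n) - 1)"
      unfolding I_def by (auto intro!: finite_PiE simp: card_PiE card_Diff_singleton)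
    define bin where "bin a = nat \<lfloor>\<omega> \<bullet> k a * real J\<rfloor>" for a
    have bin: "bin a < J" for a
    proof -
      have "\<omega> \<bullet> k a * real J < 1 * real J" using range[of a] J by (intro mult_strict_right_mono) auto
      then have "\<lfloor>\<omega> \<bullet> k a * real J\<rfloor> < int J" by linarith
      then show ?thesis using J by (simp add: bin_def)
    qed
    have "\<exists>b<J. card I \<le> J * card {a\<in>I. bin a = b}"
    proof (rule ccontr)
      assume "\<not> ?thesis"
      then have lt: "J * card {a\<in>I. bin a = b} < card I" if "b < J" for b using that by (auto simp: not_le)
      have "(\<Sum>b\<in>{..<J}. \<Sum>a | a \<in> I \<and> bin a = b. 1) = (\<Sum>a\<in>I. 1::nat)"
        using I bin by (intro sum.group) auto
      then have "(\<Sum>b<J. card {a\<in>I. bin a = b}) = card I" by simp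
      then have "J * card I = (\<Sum>b<J. J * card {a\<in>I. bin a = b})" by (simp add: sum_distrib_left[symmetric])
      also have "\<dots> < (\<Sum>b<J. card I)" using lt J by (intro sum_strict_mono) auto
      finally show False by simp
    qed
    then obtain b where b: "b < J" "card I \<le> J * card {a\<in>I. bin a = b}" by blast
    define F where "F = {a\<in>I. bin a = b}"
    have F: "finite F" using I by (simp add: F_def)
    have "0 < card I" using I m by simp
    then have "0 < card F" using b by (auto simp: F_def intro!: gr0I)
    then have "F \<noteq> {}" by auto
    have "\<exists>a0\<in>F. \<forall>a\<in>F. \<omega> \<bullet> k a0 \<le> \<omega> \<bullet> k a"
    proof (rule bexI[of _ "arg_min_on (\<lambda>a. \<omega> \<bullet> k a) F"])
      show "\<forall>a\<in>F. \<omega> \<bullet> k (arg_min_on (\<lambda>a. \<omega> \<bullet> k a) F) \<le> \<omega> \<bullet> k a"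
        by (intro ballI arg_min_least[OF F \<open>F \<noteq> {}\<close>])
      show "arg_min_on (\<lambda>a. \<omega> \<bullet> k a) F \<in> F" by (rule arg_min_if_finite(1)[OF F \<open>F \<noteq> {}\<close>])
    qed
    then obtain a0 where a0: "a0 \<in> F" "\<And>a. a \<in> F \<Longrightarrow> \<omega> \<bullet> k a0 \<le> \<omega> \<bullet> k a" by blast
    define S where "S = (\<lambda>a. k a - k a0) ` F"
    have apart: "real \<rho> \<le> infnorm (k a - k a')" if aa: "a \<in> I" "a' \<in> I" "a \<noteq> a'" for a a'
    proof -
      obtain j where j: "j \<noteq> i0" "a j \<noteq> a' j"
        using aa PiE_ext[of a "UNIV - {i0}" "\<lambda>_. {..<m}" a'] by (auto simp: I_def)
      have "1 \<le> \<bar>real (a j) - real (a' j)\<bar>" using j by linarith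
      then have "real \<rho> \<le> \<bar>real \<rho> * (real (a j) - real (a' j))\<bar>"
        using mult_left_mono[of 1 "\<bar>real (a j) - real (a' j)\<bar>" "real \<rho>"] by (simp add: abs_mult)
      also have "\<dots> = \<bar>(k a - k a') $ j\<bar>" using j by (simp add: k_def right_diff_distrib)
      also have "\<dots> \<le> infnorm (k a - k a')" by (rule component_le_infnorm_cart)
      finally show ?thesis .
    qed
    have inj: "inj_on (\<lambda>a. k a - k a0) F"
    proof (rule inj_onI, rule ccontr)
      fix a a' assume a: "a \<in> F" "a' \<in> F" "k a - k a0 = k a' - k a0" "a \<noteq> a'"
      then have "real \<rho> \<le> infnorm (k a - k a')" by (intro apart) (auto simp: F_def)
      then show False using a(3) \<rho> by (simp add: infnorm_0)
    qed
    show "\<exists>S. finite S \<and> (\<forall>k\<in>S. k \<in> Zd \<and> 0 \<le> \<omega> \<bullet> k \<and> \<omega> \<bullet> k < \<eta> \<and> infnorm k \<le> C * real m)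
       \<and> (\<forall>k\<in>S. \<forall>l\<in>S. k \<noteq> l \<longrightarrow> real \<rho> \<le> infnorm (k - l)) \<and> 1 / real J * real m ^ (CARD('n) - 1) \<le> real (card S)"
    proof (intro exI[of _ S] conjI ballI impI)
      show "finite S" using F by (simp add: S_def)
      fix v assume v: "v \<in> S"
      then obtain a where a: "a \<in> F" "v = k a - k a0" by (auto simp: S_def)
      show "v \<in> Zd" using a by (simp add: Zd_diff k_Zd)
      show nn: "0 \<le> \<omega> \<bullet> v" using a a0 by (simp add: inner_diff_right)
      have "\<lfloor>\<omega> \<bullet> k a * real J\<rfloor> = \<lfloor>\<omega> \<bullet> k a0 * real J\<rfloor>"
      proof -
        have "nat \<lfloor>\<omega> \<bullet> k a * real J\<rfloor> = nat \<lfloor>\<omega> \<bullet> k a0 * real J\<rfloor>" using a a0 by (simp add: F_def bin_def)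
        moreover have "0 \<le> \<lfloor>\<omega> \<bullet> k x * real J\<rfloor>" for x using range[of x] by simp
        ultimately show ?thesis by (metis eq_nat_nat_iff)
      qed
      then have "\<omega> \<bullet> k a * real J - \<omega> \<bullet> k a0 * real J < 1" by linarith
      then have "(\<omega> \<bullet> v) * real J < 1" by (simp add: a inner_diff_right left_diff_distrib)
      then have "\<omega> \<bullet> v < 1 / real J" using J by (simp add: field_simps)
      then show "\<omega> \<bullet> v < \<eta>" using J by simp
      show "infnorm v \<le> C * real m"
        unfolding infnorm_le_iff_cart
      proof
        fix i
        have aj: "\<bar>real (a j) - real (a0 j)\<bar> \<le> real m" if "j \<noteq> i0" for j
        proof -
          have "a j < m" "a0 j < m" using a a0 that by (auto simp: F_def I_def PiE_def Pi_def)
          then show ?thesis by (auto simp: abs_le_iff)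
        qed
        have C1: "real \<rho> * real m \<le> C * real m"
          unfolding C_def using w by (intro mult_right_mono) auto
        show "\<bar>v $ i\<bar> \<le> C * real m"
        proof (cases "i = i0")
          case False
          then have "\<bar>v $ i\<bar> = real \<rho> * \<bar>real (a i) - real (a0 i)\<bar>"
            by (simp add: a k_def right_diff_distrib[symmetric] abs_mult)
          also have "\<dots> \<le> real \<rho> * real m" using aj[OF False] by (intro mult_left_mono) auto
          finally show ?thesis using C1 by simp
        next
          case True
          have Tm: "\<bar>T a - T a0\<bar> \<le> real CARD('n) * (real \<rho> * real m)"
          proof -
            have "T a - T a0 = (\<Sum>j\<in>UNIV - {i0}. \<omega> $ j * (real \<rho> * (real (a j) - real (a0 j))))"
              unfolding T_def sum_subtractf[symmetric] by (intro sum.cong) (simp_all add: right_diff_distrib)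
            also have "\<bar>\<dots>\<bar> \<le> (\<Sum>j\<in>UNIV - {i0}. \<bar>\<omega> $ j * (real \<rho> * (real (a j) - real (a0 j)))\<bar>)"
              by (rule sum_abs)
            also have "\<dots> \<le> (\<Sum>j\<in>UNIV - {i0}. real \<rho> * real m)"
            proof (intro sum_mono)
              fix j assume "j \<in> UNIV - {i0}"
              then have "\<bar>\<omega> $ j\<bar> * (real \<rho> * \<bar>real (a j) - real (a0 j)\<bar>) \<le> 1 * (real \<rho> * real m)"
                using \<omega>1[of j] aj[of j] by (intro mult_mono) auto
              then show "\<bar>\<omega> $ j * (real \<rho> * (real (a j) - real (a0 j)))\<bar> \<le> real \<rho> * real m"
                by (simp add: abs_mult)
            qed
            also have "\<dots> \<le> real CARD('n) * (real \<rho> * real m)"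
              by (simp add: card_Diff_singleton) (intro mult_right_mono, auto)
            finally show ?thesis .
          qed
          have "w * (of_int (h a) - of_int (h a0)) = \<omega> \<bullet> v - (T a - T a0)"
            by (simp add: a \<omega>k inner_diff_right algebra_simps)
          then have "\<bar>w * (of_int (h a) - of_int (h a0))\<bar> \<le> 1 + real CARD('n) * (real \<rho> * real m)"
            using Tm nn range[of a] range[of a0] by (simp add: a inner_diff_right)
          then have "w * \<bar>of_int (h a) - of_int (h a0)\<bar> \<le> 1 + real CARD('n) * (real \<rho> * real m)"
            using w by (simp add: abs_mult)
          also have "\<dots> \<le> (1 + real CARD('n) * real \<rho>) * real m" using m by (simp add: algebra_simps)
          finally have "\<bar>of_int (h a) - of_int (h a0)\<bar> \<le> (1 + real CARD('n) * real \<rho>) / w * real m"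
            using w by (simp add: field_simps)
          moreover have "\<bar>v $ i\<bar> = \<bar>of_int (h a) - of_int (h a0)\<bar>"
            using i0 True by (simp add: a k_def right_diff_distrib[symmetric] abs_mult abs_sgn_eq)
          ultimately show ?thesis unfolding C_def by (simp add: distrib_right add_increasing)
        qed
      qed
      fix v' assume v': "v' \<in> S" "v \<noteq> v'"
      then obtain a' where a': "a' \<in> F" "v' = k a' - k a0" by (auto simp: S_def)
      then have "real \<rho> \<le> infnorm (k a - k a')" using a v' by (intro apart) (auto simp: F_def)
      then show "real \<rho> \<le> infnorm (v - v')" by (simp add: a a')
    next
      have "card S = card F" unfolding S_def by (rule card_image[OF inj])
      then have "real (m ^ (CARD('n) - 1)) \<le> real (J * card S)" using b I by (simp only: of_nat_le_iff F_def)
      then show "1 / real J * real m ^ (CARD('n) - 1) \<le> real (card S)" using J by (simp add: field_simps)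
    qed
  qed
  then show thesis using that[of C "1 / real J"] C J by simp
qed

section \<open>Average cost of a lift inside a large cube\<close>

context kernel
begin

text \<open>Measurability in the radius, so that the average of the error terms splits into a sum of
  averages.\<close>

lemma borel_measurable_average:
  fixes X :: "real \<Rightarrow> ((real^'n) \<times> (real^'n)) set"
  assumes S[measurable]: "{q. fst q \<in> I \<and> snd q \<in> X (fst q)} \<in> sets (borel \<Otimes>\<^sub>M borel)"
    and X: "\<And>r. r \<in> I \<Longrightarrow> X r \<in> sets borel"
  shows "(\<lambda>r. indicator I r * emeasure mu (X r)) \<in> borel_measurable borel"
proof -
  let ?S = "{q. fst q \<in> I \<and> snd q \<in> X (fst q)}"
  have m: "(\<lambda>(r, p). K p * indicator ?S (r, p)) \<in> borel_measurable (borel \<Otimes>\<^sub>M lborel)"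
    by measurable
  have eq: "(\<lambda>r. indicator I r * emeasure mu (X r)) = (\<lambda>r. \<integral>\<^sup>+p. K p * indicator ?S (r, p) \<partial>lborel)"
  proof
    fix r
    show "indicator I r * emeasure mu (X r) = (\<integral>\<^sup>+p. K p * indicator ?S (r, p) \<partial>lborel)"
      using X[of r] by (cases "r \<in> I") (auto simp: emeasure_mu indicator_def intro!: nn_integral_cong)
  qed
  show ?thesis unfolding eq using lborel.borel_measurable_nn_integral_fst[OF m] by simp
qed

abbreviation shell :: "real \<Rightarrow> real \<Rightarrow> (real^'n) set" where
  "shell c r \<equiv> {x. r \<le> infnorm x \<and> infnorm x < r + c}"

lemma shell_cut_measurable:
  assumes [measurable]: "E \<in> sets borel"
  shows "{q. fst q \<in> {N..N'} \<and> snd q \<in> cut (shell c (fst q)) E} \<in> sets (borel \<Otimes>\<^sub>M borel)"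
proof -
  have "{q. fst q \<in> {N..N'} \<and> snd q \<in> cut (shell c (fst q)) E} = {q \<in> space (borel \<Otimes>\<^sub>M (borel \<Otimes>\<^sub>M borel)).
      fst q \<in> {N..N'} \<and> fst (snd q) \<in> E \<and> snd (snd q) \<notin> E \<and>
      ((fst q \<le> infnorm (fst (snd q)) \<and> infnorm (fst (snd q)) < fst q + c) \<or>
       (fst q \<le> infnorm (snd (snd q)) \<and> infnorm (snd (snd q)) < fst q + c))}"
    by (auto simp: cut_def space_pair_measure)
  also have "\<dots> \<in> sets (borel \<Otimes>\<^sub>M (borel \<Otimes>\<^sub>M borel))" by measurable
  finally show ?thesis by (simp only: borel_prod)
qed

text \<open>A pair is cut within the shell only for radii at most \<open>c\<close> below the norm of
  one of its ends, a set of length at most \<open>2 * c\<close>. On average a shell of fixed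
  thickness carries a fraction of order \<open>1 / N\<close> of the energy.\<close>

lemma nn_integral_Per_shell:
  assumes [measurable]: "E \<in> sets borel" and c: "0 \<le> c" and N: "0 < N"
  shows "(\<integral>\<^sup>+r. indicator {N..2*N} r * Per (shell c r) E \<partial>lborel) \<le> ennreal (2 * c) * Per (cube 0 (2 * N + c)) E"
proof -
  have "(\<integral>\<^sup>+r. indicator {N..2*N} r * Per (shell c r) E \<partial>lborel)
     = (\<integral>\<^sup>+p. K p * emeasure lborel {r\<in>{N..2*N}. p \<in> cut (shell c r) E} \<partial>lborel)"
    unfolding Per_def by (rule nn_integral_average[OF shell_cut_measurable]) auto
  also have "\<dots> \<le> (\<integral>\<^sup>+p. ennreal (2 * c) * (K p * indicator (cut (cube 0 (2 * N + c)) E) p) \<partial>lborel)"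
  proof (intro nn_integral_mono)
    fix p :: "(real^'n) \<times> (real^'n)"
    show "K p * emeasure lborel {r\<in>{N..2*N}. p \<in> cut (shell c r) E} \<le> ennreal (2 * c) * (K p * indicator (cut (cube 0 (2 * N + c)) E) p)"
    proof (cases "p \<in> cut (cube 0 (2 * N + c)) E")
      case True
      have "{r\<in>{N..2*N}. p \<in> cut (shell c r) E} \<subseteq> {infnorm (fst p) - c..infnorm (fst p)} \<union> {infnorm (snd p) - c..infnorm (snd p)}"
        by (auto simp: cut_def)
      then have "emeasure lborel {r\<in>{N..2*N}. p \<in> cut (shell c r) E}
          \<le> emeasure lborel ({infnorm (fst p) - c..infnorm (fst p)} \<union> {infnorm (snd p) - c..infnorm (snd p)})"
        by (intro emeasure_mono) auto
      also have "\<dots> \<le> emeasure lborel {infnorm (fst p) - c..infnorm (fst p)} + emeasure lborel {infnorm (snd p) - c..infnorm (snd p)}"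
        by (intro emeasure_subadditive) auto
      also have "\<dots> = ennreal (2 * c)" using c by (simp add: ennreal_plus[symmetric] del: ennreal_plus)
      finally show ?thesis using True by (simp add: mult.commute[of "K p"] mult_right_mono)
    next
      case False
      then have e: "{r\<in>{N..2*N}. p \<in> cut (shell c r) E} = {}" by (auto simp: cut_def cube_def)
      show ?thesis unfolding e by simp
    qed
  qed
  also have "\<dots> = ennreal (2 * c) * Per (cube 0 (2 * N + c)) E"
    unfolding Per_def by (subst nn_integral_cmult) (auto simp: emeasure_mu)
  finally show ?thesis .
qed

text \<open>Without an upper obstacle the cube can be filled instead of emptied, so the energy bound
  holds also for cubes meeting the lower obstacle.\<close>

lemma obstacle_min_energy:
  assumes E: "obstacle_min L UNIV E" and R: "0 < R"
  shows "Per (cube 0 R) E \<le> ennreal (Lam * near_const (real CARD('n)) s * 4 ^ CARD('n) * R powr (real CARD('n) - s))"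
proof (rule energy_bound[OF obstacle_min_borel[OF E] R])
  fix r
  have [measurable]: "E \<in> sets borel" using E by (rule obstacle_min_borel)
  have "Per (cube 0 r) E \<le> Per (cube 0 r) (E \<union> cube 0 r)"
  proof (rule obstacle_min_le[OF E])
    show "L \<sqsubseteq> E \<union> cube 0 r" by (rule ae_subset_trans[OF obstacle_min_lower[OF E] ae_subset_subset]) auto
  qed (auto simp: bounded_cube)
  also have "\<dots> \<le> interaction (cube 0 r) (- cube 0 r)" by (rule Per_fill_le) simp
  finally show "Per (cube 0 r) E \<le> interaction (cube 0 r) (- cube 0 r)" .
qed

text \<open>As \<open>E\<close> lies below its translate, the layer has the volume of the translate
  minus that of \<open>E\<close> in the cube. The former is the volume of \<open>E\<close> in a
  shifted cube, so it exceeds the latter by at most a boundary shell.\<close>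

lemma layer_volume:
  fixes E :: "(real^'n) set"
  assumes [measurable]: "E \<in> sets borel" and ED: "E \<sqsubseteq> translate l E" and c: "infnorm l \<le> c" "c \<le> r" "0 < c"
  shows "emeasure lborel ((translate l E - E) \<inter> cube 0 r)
    \<le> ennreal (2 * c * real CARD('n) * 4 ^ (CARD('n) - 1) * r ^ (CARD('n) - 1))"
proof -
  let ?Q = "cube (0::real^'n) r" and ?D = "translate l E"
  have "emeasure lborel ((?D - E) \<inter> ?Q) + emeasure lborel (E \<inter> ?D \<inter> ?Q) = emeasure lborel (?D \<inter> ?Q)"
    by (subst plus_emeasure) (auto intro!: arg_cong[where f = "emeasure lborel"])
  also have "emeasure lborel (E \<inter> ?D \<inter> ?Q) = emeasure lborel (E \<inter> ?Q)"
  proof (rule emeasure_eq_AE)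
    show "AE x in lborel. (x \<in> E \<inter> ?D \<inter> ?Q) = (x \<in> E \<inter> ?Q)"
      using ED unfolding ae_subset_def by eventually_elim auto
  qed auto
  also have "?D \<inter> ?Q = translate l (E \<inter> cube (- l) r)" by (simp add: translate_Int translate_cube)
  also have "emeasure lborel (translate l (E \<inter> cube (- l) r)) = emeasure lborel (E \<inter> cube (- l) r)"
    by (rule emeasure_translate) auto
  also have "\<dots> \<le> emeasure lborel ((E \<inter> ?Q) \<union> (cube 0 (r + c) - ?Q))"
  proof (rule emeasure_mono)
    have "cube (- l) r \<subseteq> cube 0 (r + c)" using c by (intro cube_subset_cube) (simp add: infnorm_neg)
    then show "E \<inter> cube (- l) r \<subseteq> (E \<inter> ?Q) \<union> (cube 0 (r + c) - ?Q)" by auto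
  qed auto
  also have "\<dots> \<le> emeasure lborel (E \<inter> ?Q) + emeasure lborel (cube 0 (r + c) - ?Q)"
    by (intro emeasure_subadditive) auto
  finally have "emeasure lborel (E \<inter> ?Q) + emeasure lborel ((?D - E) \<inter> ?Q)
      \<le> emeasure lborel (E \<inter> ?Q) + emeasure lborel (cube (0::real^'n) (r + c) - ?Q)"
    by (simp add: add.commute)
  moreover have "emeasure lborel (E \<inter> ?Q) < \<infinity>"
  proof -
    have "emeasure lborel (E \<inter> ?Q) \<le> emeasure lborel ?Q" by (intro emeasure_mono) auto
    then show ?thesis using emeasure_cube_finite by (rule le_less_trans)
  qed
  ultimately have "emeasure lborel ((?D - E) \<inter> ?Q) \<le> emeasure lborel (cube (0::real^'n) (r + c) - ?Q)"
    by (auto simp: ennreal_add_left_cancel_le)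
  also have "\<dots> = emeasure lborel (cube (0::real^'n) (r + c)) - emeasure lborel ?Q"
    using c cube_mono[of r "r + c" 0] emeasure_cube_finite[of "0::real^'n" r] by (intro emeasure_Diff) auto
  also have "\<dots> = ennreal ((2 * (r + c)) ^ CARD('n) - (2 * r) ^ CARD('n))"
    using c by (simp add: emeasure_cube ennreal_minus)
  also have "\<dots> \<le> ennreal (2 * c * real CARD('n) * 4 ^ (CARD('n) - 1) * r ^ (CARD('n) - 1))"
  proof (rule ennreal_leI)
    have "(2 * (r + c)) ^ CARD('n) - (2 * r) ^ CARD('n) \<le> real CARD('n) * (2 * (r + c)) ^ (CARD('n) - 1) * (2 * (r + c) - 2 * r)"
      using c by (intro power_diff_le) auto
    also have "2 * (r + c) - 2 * r = 2 * c" by simp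
    also have "real CARD('n) * (2 * (r + c)) ^ (CARD('n) - 1) * (2 * c) \<le> real CARD('n) * (4 * r) ^ (CARD('n) - 1) * (2 * c)"
    proof -
      have "(2 * (r + c)) ^ (CARD('n) - 1) \<le> (4 * r) ^ (CARD('n) - 1)" using c by (intro power_mono) auto
      then show ?thesis using c by (intro mult_right_mono mult_left_mono) auto
    qed
    also have "\<dots> = 2 * c * real CARD('n) * 4 ^ (CARD('n) - 1) * r ^ (CARD('n) - 1)"
      unfolding power_mult_distrib by simp
    finally show "(2 * (r + c)) ^ CARD('n) - (2 * r) ^ CARD('n) \<le> 2 * c * real CARD('n) * 4 ^ (CARD('n) - 1) * r ^ (CARD('n) - 1)" .
  qed
  finally show ?thesis .
qed

text \<open>A point beyond radius \<open>4 * N\<close> is at distance at least half its norm from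
  the cube. The tail integral is taken for Lebesgue measure restricted to \<open>B\<close>, whose
  growth exponent \<open>d - 1\<close> gives \<open>N powr (- 1 - s)\<close>; the cube contributes
  its volume, of order \<open>N ^ d\<close>.\<close>

lemma far_interaction:
  assumes [measurable]: "B \<in> sets borel" and N: "0 < N" and cB: "0 \<le> cB"
    and vol: "\<And>r. N \<le> r \<Longrightarrow> emeasure lborel (B \<inter> cube 0 r) \<le> ennreal (cB * r ^ (CARD('n) - 1))"
  shows "interaction (cube 0 (2 * N)) (B - cube 0 (4 * N))
    \<le> ennreal (4 ^ CARD('n) * (Lam * 2 powr (real CARD('n) + s)) * (cB * 2 powr (real CARD('n) - 1)
         * 2 powr (real CARD('n) - 1) / (1 - 2 powr (- 1 - s)) * 4 powr (- 1 - s)) * N powr (real CARD('n) - 1 - s))"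
proof -
  define D where "D = real CARD('n)"
  have D: "1 \<le> D" unfolding D_def by (simp add: Suc_leI)
  have D1: "real (CARD('n) - 1) = D - 1" by (simp add: D_def of_nat_diff Suc_leI)
  let ?Q = "cube (0::real^'n) (2 * N)" and ?B = "B - cube 0 (4 * N)"
  define M where "M = density lborel (indicator B :: real^'n \<Rightarrow> ennreal)"
  have [simp, measurable_cong]: "sets M = sets borel" by (simp add: M_def)
  have [simp]: "space M = UNIV" by (simp add: M_def)
  define g where "g y = ennreal (infnorm y powr - (D + s)) * indicator {y. 4 * N \<le> infnorm y} y" for y :: "real^'n"
  have [measurable]: "g \<in> borel_measurable borel" unfolding g_def by measurable
  have tail: "(\<integral>\<^sup>+y. g y \<partial>M) \<le> ennreal ((cB * 2 powr (D - 1)) * 2 powr (D - 1) / (1 - 2 powr (D - 1 - (D + s))) * (4 * N) powr (D - 1 - (D + s)))"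
    unfolding g_def
  proof (rule nn_integral_powr_tail)
    fix t assume t: "4 * N \<le> t"
    have "emeasure M {x \<in> space M. infnorm x \<le> t} = emeasure lborel (B \<inter> {x. infnorm x \<le> t})"
      unfolding M_def by (subst emeasure_density) (auto simp: indicator_inter_arith[symmetric])
    also have "\<dots> \<le> emeasure lborel (B \<inter> cube 0 (2 * t))"
      using t N by (intro emeasure_mono) (auto simp: cube_def)
    also have "\<dots> \<le> ennreal (cB * (2 * t) ^ (CARD('n) - 1))" using t N by (intro vol) auto
    also have "cB * (2 * t) ^ (CARD('n) - 1) = cB * 2 powr (D - 1) * t powr (D - 1)"
      using t N powr_realpow[of "2 * t" "CARD('n) - 1", unfolded D1] by (simp add: powr_mult)
    finally show "emeasure M {x \<in> space M. infnorm x \<le> t} \<le> ennreal (cB * 2 powr (D - 1) * t powr (D - 1))" .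
  qed (use s D N cB in auto)
  have mQB: "?Q \<times> ?B \<in> sets borel" by (intro borel_Times) auto
  have LLQB: "interaction ?Q ?B = (\<integral>\<^sup>+p. K p * indicator (?Q \<times> ?B) p \<partial>lborel)" by (rule interaction_nn_integral) auto
  have meas: "(\<lambda>p. ennreal (Lam * 2 powr (D + s)) * (indicator ?Q (fst p) * (indicator B (snd p) * g (snd p)))) \<in> borel_measurable borel"
    unfolding borel_prod[symmetric] by measurable
  have "(\<integral>\<^sup>+p. K p * indicator (?Q \<times> ?B) p \<partial>lborel) \<le> (\<integral>\<^sup>+p. ennreal (Lam * 2 powr (D + s)) * (indicator ?Q (fst p) * (indicator B (snd p) * g (snd p))) \<partial>lborel)"
  proof (rule nn_integral_mono_AE)
    show "AE p in lborel. K p * indicator (?Q \<times> ?B) p \<le> ennreal (Lam * 2 powr (D + s)) * (indicator ?Q (fst p) * (indicator B (snd p) * g (snd p)))"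
      using K_up
    proof eventually_elim
      case (elim p)
      show ?case
      proof (cases "p \<in> ?Q \<times> ?B")
        case True
        then have x: "infnorm (fst p) < 2 * N" and y: "4 * N \<le> infnorm (snd p)" by (auto simp: cube_def)
        have "infnorm (snd p) / 2 \<le> infnorm (fst p - snd p)"
          using infnorm_triangle[of "fst p" "snd p - fst p"] x y by (simp add: infnorm_sub)
        then have "infnorm (fst p - snd p) powr - (D + s) \<le> (infnorm (snd p) / 2) powr - (D + s)"
          using y N s D by (intro powr_mono2') auto
        also have "\<dots> = 2 powr (D + s) * infnorm (snd p) powr - (D + s)"
          unfolding powr_divide by (simp only: powr_minus[of 2 "D + s"] divide_inverse inverse_inverse_eq mult.commute)
        finally have "Lam * infnorm (fst p - snd p) powr - (D + s) \<le> Lam * 2 powr (D + s) * infnorm (snd p) powr - (D + s)"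
          unfolding mult.assoc using Lam by (intro mult_left_mono) auto
        then have "K p \<le> ennreal (Lam * 2 powr (D + s) * infnorm (snd p) powr - (D + s))"
          using elim unfolding D_def by (meson ennreal_leI order_trans)
        also have "\<dots> = ennreal (Lam * 2 powr (D + s)) * ennreal (infnorm (snd p) powr - (D + s))"
          using Lam by (simp add: ennreal_mult')
        finally show ?thesis using True y by (auto simp: g_def mem_Times_iff)
      qed auto
    qed
  qed
  also have "\<dots> = (\<integral>\<^sup>+x. \<integral>\<^sup>+y. ennreal (Lam * 2 powr (D + s)) * (indicator ?Q x * (indicator B y * g y)) \<partial>lborel \<partial>lborel)"
    by (subst nn_integral_lborel_pair[OF meas]) simp
  also have "\<dots> = (\<integral>\<^sup>+x. (ennreal (Lam * 2 powr (D + s)) * (\<integral>\<^sup>+y. g y \<partial>M)) * indicator ?Q x \<partial>lborel)"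
  proof (rule nn_integral_cong)
    fix x :: "real^'n"
    have "(\<integral>\<^sup>+y. ennreal (Lam * 2 powr (D + s)) * (indicator ?Q x * (indicator B y * g y)) \<partial>lborel)
        = (ennreal (Lam * 2 powr (D + s)) * indicator ?Q x) * (\<integral>\<^sup>+y. indicator B y * g y \<partial>lborel)"
      by (subst nn_integral_cmult[symmetric]) (auto simp: ac_simps)
    also have "(\<integral>\<^sup>+y. indicator B y * g y \<partial>lborel) = (\<integral>\<^sup>+y. g y \<partial>M)"
      unfolding M_def by (subst nn_integral_density) auto
    finally show "(\<integral>\<^sup>+y. ennreal (Lam * 2 powr (D + s)) * (indicator ?Q x * (indicator B y * g y)) \<partial>lborel)
        = (ennreal (Lam * 2 powr (D + s)) * (\<integral>\<^sup>+y. g y \<partial>M)) * indicator ?Q x" by (simp add: ac_simps)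
  qed
  also have "\<dots> = (ennreal (Lam * 2 powr (D + s)) * (\<integral>\<^sup>+y. g y \<partial>M)) * emeasure lborel ?Q"
    by (subst nn_integral_cmult) auto
  also have "\<dots> \<le> (ennreal (Lam * 2 powr (D + s)) * ennreal ((cB * 2 powr (D - 1)) * 2 powr (D - 1) / (1 - 2 powr (D - 1 - (D + s))) * (4 * N) powr (D - 1 - (D + s))))
       * ennreal ((4 * N) ^ CARD('n))"
    using N tail by (intro mult_mono) (auto simp: emeasure_cube)
  also have "\<dots> = ennreal (4 ^ CARD('n) * (Lam * 2 powr (D + s)) * (cB * 2 powr (D - 1)
         * 2 powr (D - 1) / (1 - 2 powr (- 1 - s)) * 4 powr (- 1 - s)) * N powr (D - 1 - s))"
  proof -
    have e: "D - 1 - (D + s) = - 1 - s" by simp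
    have "2 powr (- 1 - s) < 1" using s by (intro two_powr_less_one) auto
    then have nn: "0 \<le> (cB * 2 powr (D - 1)) * 2 powr (D - 1) / (1 - 2 powr (- 1 - s)) * (4 * N) powr (- 1 - s)"
      using cB by auto
    define u where "u = Lam * 2 powr (D + s)"
    define v where "v = cB * 2 powr (D - 1) * 2 powr (D - 1) / (1 - 2 powr (- 1 - s))"
    define X where "X = (4 * N) powr (- 1 - s)"
    define Y where "Y = (4 * N) ^ CARD('n)"
    have "N ^ CARD('n) = N powr D" using N by (simp add: D_def powr_realpow)
    moreover have "N powr (- 1 - s) * N powr D = N powr (D - 1 - s)"
      by (subst powr_add[symmetric]) (simp add: algebra_simps)
    ultimately have XY: "X * Y = 4 ^ CARD('n) * 4 powr (- 1 - s) * N powr (D - 1 - s)"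
      using N by (simp add: X_def Y_def powr_mult power_mult_distrib)
    have "0 \<le> u" "0 \<le> v * X" "0 \<le> Y" using nn Lam N by (auto simp: u_def v_def X_def Y_def)
    then have "ennreal u * ennreal (v * X) * ennreal Y = ennreal (u * (v * X) * Y)"
      by (simp add: ennreal_mult')
    also have "u * (v * X) * Y = u * v * (X * Y)" by (simp only: ac_simps)
    also have "\<dots> = 4 ^ CARD('n) * u * (v * 4 powr (- 1 - s)) * N powr (D - 1 - s)"
      unfolding XY by (simp only: ac_simps)
    finally show ?thesis unfolding e u_def v_def X_def Y_def .
  qed
  finally show ?thesis unfolding LLQB by (simp only: D_def)
qed

text \<open>The hypothesis is averaged over radii between \<open>N\<close> and \<open>2 * N\<close>.
  The boundary shell, the layer up to radius \<open>4 * N\<close> and the layer beyond it yield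
  \<open>C1\<close>, \<open>C2\<close> and \<open>C3\<close>, all with the same power of
  \<open>N\<close>; the constants depend on \<open>l\<close> but not on \<open>N\<close>.\<close>

lemma error_bound:
  assumes E: "obstacle_min L UNIV E" and birkhoff: "birkhoff \<omega> E" and l: "l \<in> Zd" "0 \<le> \<omega> \<bullet> l"
  shows "\<exists>C>0. \<forall>N x. infnorm l + 1 \<le> N \<longrightarrow> 0 \<le> x \<longrightarrow>
       (\<forall>r\<in>{N..2*N}. ennreal x \<le> Per (cube (- l) r - cube 0 r) E + interaction (cube 0 r) (translate l E - E - cube 0 r))
       \<longrightarrow> N * x \<le> C * N powr (real CARD('n) - s)"
proof -
  define D where "D = real CARD('n)"
  have D: "1 \<le> D" unfolding D_def by (simp add: Suc_leI)
  have D1: "real (CARD('n) - 1) = D - 1" by (simp add: D_def of_nat_diff Suc_leI)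
  have [measurable]: "E \<in> sets borel" using E by (rule obstacle_min_borel)
  \<comment> \<open>Thickness of a shell containing the shifted cube minus the cube; the extra 1
    keeps it positive.\<close>
  define c where "c = infnorm l + 1"
  have c: "1 \<le> c" "infnorm l \<le> c" using infnorm_pos_le[of l] by (auto simp: c_def)
  define B where "B = translate l E - E"
  have [measurable]: "B \<in> sets borel" by (simp add: B_def)
  have ED: "E \<sqsubseteq> translate l E" using birkhoffD_mono[OF birkhoff Zd_zero l(1)] l(2) by simp
  define cB where "cB = 2 * c * D * 4 ^ (CARD('n) - 1)"
  have cB: "0 < cB" using c D by (simp add: cB_def)
  have vol: "emeasure lborel (B \<inter> cube 0 r) \<le> ennreal (cB * r ^ (CARD('n) - 1))" if "c \<le> r" for r
    unfolding B_def cB_def D_def using that c by (intro layer_volume[OF _ ED]) auto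
  define cK where "cK = Lam * near_const D s"
  have cK: "0 < cK" using kernel_const_pos by (simp add: cK_def D_def)
  define C1 where "C1 = 2 * c * (cK * 4 ^ CARD('n) * 3 powr (D - s))"
  define C2 where "C2 = cK * (cB * 4 ^ (CARD('n) - 1))"
  define C3 where "C3 = 4 ^ CARD('n) * (Lam * 2 powr (D + s)) * (cB * 2 powr (D - 1)
         * 2 powr (D - 1) / (1 - 2 powr (- 1 - s)) * 4 powr (- 1 - s))"
  have C12: "0 < C1" "0 < C2" using c cK cB by (auto simp: C1_def C2_def)
  have C3: "0 < C3"
  proof -
    have "2 powr (- 1 - s) < 1" using s by (intro two_powr_less_one) auto
    then show ?thesis using Lam cB by (auto simp: C3_def)
  qed
  show ?thesis
  proof (intro exI[of _ "C1 + C2 + C3"] conjI allI impI)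
    show "0 < C1 + C2 + C3" using C12 C3 by simp
    fix N x :: real
    assume N: "infnorm l + 1 \<le> N" and x: "0 \<le> x"
      and le: "\<forall>r\<in>{N..2*N}. ennreal x \<le> Per (cube (- l) r - cube 0 r) E + interaction (cube 0 r) (translate l E - E - cube 0 r)"
    have N0: "0 < N" "c \<le> N" using N c by (auto simp: c_def)
    let ?I = "indicator {N..2*N} :: real \<Rightarrow> ennreal"
    define B1 where "B1 = B \<inter> cube 0 (4 * N)"
    define F where "F = interaction (cube 0 (2 * N)) (B - cube 0 (4 * N))"
    have [measurable]: "B1 \<in> sets borel" by (simp add: B1_def)
    have m1: "(\<lambda>r. ?I r * Per (shell c r) E) \<in> borel_measurable lborel"
      unfolding Per_def using borel_measurable_average[OF shell_cut_measurable[of E N "2 * N" c]] by simp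
    have m2: "(\<lambda>r. ?I r * interaction (UNIV \<inter> cube 0 r) (B1 - cube 0 r)) \<in> borel_measurable lborel"
      unfolding interaction_def using borel_measurable_average[OF cube_pairs_measurable[of UNIV B1 N "2 * N" 0]]
      by (simp add: borel_Times)
    have "ennreal (N * x) = (\<integral>\<^sup>+r. ?I r * ennreal x \<partial>lborel)"
      using N0 x by (subst nn_integral_multc) (auto simp: ennreal_mult')
    also have "\<dots> \<le> (\<integral>\<^sup>+r. ?I r * Per (shell c r) E + (?I r * interaction (UNIV \<inter> cube 0 r) (B1 - cube 0 r) + ?I r * F) \<partial>lborel)"
    proof (rule nn_integral_mono)
      fix r
      show "?I r * ennreal x \<le> ?I r * Per (shell c r) E + (?I r * interaction (UNIV \<inter> cube 0 r) (B1 - cube 0 r) + ?I r * F)"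
      proof (cases "r \<in> {N..2*N}")
        case True
        have 1: "Per (cube (- l) r - cube 0 r) E \<le> Per (shell c r) E"
        proof (rule Per_mono)
          have "cube (- l) r \<subseteq> cube 0 (r + c)" using c by (intro cube_subset_cube) (simp add: infnorm_neg)
          then show "cube (- l) r - cube 0 r \<subseteq> shell c r" by (auto simp: cube_def)
        qed auto
        have "interaction (cube 0 r) (translate l E - E - cube 0 r) \<le> interaction (cube 0 r) ((B1 - cube 0 r) \<union> (B - cube 0 (4 * N)))"
          by (intro interaction_mono) (auto simp: B_def B1_def)
        also have "\<dots> = interaction (cube 0 r) (B1 - cube 0 r) + interaction (cube 0 r) (B - cube 0 (4 * N))"
          by (intro interaction_Un) (auto simp: B1_def)
        also have "\<dots> \<le> interaction (UNIV \<inter> cube 0 r) (B1 - cube 0 r) + F"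
          unfolding F_def using True by (intro add_mono interaction_mono cube_mono) auto
        finally have "ennreal x \<le> Per (shell c r) E + (interaction (UNIV \<inter> cube 0 r) (B1 - cube 0 r) + F)"
          using le 1 True by (intro order_trans[OF le[rule_format] add_mono]) auto
        then show ?thesis using True by simp
      qed auto
    qed
    also have "\<dots> = (\<integral>\<^sup>+r. ?I r * Per (shell c r) E \<partial>lborel) + ((\<integral>\<^sup>+r. ?I r * interaction (UNIV \<inter> cube 0 r) (B1 - cube 0 r) \<partial>lborel) + (\<integral>\<^sup>+r. ?I r * F \<partial>lborel))"
      using m1 m2 by (simp add: nn_integral_add)
    also have "\<dots> \<le> ennreal (C1 * N powr (D - s)) + (ennreal (C2 * N powr (D - s)) + ennreal (C3 * N powr (D - s)))"
    proof (intro add_mono)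
      have "(\<integral>\<^sup>+r. ?I r * Per (shell c r) E \<partial>lborel) \<le> ennreal (2 * c) * Per (cube 0 (2 * N + c)) E"
        using c N0 by (intro nn_integral_Per_shell) auto
      also have "\<dots> \<le> ennreal (2 * c) * Per (cube 0 (3 * N)) E"
        using N0 by (intro mult_left_mono Per_mono cube_mono) auto
      also have "\<dots> \<le> ennreal (2 * c) * ennreal (cK * 4 ^ CARD('n) * (3 * N) powr (D - s))"
        unfolding cK_def D_def using N0 by (intro mult_left_mono obstacle_min_energy[OF E]) auto
      also have "\<dots> = ennreal (C1 * N powr (D - s))"
        using c N0 by (simp add: C1_def ennreal_mult'[symmetric] powr_mult ac_simps)
      finally show "(\<integral>\<^sup>+r. ?I r * Per (shell c r) E \<partial>lborel) \<le> ennreal (C1 * N powr (D - s))" .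
      have "(\<integral>\<^sup>+r. ?I r * interaction (UNIV \<inter> cube 0 r) (B1 - cube 0 r) \<partial>lborel) \<le> ennreal (cK * (2 * N - N) powr (1 - s)) * emeasure lborel B1"
        unfolding cK_def D_def using N0 by (intro nn_integral_interaction_cube_snd) auto
      also have "\<dots> \<le> ennreal (cK * N powr (1 - s)) * ennreal (cB * (4 * N) ^ (CARD('n) - 1))"
        unfolding B1_def using N0 vol[of "4 * N"] by (intro mult_mono) auto
      also have "\<dots> = ennreal (C2 * N powr (D - s))"
      proof -
        have "N powr (1 - s) * N ^ (CARD('n) - 1) = N powr (D - s)"
          using N0 powr_realpow[of N "CARD('n) - 1", unfolded D1] powr_add[of N "1 - s" "D - 1"] by simp
        then have "cK * N powr (1 - s) * (cB * (4 * N) ^ (CARD('n) - 1)) = C2 * N powr (D - s)"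
          by (simp add: C2_def power_mult_distrib ac_simps)
        then show ?thesis using cK by (simp add: ennreal_mult'[symmetric])
      qed
      finally show "(\<integral>\<^sup>+r. ?I r * interaction (UNIV \<inter> cube 0 r) (B1 - cube 0 r) \<partial>lborel) \<le> ennreal (C2 * N powr (D - s))" .
      have "(\<integral>\<^sup>+r. ?I r * F \<partial>lborel) = ennreal N * F"
        using N0 by (subst nn_integral_multc) auto
      also have "\<dots> \<le> ennreal N * ennreal (C3 * N powr (D - 1 - s))"
        unfolding F_def C3_def D_def using N0 cB vol by (intro mult_left_mono far_interaction) auto
      also have "\<dots> = ennreal (C3 * N powr (D - s))"
      proof -
        have e: "1 + (D - 1 - s) = D - s" by simp
        have "N * N powr (D - 1 - s) = N powr (D - s)"
          using powr_add[of N 1 "D - 1 - s", unfolded e] N0 by simp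
        then have "N * (C3 * N powr (D - 1 - s)) = C3 * N powr (D - s)" by (metis mult.left_commute)
        moreover have "ennreal N * ennreal (C3 * N powr (D - 1 - s)) = ennreal (N * (C3 * N powr (D - 1 - s)))"
          using N0 by (intro ennreal_mult'[symmetric]) simp
        ultimately show ?thesis by (simp only:)
      qed
      finally show "(\<integral>\<^sup>+r. ?I r * F \<partial>lborel) \<le> ennreal (C3 * N powr (D - s))" .
    qed
    also have "\<dots> = ennreal ((C1 + C2 + C3) * N powr (D - s))"
      using C12 C3 by (simp add: ennreal_plus[symmetric] distrib_right del: ennreal_plus)
    finally show "N * x \<le> (C1 + C2 + C3) * N powr (real CARD('n) - s)"
      using C12 C3 unfolding D_def by (subst (asm) ennreal_le_iff) auto
  qed
qed

text \<open>There is no drift: if pushing \<open>E\<close> below its obstacle gained energy somewhere, it would do so at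
  about \<open>N^(d-1)\<close> almost-periods in a cube of side \<open>N\<close>. Lifting \<open>E\<close> by an integer vector inside the
  cube makes all these gains admissible and costs only \<open>N^(d-1-s)\<close>.\<close>
lemma left_cont_obstacle_free:
  assumes unit_dir: "unit_dir \<omega>" and E: "obstacle_min (staircase \<omega> a) UNIV E" and birkhoff: "birkhoff \<omega> E" and left_cont: "left_cont \<omega> E"
  shows "obstacle_min {} UNIV E"
proof (rule ccontr)
  assume nf: "\<not> obstacle_min {} UNIV E"
  obtain R A \<delta> where R: "0 < R" and \<delta>: "0 < \<delta>" and A: "A \<in> sets borel" "A \<subseteq> E" "A \<subseteq> cube 0 R"
    and gain: "Per (cube 0 R) (E - A) + ennreal \<delta> \<le> Per (cube 0 R) E"
    by (rule obstacle_min_not_free_gain[OF E nf])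
  define D where "D = real CARD('n)"
  have D1: "real (CARD('n) - 1) = D - 1" by (simp add: D_def of_nat_diff Suc_leI)
  obtain \<epsilon> where \<epsilon>: "0 < \<epsilon>"
    and small: "\<And>A'. A' \<in> sets borel \<Longrightarrow> emeasure lborel A' < ennreal \<epsilon> \<Longrightarrow> Per (cube 0 R) E \<le> Per (cube 0 R) (E - A') + ennreal (\<delta>/2)"
    using \<delta> by (rule_tac Per_remove_small[OF obstacle_min_borel[OF E] locally_finite_cube[OF obstacle_min_locally_finite[OF E]] cube_borel, of "\<delta>/2" 0 R]) auto
  obtain \<eta> where \<eta>: "0 < \<eta>" and left_cont\<eta>: "\<And>k. k \<in> Zd \<Longrightarrow> - \<eta> < \<omega> \<bullet> k \<Longrightarrow> \<omega> \<bullet> k \<le> 0 \<Longrightarrow> emeasure lborel (E \<inter> cube 0 R - translate k E) < ennreal \<epsilon>"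
    using left_cont \<epsilon> unfolding left_cont_def by meson
  obtain k1 where k1: "k1 \<in> Zd" "0 < \<omega> \<bullet> k1" using unit_dir_short_step[OF unit_dir] .
  obtain j :: nat where j: "\<bar>a + 1 + R\<bar> < real j * (\<omega> \<bullet> k1)" using reals_Archimedean3[OF k1(2)] by blast
  \<comment> \<open>High enough for the copies of \<open>A\<close> to clear the obstacle.\<close>
  define k0 where "k0 = real j *\<^sub>R k1"
  have k0: "k0 \<in> Zd" "a + 1 + R \<le> \<omega> \<bullet> k0" "0 \<le> \<omega> \<bullet> k0"
    using k1 j by (auto simp: k0_def Zd_def)
  \<comment> \<open>Spacing at least \<open>2 * R\<close> keeps the cubes of radius \<open>R\<close>
    around different almost-periods disjoint.\<close>
  define \<rho> where "\<rho> = nat \<lceil>2 * R\<rceil>"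
  have \<rho>: "0 < \<rho>" "2 * R \<le> real \<rho>" using R unfolding \<rho>_def by linarith+
  obtain C c where C: "0 < C" and c: "0 < c" and S: "\<forall>m::nat. 1 \<le> m \<longrightarrow> (\<exists>S. finite S \<and> (\<forall>k\<in>S. k \<in> Zd \<and> 0 \<le> \<omega> \<bullet> k \<and> \<omega> \<bullet> k < \<eta> \<and> infnorm k \<le> C * real m)
       \<and> (\<forall>k\<in>S. \<forall>l\<in>S. k \<noteq> l \<longrightarrow> real \<rho> \<le> infnorm (k - l)) \<and> c * real m ^ (CARD('n) - 1) \<le> real (card S))"
    by (rule almost_periods[OF unit_dir \<rho>(1) \<eta>])
  obtain C' where C': "0 < C'" and err: "\<forall>N x. infnorm k0 + 1 \<le> N \<longrightarrow> 0 \<le> x \<longrightarrow>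
       (\<forall>r\<in>{N..2*N}. ennreal x \<le> Per (cube (- k0) r - cube 0 r) E + interaction (cube 0 r) (translate k0 E - E - cube 0 r))
       \<longrightarrow> N * x \<le> C' * N powr (real CARD('n) - s)"
    using error_bound[OF E birkhoff k0(1,3)] by auto
  \<comment> \<open>With this factor the cube of radius \<open>\<Lambda> * real m\<close> contains
    the cubes of radius \<open>R\<close> around all \<open>k + k0\<close>.\<close>
  define \<Lambda> where "\<Lambda> = C + infnorm k0 + R + 1"
  have \<Lambda>: "0 < \<Lambda>" using C R infnorm_pos_le[of k0] by (simp add: \<Lambda>_def)
  define H where "H = C' * \<Lambda> powr (D - s) / (\<Lambda> * (c * (\<delta>/2)))"
  have bound: "real m powr s \<le> H" if m: "1 \<le> m" for m :: nat
  proof -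
    obtain S where fin: "finite S" and S1: "\<And>k. k \<in> S \<Longrightarrow> k \<in> Zd \<and> 0 \<le> \<omega> \<bullet> k \<and> \<omega> \<bullet> k < \<eta>"
      and S2: "\<And>k. k \<in> S \<Longrightarrow> infnorm k \<le> C * real m" and S3: "\<And>k l. k \<in> S \<Longrightarrow> l \<in> S \<Longrightarrow> k \<noteq> l \<Longrightarrow> real \<rho> \<le> infnorm (k - l)"
      and S4: "c * real m ^ (CARD('n) - 1) \<le> real (card S)"
      using S[rule_format, OF m] by blast
    let ?N = "\<Lambda> * real m"
    have m0: "0 < real m" "1 \<le> real m" using m by auto
    have N: "C * real m + infnorm k0 + R + 1 \<le> ?N"
    proof -
      have "(infnorm k0 + R + 1) * 1 \<le> (infnorm k0 + R + 1) * real m"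
        using m0 R infnorm_pos_le[of k0] by (intro mult_left_mono) auto
      then show ?thesis by (simp add: \<Lambda>_def algebra_simps)
    qed
    have e1: "?N * (real (card S) * (\<delta>/2)) \<le> C' * ?N powr (real CARD('n) - s)"
    proof (rule err[rule_format])
      have "0 \<le> C * real m" using C by simp
      then show "infnorm k0 + 1 \<le> ?N" using N R by linarith
      show "0 \<le> real (card S) * (\<delta>/2)" using \<delta> by simp
      fix r assume "r \<in> {?N..2 * ?N}"
      then have r: "?N \<le> r" by simp
      show "ennreal (real (card S) * (\<delta>/2)) \<le> Per (cube (- k0) r - cube 0 r) E + interaction (cube 0 r) (translate k0 E - E - cube 0 r)"
      proof (rule removal_cost[OF unit_dir E birkhoff A \<delta> gain small left_cont\<eta> fin S1 _ k0])
        fix k l assume kl: "k \<in> S" "l \<in> S" "k \<noteq> l"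
        show "cube k R \<inter> cube l R = {}"
        proof (rule ccontr)
          assume "\<not> ?thesis"
          then obtain x where "infnorm (x - k) < R" "infnorm (x - l) < R" by (auto simp: cube_def)
          then have "infnorm (k - l) < 2 * R"
            using infnorm_triangle[of "k - x" "x - l"] by (simp add: infnorm_sub)
          then show False using S3[OF kl] \<rho> by simp
        qed
      next
        fix k assume k: "k \<in> S"
        have "infnorm (k + k0) \<le> C * real m + infnorm k0" using S2[OF k] infnorm_triangle[of k k0] by simp
        then show "cube (k + k0) R \<subseteq> cube 0 r" using N r by (intro cube_subset_cube) simp
      qed
    qed
    have e2: "?N * (c * real m powr (D - 1) * (\<delta>/2)) \<le> ?N * (real (card S) * (\<delta>/2))"
    proof -
      have "real m ^ (CARD('n) - 1) = real m powr (D - 1)"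
        using m0 powr_realpow[of "real m" "CARD('n) - 1", unfolded D1] by simp
      then show ?thesis using S4 \<Lambda> \<delta> m0 by (intro mult_left_mono mult_right_mono) auto
    qed
    have "?N * (c * real m powr (D - 1) * (\<delta>/2)) \<le> C' * ?N powr (D - s)"
      using e2 e1 unfolding D_def by (rule order_trans)
    also have "?N powr (D - s) = \<Lambda> powr (D - s) * real m powr (D - s)"
      by (rule powr_mult)
    finally have "?N * (c * real m powr (D - 1) * (\<delta>/2)) \<le> C' * (\<Lambda> powr (D - s) * real m powr (D - s))" .
    \<comment> \<open>After multiplication by the radius the gain is of order
      \<open>m powr D\<close> and the cost of order \<open>m powr (D - s)\<close>, so
      \<open>m powr s\<close> would stay bounded.\<close>
    moreover have "?N * (c * real m powr (D - 1) * (\<delta>/2)) = (\<Lambda> * (c * (\<delta>/2))) * (real m powr s * real m powr (D - s))"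
    proof -
      have "real m powr s * real m powr (D - s) = real m * real m powr (D - 1)"
        using powr_add[of "real m" s "D - s"] powr_add[of "real m" 1 "D - 1"] m0 by simp
      then show ?thesis by (simp add: ac_simps)
    qed
    ultimately have "((\<Lambda> * (c * (\<delta>/2))) * real m powr s) * real m powr (D - s) \<le> (C' * \<Lambda> powr (D - s)) * real m powr (D - s)"
      by (simp only: mult.assoc)
    then have "(\<Lambda> * (c * (\<delta>/2))) * real m powr s \<le> C' * \<Lambda> powr (D - s)"
      using m0 by (simp add: mult_le_cancel_right)
    then show ?thesis using \<Lambda> c \<delta> by (simp add: H_def field_simps)
  qed
  have H: "0 \<le> H" using bound[of 1] by simp
  obtain m :: nat where m: "(H + 1) powr (1 / s) < real m" using reals_Archimedean2 by blast
  have "1 \<le> (H + 1) powr (1 / s)" using H s by (intro ge_one_powr_ge_zero) auto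
  then have "1 \<le> m" using m by linarith
  have "H + 1 = ((H + 1) powr (1 / s)) powr s" using H s by (simp add: powr_powr)
  also have "\<dots> \<le> real m powr s" using m s by (intro powr_mono2) auto
  also have "\<dots> \<le> H" by (rule bound[OF \<open>1 \<le> m\<close>])
  finally show False by simp
qed

subsection \<open>Planelike minimizers\<close>

lemma planelike_below:
  assumes unit_dir: "unit_dir \<omega>" and ab: "a \<le> b" and E: "least_obstacle_min (staircase \<omega> a) (staircase \<omega> b) E" and room: "E \<sqsubseteq> staircase \<omega> (b - 1)"
  obtains E' where "obstacle_min {} UNIV E'" "staircase \<omega> a \<sqsubseteq> E'" "E' \<sqsubseteq> staircase \<omega> b"
proof -
  have "obstacle_min (staircase \<omega> a) UNIV E" using obstacle_min_remove_upper[OF unit_dir ab E room] .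
  from left_continuous_version[OF this least_obstacle_min_birkhoff[OF E] obstacle_min_upper[OF least_obstacle_min_imp[OF E]]]
  obtain E' where E': "obstacle_min (staircase \<omega> a) UNIV E'" "birkhoff \<omega> E'" "E' \<sqsubseteq> staircase \<omega> b" "left_cont \<omega> E'" .
  show thesis using that[OF left_cont_obstacle_free[OF unit_dir E'(1,2,4)] obstacle_min_lower[OF E'(1)] E'(3)] .
qed

lemma planelike:
  assumes unit_dir: "unit_dir \<omega>" and m: "2 \<le> m"
    and large: "Lam * near_const (real CARD('n)) s * 4 ^ CARD('n) * (2 * real m) powr (real CARD('n) - s)
       < real m ^ CARD('n) * (lam * 4 powr - (real CARD('n) + s) * (density_threshold TYPE('n)) ^ 2)"
  defines "M \<equiv> 8 * real m + 13"
  obtains E where "obstacle_min {} UNIV E" "{x. \<omega> \<bullet> x < - M} \<subseteq> E" "E \<subseteq> {x. \<omega> \<bullet> x \<le> M}"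
proof -
  note unit_dir' = unit_dir_uminus[OF unit_dir]
  define b where "b = 8 * real m + 10"
  \<comment> \<open>The margin 3 is dictated by the staircases for \<open>- \<omega>\<close>, whose
    levels are shifted by 2 and which miss their levels by up to 1.\<close>
  have b: "0 \<le> b" "M = b + 3" by (auto simp: b_def M_def)
  obtain E where E: "least_obstacle_min (staircase \<omega> 0) (staircase \<omega> b) E" using b by (rule_tac least_obstacle_min_staircase) auto
  have b2: "- 2 - b \<le> - 2" using b by simp
  obtain E' where E': "least_obstacle_min (staircase (- \<omega>) (- 2 - b)) (staircase (- \<omega>) (- 2)) E'" by (rule least_obstacle_min_staircase[OF b2])
  have "\<exists>F. obstacle_min {} UNIV F \<and> {x. \<omega> \<bullet> x < - M} \<sqsubseteq> F \<and> F \<sqsubseteq> {x. \<omega> \<bullet> x \<le> M}"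
    using least_obstacle_min_dichotomy[OF unit_dir m large b_def E E']
  proof
    assume "E \<sqsubseteq> staircase \<omega> (b - 1)"
    then obtain F where F: "obstacle_min {} UNIV F" "staircase \<omega> 0 \<sqsubseteq> F" "F \<sqsubseteq> staircase \<omega> b" using planelike_below[OF unit_dir b(1) E] by blast
    have "{x. \<omega> \<bullet> x < - M} \<subseteq> staircase \<omega> 0" "staircase \<omega> b \<subseteq> {x. \<omega> \<bullet> x \<le> M}"
      using b by (auto intro!: staircase_lower[OF unit_dir] dest!: staircase_upper[OF unit_dir])
    then show ?thesis using F by (meson ae_subset_subset ae_subset_trans)
  next
    assume "E' \<sqsubseteq> staircase (- \<omega>) (- 3)"
    then have "E' \<sqsubseteq> staircase (- \<omega>) (- 2 - 1)" by simp
    then obtain F where F: "obstacle_min {} UNIV F" "staircase (- \<omega>) (- 2 - b) \<sqsubseteq> F" "F \<sqsubseteq> staircase (- \<omega>) (- 2)"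
      using planelike_below[OF unit_dir' b2 E'] by blast
    have "{x. \<omega> \<bullet> x < - M} \<subseteq> - staircase (- \<omega>) (- 2)"
      using b staircase_upper[OF unit_dir'] by fastforce
    moreover have "- staircase (- \<omega>) (- 2 - b) \<subseteq> {x. \<omega> \<bullet> x \<le> M}"
    proof
      fix x assume x: "x \<in> - staircase (- \<omega>) (- 2 - b)"
      have "x \<in> staircase (- \<omega>) (- 2 - b)" if "M < \<omega> \<bullet> x" using that b by (intro staircase_lower[OF unit_dir']) simp
      then show "x \<in> {x. \<omega> \<bullet> x \<le> M}" using x by (auto simp: not_le[symmetric])
    qed
    moreover have "- staircase (- \<omega>) (- 2) \<sqsubseteq> - F" "- F \<sqsubseteq> - staircase (- \<omega>) (- 2 - b)"
      using F by (auto simp: ae_subset_Compl_iff)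
    moreover have "obstacle_min {} UNIV (- F)" using obstacle_min_Compl[OF F(1)] by simp
    ultimately show ?thesis by (meson ae_subset_subset ae_subset_trans)
  qed
  then obtain F where F: "obstacle_min {} UNIV F" "{x. \<omega> \<bullet> x < - M} \<sqsubseteq> F" "F \<sqsubseteq> {x. \<omega> \<bullet> x \<le> M}" by blast
  have [measurable]: "F \<in> sets borel" using F(1) by (rule obstacle_min_borel)
  \<comment> \<open>The inclusions hold almost everywhere so far; changing \<open>F\<close> on a
    null set makes them exact.\<close>
  let ?G = "(F \<union> {x. \<omega> \<bullet> x < - M}) \<inter> {x. \<omega> \<bullet> x \<le> M}"
  have G: "?G \<in> sets borel" by measurable
  show thesis
  proof
    show "obstacle_min {} UNIV ?G"
    proof (rule obstacle_min_cong[OF F(1) _ _ G])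
      show "F \<sqsubseteq> ?G" using F(3) unfolding ae_subset_def by eventually_elim auto
      show "?G \<sqsubseteq> F" using F(2) unfolding ae_subset_def by eventually_elim auto
    qed
    show "{x. \<omega> \<bullet> x < - M} \<subseteq> ?G" by (auto simp: M_def)
  qed auto
qed

end

section \<open>Choice of the scale and transfer to the given kernel\<close>

lemma large_scale_exists:
  fixes A B s :: real
  assumes A: "0 \<le> A" and B: "0 < B" and s: "0 < s"
  obtains m :: nat where "2 \<le> m" "A * (2 * real m) powr (real n - s) < real m ^ n * B"
proof -
  \<comment> \<open>After division by \<open>B * real m powr (real n - s)\<close> the claim reads
    \<open>H < real m powr s\<close>.\<close>
  define H where "H = A * 2 powr (real n - s) / B"
  have H: "0 \<le> H" using A B by (simp add: H_def)
  obtain m0 :: nat where m0: "(H + 1) powr (1 / s) < real m0" using reals_Archimedean2 by blast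
  define m where "m = max m0 2"
  have m: "2 \<le> m" "(H + 1) powr (1 / s) < real m" using m0 by (auto simp: m_def)
  have "H < ((H + 1) powr (1 / s)) powr s" using H s by (simp add: powr_powr)
  also have "\<dots> \<le> real m powr s" using m s by (intro powr_mono2) auto
  finally have lt: "A * 2 powr (real n - s) < B * real m powr s" using B by (simp add: H_def field_simps)
  have "A * (2 * real m) powr (real n - s) = A * 2 powr (real n - s) * real m powr (real n - s)"
    by (simp add: powr_mult)
  also have "\<dots> < B * real m powr s * real m powr (real n - s)"
    using lt m by (intro mult_strict_right_mono) auto
  also have "\<dots> = B * (real m powr s * real m powr (real n - s))" by simp
  also have "real m powr s * real m powr (real n - s) = real m ^ n"
    using m by (subst powr_add[symmetric]) (simp add: powr_realpow)
  finally show thesis using m that by (simp add: mult.commute)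
qed

lemma infnorm_le_l1norm: "infnorm x \<le> l1norm x"
  unfolding infnorm_le_iff_cart l1norm_def by (auto intro: member_le_sum)

lemma l1norm_le_infnorm: "l1norm (x :: real^'n) \<le> real CARD('n) * infnorm x"
  unfolding l1norm_def using sum_mono[of UNIV "\<lambda>i. \<bar>x $ i\<bar>" "\<lambda>_. infnorm x"]
  by (auto intro: component_le_infnorm_cart)

text \<open>Duality of the l1 norm and the sup norm.\<close>

lemma unit_dir_l1_normalized:
  assumes "\<omega> \<noteq> 0"
  shows "unit_dir (inverse (l1norm \<omega>) *\<^sub>R \<omega>)"
  unfolding unit_dir_def
proof (intro conjI allI)
  have pos: "0 < l1norm \<omega>"
    using infnorm_le_l1norm[of \<omega>] assms infnorm_pos_lt[of \<omega>] by linarith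
  then show "inverse (l1norm \<omega>) *\<^sub>R \<omega> \<noteq> 0" using assms by simp
  fix x
  have "\<bar>\<omega> \<bullet> x\<bar> \<le> (\<Sum>i\<in>UNIV. \<bar>\<omega> $ i * x $ i\<bar>)" unfolding inner_vec_def by (simp add: sum_abs)
  also have "\<dots> \<le> (\<Sum>i\<in>UNIV. \<bar>\<omega> $ i\<bar> * infnorm x)"
    by (intro sum_mono) (simp add: abs_mult mult_left_mono component_le_infnorm_cart)
  also have "\<dots> = l1norm \<omega> * infnorm x" by (simp add: l1norm_def sum_distrib_right)
  finally show "\<bar>inverse (l1norm \<omega>) *\<^sub>R \<omega> \<bullet> x\<bar> \<le> infnorm x"
    using pos by (simp add: abs_mult field_simps)
qed

lemma lebesgue_set_borel_version:
  fixes F :: "(real^'n) set"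
  assumes "F \<in> sets lebesgue"
  obtains F' where "F' \<in> sets borel" "AE x in lborel. x \<in> F \<longleftrightarrow> x \<in> F'"
proof -
  have "(indicator F :: _ \<Rightarrow> ennreal) \<in> borel_measurable (completion lborel)"
    using assms by (intro borel_measurable_indicator) simp
  from completion_ex_borel_measurable[OF this]
  obtain g :: "real^'n \<Rightarrow> ennreal" where g: "g \<in> borel_measurable lborel" "AE x in lborel. indicator F x = g x" by blast
  have "g -` {1} \<in> sets borel" using measurable_sets[OF g(1), of "{1}"] by simp
  moreover have "AE x in lborel. x \<in> F \<longleftrightarrow> x \<in> g -` {1}"
    using g(2) by (auto elim!: eventually_mono simp: indicator_def split: if_splits)
  ultimately show thesis using that by blast
qed

lemma AE_lebesgue2: "(AE p in lebesgue2. P p) \<longleftrightarrow> (AE p in lborel. P p)"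
  unfolding lebesgue2_def AE_completion_iff lborel_prod ..

lemma AE_lborel_swap:
  fixes P :: "(real^'n) \<times> (real^'n) \<Rightarrow> bool"
  assumes "AE p in lborel. P p" shows "AE p in lborel. P (snd p, fst p)"
proof -
  have "AE p in distr (lborel \<Otimes>\<^sub>M lborel) (lborel \<Otimes>\<^sub>M lborel) (\<lambda>(x, y). (y, x)). P p"
    using assms lborel_pair.distr_pair_swap by (metis lborel_prod)
  then have "AE p in (lborel \<Otimes>\<^sub>M lborel). P ((\<lambda>(x, y). (y, x)) p)"
    by (rule AE_distrD[rotated]) simp
  then show ?thesis unfolding lborel_prod case_prod_beta .
qed

text \<open>From \<open>infnorm h \<le> l1norm h \<le> d * infnorm h\<close> only the lower bound on
  the kernel loses a factor, \<open>d powr - (d + s)\<close>. The Borel version differs from the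
  given kernel on a null set of pairs, so symmetry and periodicity carry over.\<close>

lemma kernel_ok_kernel:
  fixes K :: "real ^ 'n \<Rightarrow> real ^ 'n \<Rightarrow> ennreal"
  assumes ok: "kernel_ok s lam Lam K" and s: "0 < s" "s < 1" and lam: "0 < lam" "lam \<le> Lam"
  obtains K' where "kernel K' s (lam * real CARD('n) powr - (real CARD('n) + s)) Lam"
    "AE p in lborel. K (fst p) (snd p) = K' p"
proof -
  define D where "D = real CARD('n)"
  have D: "0 < D" by (simp add: D_def)
  have m: "(\<lambda>p. K (fst p) (snd p)) \<in> borel_measurable (completion (lborel \<Otimes>\<^sub>M lborel))"
    and sym: "AE p in lborel. K (fst p) (snd p) = K (snd p) (fst p)"
    and bd: "AE p in lborel. ennreal (lam * l1norm (fst p - snd p) powr (- (D + s))) \<le> K (fst p) (snd p) \<and>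
        K (fst p) (snd p) \<le> ennreal (Lam * l1norm (fst p - snd p) powr (- (D + s)))"
    and per: "\<And>z. z \<in> Zd \<Longrightarrow> AE p in lborel. K (fst p + z) (snd p + z) = K (fst p) (snd p)"
    using ok by (auto simp: kernel_ok_def AE_lebesgue2 D_def Zd_def lebesgue2_def[symmetric])
  obtain K' where K'm: "K' \<in> borel_measurable (lborel \<Otimes>\<^sub>M lborel)" and "AE p in lborel \<Otimes>\<^sub>M lborel. K (fst p) (snd p) = K' p"
    using completion_ex_borel_measurable[OF m] by blast
  then have eq: "AE p in lborel. K (fst p) (snd p) = K' p" by (simp only: lborel_prod)
  have "AE p in (lborel :: ((real^'n) \<times> (real^'n)) measure). lam * D powr - (D + s) * infnorm (fst p - snd p) powr - (D + s) \<le> lam * l1norm (fst p - snd p) powr - (D + s)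
      \<and> Lam * l1norm (fst p - snd p) powr - (D + s) \<le> Lam * infnorm (fst p - snd p) powr - (D + s)"
  proof (rule AE_I2)
    fix p :: "(real^'n) \<times> (real^'n)"
    let ?h = "fst p - snd p"
    show "lam * D powr - (D + s) * infnorm ?h powr - (D + s) \<le> lam * l1norm ?h powr - (D + s)
      \<and> Lam * l1norm ?h powr - (D + s) \<le> Lam * infnorm ?h powr - (D + s)"
    proof (cases "?h = 0")
      \<comment> \<open>On the diagonal all powers are 0 by convention.\<close>
      case True
      then show ?thesis by (simp add: l1norm_def infnorm_0)
    next
      case False
      then have i: "0 < infnorm ?h" using infnorm_pos_lt by blast
      have l: "0 < l1norm ?h" using i infnorm_le_l1norm[of ?h] by linarith
      have "D powr - (D + s) * infnorm ?h powr - (D + s) = (D * infnorm ?h) powr - (D + s)"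
        by (rule powr_mult[symmetric])
      also have "\<dots> \<le> l1norm ?h powr - (D + s)"
        using l l1norm_le_infnorm[of ?h] D s by (intro powr_mono2') (auto simp: D_def)
      finally have "D powr - (D + s) * infnorm ?h powr - (D + s) \<le> l1norm ?h powr - (D + s)" .
      moreover have "l1norm ?h powr - (D + s) \<le> infnorm ?h powr - (D + s)"
        using i infnorm_le_l1norm[of ?h] D s by (intro powr_mono2') auto
      ultimately show ?thesis using lam by (auto simp: mult.assoc intro!: mult_left_mono)
    qed
  qed
  then have bd': "AE p in lborel. ennreal (lam * D powr - (D + s) * infnorm (fst p - snd p) powr - (D + s)) \<le> K' p
      \<and> K' p \<le> ennreal (Lam * infnorm (fst p - snd p) powr - (D + s))"
    using bd eq
  proof eventually_elim
    case (elim p)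
    show ?case
      using order_trans[OF ennreal_leI[OF conjunct1[OF elim(1)]] conjunct1[OF elim(2)]]
        order_trans[OF conjunct2[OF elim(2)] ennreal_leI[OF conjunct2[OF elim(1)]]]
      unfolding elim(3) by (rule conjI)
  qed
  have "kernel K' s (lam * D powr - (D + s)) Lam"
  proof
    show "K' \<in> borel_measurable borel" using K'm by (simp add: lborel_prod)
    show "AE p in lborel. K' (snd p, fst p) = K' p"
      using eq sym AE_lborel_swap[OF eq] by eventually_elim auto
    show "AE p in lborel. K' (fst p + k, snd p + k) = K' p" if k: "k \<in> Zd" for k
    proof -
      have "AE p in lborel. K (fst (p - (- k, - k))) (snd (p - (- k, - k))) = K' (p - (- k, - k))"
        using eq AE_translate_iff[of "\<lambda>p. K (fst p) (snd p) = K' p" "(- k, - k)"] by simp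
      then show ?thesis using eq per[OF k] by eventually_elim (simp add: minus_prod_def)
    qed
  qed (use s lam D bd' in \<open>auto simp: D_def elim: eventually_mono\<close>)
  then show thesis using that eq by (simp add: D_def)
qed

text \<open>For a Borel version \<open>F\<close> the three products in \<open>PerK\<close> are
  disjoint with union \<open>cut \<Omega> F\<close>, and almost every pair has both ends where
  \<open>E\<close> and \<open>F\<close> agree.\<close>

lemma (in kernel) PerK_eq_Per:
  fixes K0 :: "real ^ 'n \<Rightarrow> real ^ 'n \<Rightarrow> ennreal"
  assumes eq: "AE p in lborel. K0 (fst p) (snd p) = K p"
    and [measurable]: "F \<in> sets borel" "\<Omega> \<in> sets borel" and FE: "AE x in lborel. x \<in> E \<longleftrightarrow> x \<in> F"
  shows "PerK K0 E \<Omega> = Per \<Omega> F"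
proof -
  have LK: "LK K0 A B = interaction A' B'"
    if [measurable]: "A' \<in> sets borel" "B' \<in> sets borel"
      and A: "\<And>x. (x \<in> E \<longleftrightarrow> x \<in> F) \<Longrightarrow> x \<in> A \<longleftrightarrow> x \<in> A'" and B: "\<And>x. (x \<in> E \<longleftrightarrow> x \<in> F) \<Longrightarrow> x \<in> B \<longleftrightarrow> x \<in> B'"
    for A B A' B'
  proof -
    have "LK K0 A B = (\<integral>\<^sup>+p. indicator (A \<times> B) p * K0 (fst p) (snd p) \<partial>lborel)"
      unfolding LK_def lebesgue2_def by (simp add: nn_integral_completion lborel_prod)
    also have "\<dots> = (\<integral>\<^sup>+p. K p * indicator (A' \<times> B') p \<partial>lborel)"
    proof (rule nn_integral_cong_AE)
      show "AE p in lborel. indicator (A \<times> B) p * K0 (fst p) (snd p) = K p * indicator (A' \<times> B') p"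
        using eq AE_lborel_pair[OF FE FE]
        by eventually_elim (use A B in \<open>auto simp: indicator_def mem_Times_iff\<close>)
    qed
    also have "\<dots> = interaction A' B'" by (rule interaction_nn_integral[symmetric]) auto
    finally show ?thesis .
  qed
  let ?X1 = "(F \<inter> \<Omega>) \<times> (\<Omega> - F)" and ?X2 = "(F \<inter> \<Omega>) \<times> (UNIV - (F \<union> \<Omega>))" and ?X3 = "(F - \<Omega>) \<times> (\<Omega> - F)"
  have b: "?X1 \<in> sets mu" "?X2 \<in> sets mu" "?X3 \<in> sets mu"
    by (simp_all only: sets_mu) (intro borel_Times; measurable)+
  have "PerK K0 E \<Omega> = interaction (F \<inter> \<Omega>) (\<Omega> - F) + interaction (F \<inter> \<Omega>) (UNIV - (F \<union> \<Omega>)) + interaction (F - \<Omega>) (\<Omega> - F)"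
    unfolding PerK_def by (intro arg_cong2[where f = "(+)"] LK) auto
  also have "\<dots> = emeasure mu (?X1 \<union> ?X2) + emeasure mu ?X3"
    unfolding interaction_def using b by (subst plus_emeasure) auto
  also have "\<dots> = emeasure mu (?X1 \<union> ?X2 \<union> ?X3)"
    using b by (intro plus_emeasure) auto
  also have "?X1 \<union> ?X2 \<union> ?X3 = cut \<Omega> F" by (auto simp: cut_def)
  finally show ?thesis by (simp add: Per_def)
qed

lemma (in kernel) obstacle_min_classA_minimal:
  fixes K0 :: "real ^ 'n \<Rightarrow> real ^ 'n \<Rightarrow> ennreal"
  assumes eq: "AE p in lborel. K0 (fst p) (snd p) = K p" and E: "obstacle_min {} UNIV E"
  shows "classA_minimal K0 E"
  unfolding classA_minimal_def minimizer_in_def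
proof (intro allI impI conjI ballI)
  fix \<Omega> :: "(real^'n) set" assume \<Omega>: "open \<Omega> \<and> bounded \<Omega>"
  have [measurable]: "\<Omega> \<in> sets borel" using \<Omega> by auto
  have [measurable]: "E \<in> sets borel" using E by (rule obstacle_min_borel)
  have PE: "PerK K0 E \<Omega> = Per \<Omega> E" by (rule PerK_eq_Per[OF eq]) auto
  show "E \<in> sets lebesgue" by simp
  show "PerK K0 E \<Omega> < \<infinity>" unfolding PE using \<Omega> by (intro locally_finite_bounded[OF obstacle_min_locally_finite[OF E]]) auto
  fix F assume F: "F \<in> sets lebesgue" "F - \<Omega> = E - \<Omega>"
  obtain F' where F': "F' \<in> sets borel" "AE x in lborel. x \<in> F \<longleftrightarrow> x \<in> F'"
    using lebesgue_set_borel_version[OF F(1)] .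
  have [measurable]: "F' \<in> sets borel" by (rule F')
  \<comment> \<open>The Borel version is replaced by \<open>E\<close> outside \<Omega>, so that the
    two agree there exactly and not only almost everywhere.\<close>
  let ?F = "F' \<inter> \<Omega> \<union> (E - \<Omega>)"
  have "PerK K0 F \<Omega> = Per \<Omega> ?F"
  proof (rule PerK_eq_Per[OF eq])
    show "AE x in lborel. x \<in> F \<longleftrightarrow> x \<in> ?F" using F'(2) by eventually_elim (use F(2) in blast)
  qed auto
  moreover have "Per \<Omega> E \<le> Per \<Omega> ?F" using \<Omega> by (intro obstacle_min_le[OF E]) auto
  ultimately show "PerK K0 E \<Omega> \<le> PerK K0 F \<Omega>" by (simp add: PE)
qed

theorem theorem1p3:
  fixes s lam Lam :: real
  assumes "CARD('n::finite) \<ge> 2"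
    and "0 < s" and "s < 1" and "0 < lam" and "lam \<le> Lam"
  shows "\<exists>M0>0. \<forall>K :: real ^ 'n \<Rightarrow> real ^ 'n \<Rightarrow> ennreal. kernel_ok s lam Lam K \<longrightarrow>
           (\<forall>\<omega>::real^'n. \<omega> \<noteq> 0 \<longrightarrow>
              (\<exists>E. classA_minimal K E \<and>
                   {x. (inverse (l1norm \<omega>) *\<^sub>R \<omega>) \<bullet> x < - M0} \<subseteq> E \<and>
                   E \<subseteq> {x. (inverse (l1norm \<omega>) *\<^sub>R \<omega>) \<bullet> x \<le> M0}))"
proof -
  let ?n = "CARD('n)"
  define lam' where "lam' = lam * real ?n powr - (real ?n + s)"
  define c where "c = Lam * near_const (real ?n) s"
  have c: "0 < c" using assms near_const_pos[of s] by (simp add: c_def)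
  have lam': "0 < lam'" using assms by (simp add: lam'_def)
  let ?eps = "recursion_threshold (2 * c / lam') s (1 / (1 - s / real ?n))"
  have "0 < ?eps" using c lam' by (intro recursion_threshold_pos) simp
  then have "0 < lam' * 4 powr - (real ?n + s) * ?eps ^ 2" using lam' by simp
  moreover have "0 \<le> c * 4 ^ ?n" using c by simp
  \<comment> \<open>The scale is fixed from \<open>d\<close>, \<open>s\<close>, \<open>lam\<close>
    and \<open>Lam\<close> alone, before \<open>K\<close> and \<omega> are introduced.\<close>
  ultimately obtain m :: nat where m: "2 \<le> m"
    and large: "c * 4 ^ ?n * (2 * real m) powr (real ?n - s) < real m ^ ?n * (lam' * 4 powr - (real ?n + s) * ?eps ^ 2)"
    using assms(2) by (rule_tac large_scale_exists)
  show ?thesis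
  proof (intro exI[of _ "8 * real m + 13"] conjI allI impI)
    fix K :: "real ^ 'n \<Rightarrow> real ^ 'n \<Rightarrow> ennreal" and \<omega> :: "real ^ 'n"
    assume K: "kernel_ok s lam Lam K" and \<omega>: "\<omega> \<noteq> 0"
    obtain K' where K': "kernel K' s lam' Lam" "AE p in lborel. K (fst p) (snd p) = K' p"
      using kernel_ok_kernel[OF K assms(2-5)] unfolding lam'_def .
    interpret kernel K' s lam' Lam by (rule K')
    obtain E where "obstacle_min {} UNIV E" "{x. (inverse (l1norm \<omega>) *\<^sub>R \<omega>) \<bullet> x < - (8 * real m + 13)} \<subseteq> E"
      "E \<subseteq> {x. (inverse (l1norm \<omega>) *\<^sub>R \<omega>) \<bullet> x \<le> 8 * real m + 13}"
      using planelike[OF unit_dir_l1_normalized[OF \<omega>] m] large unfolding c_def by blast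
    then show "\<exists>E. classA_minimal K E \<and>
                   {x. (inverse (l1norm \<omega>) *\<^sub>R \<omega>) \<bullet> x < - (8 * real m + 13)} \<subseteq> E \<and>
                   E \<subseteq> {x. (inverse (l1norm \<omega>) *\<^sub>R \<omega>) \<bullet> x \<le> 8 * real m + 13}"
      using obstacle_min_classA_minimal[OF K'(2)] by blast
  qed simp
qed

end
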